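(* Let $\sigma$ be a finite sequence of transitions and let $n=|X|$. Consider the following procedure. 1. If $\sigma$ satisfies one of (C1), (C2), (C3), report that $\sigma$ is not $\omega$-iterable. 2. Otherwise, if there is no clock $x\in X_0$ with an atomic guard $x\succcurlyeq c$, $c>0$, in $\sigma$, report that $\sigma$ is $\omega$-iterable. Otherwise replace $\sigma$ by $\sigma_{X_0}$ (remove all atomic guards on clocks not in $X_0$) and continue. 3. Compute $G^1=|G_\sigma|$; if $G_\sigma$ has a negative cycle, stop. 4. For $k=0,1,2,\dots$ compute $G^{2^{k+1}}=G^{2^k}\cdot G^{2^k}$; stop if $G^{2^k}\odot G^{2^k}$ has a negative cycle, or if $2^k>n^2$, or if $G^{2^{k+1}}\bumpeq G^{2^k}$. Then: if the procedure stops in step 3 or 4 because of a negative cycle, or because $2^k>n^2$, then $\sigma$ is not $\omega$-iterable; if it stops because $G^{2^{k+1}}\bumpeq G^{2^k}$, then the zone defined by $\mathit{left}(G^{2^k})$ consists precisely of the valuations from which the (reduced) sequence $\sigma$ is $\omega$-iterable. Here: (C1) For some clock $y\in X(\sigma)\setminus X_0$, $\sigma$ contains atomic guards $y\preccurlyeq d$ and $y\succcurlyeq c$ with $d<c$, or with $d=c$ and $\preccurlyeq$ being $<$, or with $d=c$ and $\succcurlyeq$ being $>$. (C2) There are clocks $x\in X_0$ and $y\in X(\sigma)\setminus X_0$ such that $\sigma$ contains atomic guards $y\preccurlyeq d$ and $x\succcurlyeq c$ with $c>0$. (C3) For some clock $x\in X_0$ the atomic guard $x>0$ occurs in $\sigma$,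 and for some clock $y\in X(\sigma)\setminus X_0$ both $y\le c$ and $y\ge c$ occur in $\sigma$ (for the same $c$).
   Context: Fix a finite set of clocks $X=\{x_0,\dots,x_m\}$ ($x_0$ a reference clock). Valuations $v:X\to\mathbb{R}_{\ge0}$ satisfy $v(x_0)=0$; a transition is a pair $(g,R)$ of a guard (conjunction of atomic constraints $x\sim c$, $x\ne x_0$, $\sim\in\{<,\le,=,\ge,>\}$, $c\in\mathbb{N}$) and a reset set $R\subseteq X\setminus\{x_0\}$; $v\xrightarrow{(g,R)}^{\delta}v'$ iff $v+\delta\models g$ and $v'=[R](v+\delta)$ (delay $\delta\ge0$ added to all clocks except $x_0$, then the clocks of $R$ reset to $0$). A sequence $\sigma$ is $\omega$-iterable from $v_0$ if there are valuations $v_1,v_2,\dots$ such that each $v_{j+1}$ is reached from $v_j$ by executing the whole sequence $\sigma$ (with some delays); it is $\omega$-iterable if it is so from some valuation. $X(\sigma)$ is the set of clocks appearing in $\sigma$, $X_0$ the set of clocks reset somewhere in $\sigma$. $\preccurlyeq$ stands for $<$ or $\le$, $\succcurlyeq$ for $>$ or $\ge$; an atomic guard $x=c$ counts both as $x\le c$ and $x\ge c$. A weight is a pair $(\preccurlyeq,d)$, $\preccurlyeq\in\{<,\le\}$, $d\in\mathbb{Z}$; weights are added by $(\preccurlyeq_1,d_1)+(\preccurlyeq_2,d_2)=(\preccurlyeq,d_1+d_2)$, $\preccurlyeq$ being $<$ iff one of them is $<$, and ordered by $(\preccurlyeq,d)<(\preccurlyeq',d')$ iff $d<d'$, or $d=d'$,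 $\preccurlyeq$ is $<$ and $\preccurlyeq'$ is $\le$; negative means smaller than $(\le,0)$. A transformation graph with $k+1$ columns is a directed graph on $\{0,\dots,k\}\times X$ with weighted edges. $G_\sigma$ is the composition $G_{t_1}\odot\cdots\odot G_{t_k}$ for $\sigma=t_1\cdots t_k$, where for $t=(g,R)$, $G_t$ has vertices $\{0,1,2\}\times X$ and edges (weight $(\le,0)$ unless stated): $(0,x_0)\to(1,x_0)$; $(0,x)\leftrightarrow(1,x)$ for $x\ne x_0$; $(1,x_0)\to(1,x)$ of weight $(\preccurlyeq,c)$ for each atomic guard $x\preccurlyeq c$; $(1,x)\to(1,x_0)$ of weight $(<,-c)$ resp. $(\le,-c)$ for each atomic guard $x>c$ resp. $x\ge c$; $(1,x)\leftrightarrow(2,x)$ for $x\notin R$; $(1,x)\to(2,x)$ and $(2,x_0)\leftrightarrow(2,x)$ for $x\in R$. Composition $G_1\odot G_2$ (with $k_1$, $k_2$ columns) has vertices $\{0,\dots,k_1+k_2-1\}\times X$, the edges of $G_1$, those of $G_2$ shifted by $k_1$ columns, and $(\le,0)$-edges $(k_1-1,x)\leftrightarrow(k_1,x)$ for all $x$. The canonical form of a graph without negative cycles has an edge $u\to w$ for each pair of distinct vertices joined by a path, weighted by the minimal path weight; $|G|$ is the canonical form restricted to the first and last columns, renumbered $0,1$. $G_1\cdot G_2=|G_1\odot G_2|$. For a two-column graph $G$ in canonical form, $\mathit{left}(G)$ (resp. $\mathit{right}(G)$) is the set of weighted edges between vertices of column $0$ (resp. $1$); $G_1\bumpeq G_2$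 means $\mathit{left}(G_1)=\mathit{left}(G_2)$ and $\mathit{right}(G_1)=\mathit{right}(G_2)$. The zone defined by $\mathit{left}(G)$ is the set of valuations $v$ such that $v(y)-v(x)\preccurlyeq d$ for every edge $(0,x)\to(0,y)$ of weight $(\preccurlyeq,d)$ in $\mathit{left}(G)$. *)

theory Defs
  imports Main "HOL.Real"
begin

text \<open>Clocks form a finite type 'c (this is the clock set X); x0 is the reference clock.\<close>

datatype rel = Lt | Le | Eq | Ge | Gt

type_synonym 'c atom = "'c \<times> rel \<times> nat"
type_synonym 'c guard = "'c atom list"
type_synonym 'c transition = "'c guard \<times> 'c set"
type_synonym 'c valuation = "'c \<Rightarrow> real"

definition is_upper :: "rel \<Rightarrow> bool" where
  "is_upper r \<longleftrightarrow> r \<in> {Lt, Le, Eq}"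

definition is_lower :: "rel \<Rightarrow> bool" where
  "is_lower r \<longleftrightarrow> r \<in> {Gt, Ge, Eq}"

fun sat_atom :: "'c valuation \<Rightarrow> 'c atom \<Rightarrow> bool" where
  "sat_atom v (x, Lt, c) = (v x < real c)"
| "sat_atom v (x, Le, c) = (v x \<le> real c)"
| "sat_atom v (x, Eq, c) = (v x = real c)"
| "sat_atom v (x, Ge, c) = (v x \<ge> real c)"
| "sat_atom v (x, Gt, c) = (v x > real c)"

definition valuation :: "'c \<Rightarrow> 'c valuation \<Rightarrow> bool" where
  "valuation x0 v \<longleftrightarrow> v x0 = 0 \<and> (\<forall>x. 0 \<le> v x)"

definition delay :: "'c \<Rightarrow> 'c valuation \<Rightarrow> real \<Rightarrow> 'c valuation" where
  "delay x0 v \<delta> = (\<lambda>x. if x = x0 then v x else v x + \<delta>)"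

definition reset :: "'c set \<Rightarrow> 'c valuation \<Rightarrow> 'c valuation" where
  "reset R v = (\<lambda>x. if x \<in> R then 0 else v x)"

definition step :: "'c \<Rightarrow> 'c valuation \<Rightarrow> 'c transition \<Rightarrow> real \<Rightarrow> 'c valuation \<Rightarrow> bool" where
  "step x0 v t \<delta> v' \<longleftrightarrow> 0 \<le> \<delta> \<and> (\<forall>a\<in>set (fst t). sat_atom (delay x0 v \<delta>) a)
      \<and> v' = reset (snd t) (delay x0 v \<delta>)"

fun run :: "'c \<Rightarrow> 'c valuation \<Rightarrow> 'c transition list \<Rightarrow> 'c valuation \<Rightarrow> bool" where
  "run x0 v [] v' = (v' = v)"
| "run x0 v (t # ts) v' = (\<exists>\<delta> w. step x0 v t \<delta> w \<and> run x0 w ts v')"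

definition omega_iterable_from :: "'c \<Rightarrow> 'c transition list \<Rightarrow> 'c valuation \<Rightarrow> bool" where
  "omega_iterable_from x0 \<sigma> v0 \<longleftrightarrow>
     (\<exists>vs. vs 0 = v0 \<and> (\<forall>j. run x0 (vs j) \<sigma> (vs (Suc j))))"

definition omega_iterable :: "'c \<Rightarrow> 'c transition list \<Rightarrow> bool" where
  "omega_iterable x0 \<sigma> \<longleftrightarrow> (\<exists>v0. valuation x0 v0 \<and> omega_iterable_from x0 \<sigma> v0)"

definition wf_seq :: "'c \<Rightarrow> 'c transition list \<Rightarrow> bool" where
  "wf_seq x0 \<sigma> \<longleftrightarrow> (\<forall>(g, R)\<in>set \<sigma>. (\<forall>a\<in>set g. fst a \<noteq> x0) \<and> x0 \<notin> R)"

definition atoms :: "'c transition list \<Rightarrow> 'c atom set" where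
  "atoms \<sigma> = (\<Union>t\<in>set \<sigma>. set (fst t))"

definition clocks_of :: "'c transition list \<Rightarrow> 'c set" where
  "clocks_of \<sigma> = (\<Union>t\<in>set \<sigma>. fst ` set (fst t) \<union> snd t)"

definition reset_clocks :: "'c transition list \<Rightarrow> 'c set" where
  "reset_clocks \<sigma> = (\<Union>t\<in>set \<sigma>. snd t)"

definition C1 :: "'c transition list \<Rightarrow> bool" where
  "C1 \<sigma> \<longleftrightarrow> (\<exists>y\<in>clocks_of \<sigma> - reset_clocks \<sigma>. \<exists>r1 d r2 c.
      (y, r1, d) \<in> atoms \<sigma> \<and> is_upper r1 \<and> (y, r2, c) \<in> atoms \<sigma> \<and> is_lower r2 \<and>
      (d < c \<or> (d = c \<and> r1 = Lt) \<or> (d = c \<and> r2 = Gt)))"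

definition C2 :: "'c transition list \<Rightarrow> bool" where
  "C2 \<sigma> \<longleftrightarrow> (\<exists>x\<in>reset_clocks \<sigma>. \<exists>y\<in>clocks_of \<sigma> - reset_clocks \<sigma>. \<exists>r1 d r2 c.
      (y, r1, d) \<in> atoms \<sigma> \<and> is_upper r1 \<and> (x, r2, c) \<in> atoms \<sigma> \<and> is_lower r2 \<and> c > 0)"

definition C3 :: "'c transition list \<Rightarrow> bool" where
  "C3 \<sigma> \<longleftrightarrow> (\<exists>x\<in>reset_clocks \<sigma>. (x, Gt, 0) \<in> atoms \<sigma>) \<and>
      (\<exists>y\<in>clocks_of \<sigma> - reset_clocks \<sigma>. \<exists>c.
         ((y, Le, c) \<in> atoms \<sigma> \<or> (y, Eq, c) \<in> atoms \<sigma>) \<and>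
         ((y, Ge, c) \<in> atoms \<sigma> \<or> (y, Eq, c) \<in> atoms \<sigma>))"

definition has_pos_lower_reset :: "'c transition list \<Rightarrow> bool" where
  "has_pos_lower_reset \<sigma> \<longleftrightarrow>
     (\<exists>x\<in>reset_clocks \<sigma>. \<exists>r c. (x, r, c) \<in> atoms \<sigma> \<and> is_lower r \<and> c > 0)"

definition reduce :: "'c transition list \<Rightarrow> 'c transition list" where
  "reduce \<sigma> = map (\<lambda>(g, R). (filter (\<lambda>a. fst a \<in> reset_clocks \<sigma>) g, R)) \<sigma>"

text \<open>A weight (strict, d): strict = True means the relation is <, otherwise <=.\<close>
type_synonym weight = "bool \<times> int"
type_synonym 'c vertex = "nat \<times> 'c"
type_synonym 'c edge = "'c vertex \<times> weight \<times> 'c vertex"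
text \<open>A transformation graph: number of columns and the set of weighted edges.\<close>
type_synonym 'c tgraph = "nat \<times> 'c edge set"

definition wzero :: weight where "wzero = (False, 0)"

fun wadd :: "weight \<Rightarrow> weight \<Rightarrow> weight" where
  "wadd (s1, d1) (s2, d2) = (s1 \<or> s2, d1 + d2)"

fun wless :: "weight \<Rightarrow> weight \<Rightarrow> bool" where
  "wless (s1, d1) (s2, d2) = (d1 < d2 \<or> (d1 = d2 \<and> s1 \<and> \<not> s2))"

definition wle :: "weight \<Rightarrow> weight \<Rightarrow> bool" where
  "wle a b \<longleftrightarrow> a = b \<or> wless a b"

definition wneg :: "weight \<Rightarrow> bool" where
  "wneg w \<longleftrightarrow> wless w wzero"

definition trans_graph :: "'c \<Rightarrow> 'c transition \<Rightarrow> 'c tgraph" where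
  "trans_graph x0 t = (case t of (g, R) \<Rightarrow> (3,
      {((0, x0), wzero, (1, x0))}
    \<union> {((0, x), wzero, (1, x)) | x. x \<noteq> x0}
    \<union> {((1, x), wzero, (0, x)) | x. x \<noteq> x0}
    \<union> {((1, x0), (r = Lt, int c), (1, x)) | x r c. (x, r, c) \<in> set g \<and> is_upper r}
    \<union> {((1, x), (r = Gt, - int c), (1, x0)) | x r c. (x, r, c) \<in> set g \<and> is_lower r}
    \<union> {((1, x), wzero, (2, x)) | x. x \<notin> R}
    \<union> {((2, x), wzero, (1, x)) | x. x \<notin> R}
    \<union> {((1, x), wzero, (2, x)) | x. x \<in> R}
    \<union> {((2, x0), wzero, (2, x)) | x. x \<in> R}
    \<union> {((2, x), wzero, (2, x0)) | x. x \<in> R}))"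

definition shift :: "nat \<Rightarrow> 'c edge set \<Rightarrow> 'c edge set" where
  "shift k E = {((i + k, x), w, (j + k, y)) | i x w j y. ((i, x), w, (j, y)) \<in> E}"

fun compose :: "'c tgraph \<Rightarrow> 'c tgraph \<Rightarrow> 'c tgraph" where
  "compose (k1, E1) (k2, E2) = (k1 + k2,
      E1 \<union> shift k1 E2
    \<union> {((k1 - 1, x), wzero, (k1, x)) | x. True}
    \<union> {((k1, x), wzero, (k1 - 1, x)) | x. True})"

text \<open>G_sigma = G_t1 \<odot> ... \<odot> G_tk (the empty sequence is never used below).\<close>
fun seq_graph :: "'c \<Rightarrow> 'c transition list \<Rightarrow> 'c tgraph" where
  "seq_graph x0 [] = (1, {})"
| "seq_graph x0 [t] = trans_graph x0 t"
| "seq_graph x0 (t # t' # ts) = compose (trans_graph x0 t) (seq_graph x0 (t' # ts))"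

inductive path :: "'c edge set \<Rightarrow> 'c vertex \<Rightarrow> weight \<Rightarrow> 'c vertex \<Rightarrow> bool" for E where
  edge: "(u, w, v) \<in> E \<Longrightarrow> path E u w v"
| snoc: "path E u w v \<Longrightarrow> (v, w', z) \<in> E \<Longrightarrow> path E u (wadd w w') z"

definition has_neg_cycle :: "'c tgraph \<Rightarrow> bool" where
  "has_neg_cycle G \<longleftrightarrow> (\<exists>u w. path (snd G) u w u \<and> wneg w)"

definition min_weight :: "'c edge set \<Rightarrow> 'c vertex \<Rightarrow> 'c vertex \<Rightarrow> weight" where
  "min_weight E u v = (SOME w. path E u w v \<and> (\<forall>w'. path E u w' v \<longrightarrow> wle w w'))"

definition renum :: "nat \<Rightarrow> nat" where
  "renum i = (if i = 0 then 0 else 1)"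

fun close :: "'c tgraph \<Rightarrow> 'c tgraph" where
  "close (k, E) = (2,
     {((renum i, x), min_weight E (i, x) (j, y), (renum j, y)) | i x j y.
        i \<in> {0, k - 1} \<and> j \<in> {0, k - 1} \<and> (i, x) \<noteq> (j, y) \<and> (\<exists>w. path E (i, x) w (j, y))})"

definition gmult :: "'c tgraph \<Rightarrow> 'c tgraph \<Rightarrow> 'c tgraph" where
  "gmult G1 G2 = close (compose G1 G2)"

definition left :: "'c tgraph \<Rightarrow> 'c edge set" where
  "left G = {e \<in> snd G. fst (fst e) = 0 \<and> fst (snd (snd e)) = 0}"

definition right :: "'c tgraph \<Rightarrow> 'c edge set" where
  "right G = {e \<in> snd G. fst (fst e) = 1 \<and> fst (snd (snd e)) = 1}"

definition bumpeq :: "'c tgraph \<Rightarrow> 'c tgraph \<Rightarrow> bool" where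
  "bumpeq G1 G2 \<longleftrightarrow> left G1 = left G2 \<and> right G1 = right G2"

definition zone :: "'c \<Rightarrow> 'c edge set \<Rightarrow> 'c valuation set" where
  "zone x0 L = {v. valuation x0 v \<and>
     (\<forall>x s d y. ((0, x), (s, d), (0, y)) \<in> L \<longrightarrow>
        (if s then v y - v x < real_of_int d else v y - v x \<le> real_of_int d))}"

text \<open>Gpow x0 sigma k = G^(2^k).\<close>
fun Gpow :: "'c \<Rightarrow> 'c transition list \<Rightarrow> nat \<Rightarrow> 'c tgraph" where
  "Gpow x0 \<sigma> 0 = close (seq_graph x0 \<sigma>)"
| "Gpow x0 \<sigma> (Suc k) = gmult (Gpow x0 \<sigma> k) (Gpow x0 \<sigma> k)"

text \<open>Iteration k of step 4 is reached: step 3 did not stop, and no stop condition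
  held at any earlier iteration j < k.\<close>
definition reached :: "'c \<Rightarrow> 'c transition list \<Rightarrow> nat \<Rightarrow> nat \<Rightarrow> bool" where
  "reached x0 \<sigma> n k \<longleftrightarrow> \<not> has_neg_cycle (seq_graph x0 \<sigma>) \<and>
     (\<forall>j<k. \<not> has_neg_cycle (compose (Gpow x0 \<sigma> j) (Gpow x0 \<sigma> j)) \<and>
            \<not> (2::nat) ^ j > n ^ 2 \<and>
            \<not> bumpeq (Gpow x0 \<sigma> (Suc j)) (Gpow x0 \<sigma> j))"

end

(* The idea. Place the clock values of an infinite run of tau in the columns of the infinite periodic
   graph obtained by unrolling G_tau: recording x at absolute time T as v(x) - T, every edge becomes a
   difference constraint. Hence iterability from v means that the unrolled graph has a solution with
   v in column 0, which excludes negative cycles; conversely, if left(G^m) = left(G^2m), a valuation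
   in the zone of left(G^2m) = left(G^m) extends to a solution over 2m copies of tau, whose first half is
   a run ending in the same zone, and such runs can be concatenated.

   The quantitative part is that 2m > n^2 forces left(G^m) = left(G^2m), and by reflection the same
   for right, if a solution exists. A minimal path from column 0 to column 0 that goes far to the right
   crosses the same columns, one per copy, on the way up at clocks x_0, ..., x_K and on the way down
   at y_0, ..., y_K, all of which may be taken among the reset clocks. A loop x_i -> x_i' upwards can be moved
   to any place where the path visits the same clock on the way down, which lowers the path; and a pair of
   simultaneous loops x_i = x_i', y_i = y_i' can be cut out, because going round the former and
   back the latter arbitrarily often would otherwise contradict the existence of a solution.
   If neither is possible, 4(K+1) <= n^2 by counting. *)

theory Submission imports Defs begin

section \<open>Weights and paths\<close>

text \<open>The obstacle is strictness. Cutting out two opposite loops never raises the integer part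
  of the weight, but it may remove the only strict edge and so turn \<open><\<close> into
  \<open>\<le>\<close>. One strict piece must therefore be spared; it splits the upward word at a
  position \<open>k\<close>, and repetitions across \<open>k\<close> have to be limited by
  exchanging loops instead of cutting. The factor 4 comes from the inequality of the means. A clock
  repeated on one side does not occur on the other, so the repeated clocks form disjoint sets of
  sizes p and q with p + q at most n - 1. Without the split there are at most p * q pairs of them;
  the split costs one more p, and 4 * p * (q + 1) is at most (p + q + 1)^2. Clocks that are not
  repeated contribute little and take room from p and q. Excursions are studied above cut
  \<open>K\<close> instead of column 0, because a reordered or lowered piece may dip below its old
  range and needs up to \<open>K\<close> periods of room. The word of length \<open>K\<close> then
  ends at cut \<open>2 * K\<close>, inside the first \<open>m = 2 * (K + 1)\<close> copies, and
  \<open>2 * m = 4 * (K + 1)\<close> is the quantity compared with n^2.\<close>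

lemma wle_iff: "wle a b \<longleftrightarrow> snd a < snd b \<or> snd a = snd b \<and> (fst b \<longrightarrow> fst a)"
  by (cases a; cases b) (auto simp: wle_def)

lemma wneg_iff: "wneg w \<longleftrightarrow> snd w < 0 \<or> snd w = 0 \<and> fst w"
  by (cases w) (auto simp: wneg_def wzero_def)

lemma fst_wadd [simp]: "fst (wadd a b) \<longleftrightarrow> fst a \<or> fst b"
  and snd_wadd [simp]: "snd (wadd a b) = snd a + snd b"
  by (cases a; cases b; simp)+

lemma fst_wzero [simp]: "\<not> fst wzero" and snd_wzero [simp]: "snd wzero = 0"
  by (simp_all add: wzero_def)

lemma weight_eqI: "fst a = fst b \<Longrightarrow> snd a = snd b \<Longrightarrow> a = (b::weight)"
  by (rule prod_eqI)

lemma wadd_assoc: "wadd (wadd a b) c = wadd a (wadd b c)"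
  and wadd_commute: "wadd a b = wadd b a"
  and wadd_left_commute: "wadd a (wadd b c) = wadd b (wadd a c)"
  by (auto intro!: weight_eqI)

lemmas wadd_ac = wadd_assoc wadd_commute wadd_left_commute

lemma wadd_wzero [simp]: "wadd wzero a = a" "wadd a wzero = a"
  by (auto intro!: weight_eqI)

lemma wle_refl [simp]: "wle a a"
  by (simp add: wle_iff)

lemma wle_trans: "wle a b \<Longrightarrow> wle b c \<Longrightarrow> wle a c"
  by (auto simp: wle_iff)

lemma wle_antisym: "wle a b \<Longrightarrow> wle b a \<Longrightarrow> a = b"
  by (auto simp: wle_iff intro!: weight_eqI)

lemma wadd_mono: "wle a b \<Longrightarrow> wle c d \<Longrightarrow> wle (wadd a c) (wadd b d)"
  by (auto simp: wle_iff)

lemma wle_wadd_nonneg: "\<not> wneg b \<Longrightarrow> wle a (wadd b a)"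
  by (auto simp: wle_iff wneg_iff)

lemma path_trans:
  assumes "path E v w' z" "path E u w v"
  shows "path E u (wadd w w') z"
  using assms
proof (induction rule: path.induct)
  case (edge v w' z)
  then show ?case by (blast intro: path.snoc)
next
  case (snoc v w1 z w2 z')
  from path.snoc[OF snoc.IH[OF snoc.prems] snoc.hyps(2)] show ?case by (simp add: wadd_assoc)
qed

lemma path_mono: "path E u w v \<Longrightarrow> E \<subseteq> E' \<Longrightarrow> path E' u w v"
  by (induction rule: path.induct) (auto intro: path.intros)

section \<open>Possibly empty walks, their reversal, and walks confined to a range of
  columns\<close>

text \<open>\<open>path\<close> is never empty; the reflexive closure lets the parts of a
  decomposition shrink to a point of weight \<open>wzero\<close>.\<close>

definition walk :: "'c edge set \<Rightarrow> 'c vertex \<Rightarrow> weight \<Rightarrow> 'c vertex \<Rightarrow> bool" where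
  "walk E u w v \<longleftrightarrow> u = v \<and> w = wzero \<or> path E u w v"

lemma walk_refl [simp]: "walk E u wzero u"
  by (simp add: walk_def)

lemma path_walk: "path E u w v \<Longrightarrow> walk E u w v"
  by (simp add: walk_def)

lemma edge_walk: "(u, w, v) \<in> E \<Longrightarrow> walk E u w v"
  by (simp add: walk_def path.edge)

lemma walk_trans: "walk E u w v \<Longrightarrow> walk E v w' z \<Longrightarrow> walk E u (wadd w w') z"
  by (auto simp: walk_def intro: path_trans)

lemma walk_mono: "walk E u w v \<Longrightarrow> E \<subseteq> E' \<Longrightarrow> walk E' u w v"
  by (auto simp: walk_def intro: path_mono)

lemma walk_snoc: "walk E u w v \<Longrightarrow> (v, w', z) \<in> E \<Longrightarrow> walk E u (wadd w w') z"
  by (rule walk_trans[OF _ edge_walk])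

lemma walk_path: "walk E u w v \<Longrightarrow> u \<noteq> v \<Longrightarrow> path E u w v"
  by (auto simp: walk_def)

lemma walk_induct [consumes 1, case_names refl snoc]:
  assumes "walk E u w v" and "P wzero u"
    and "\<And>w v w' z. walk E u w v \<Longrightarrow> P w v \<Longrightarrow> (v, w', z) \<in> E \<Longrightarrow> P (wadd w w') z"
  shows "P w v"
proof (cases "path E u w v")
  case True
  then show ?thesis using assms(2,3)
  proof (induction rule: path.induct)
    case (edge u w v)
    from edge(3)[OF walk_refl edge(2) edge(1)] show ?case by simp
  next
    case (snoc u w v w' z)
    then show ?case by (blast intro: path_walk)
  qed
qed (use assms in \<open>auto simp: walk_def\<close>)

text \<open>Descents are handled as climbs of the reversed graph, so each result about the upward
  side yields its dual.\<close>

definition rev_edges :: "'c edge set \<Rightarrow> 'c edge set" where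
  "rev_edges E = (\<lambda>(u, w, v). (v, w, u)) ` E"

lemma rev_edges_iff [simp]: "(v, w, u) \<in> rev_edges E \<longleftrightarrow> (u, w, v) \<in> E"
  unfolding rev_edges_def by force

lemma rev_rev_edges [simp]: "rev_edges (rev_edges E) = E"
  unfolding rev_edges_def by force

lemma walk_rev1: "walk E u w v \<Longrightarrow> walk (rev_edges E) v w u"
proof (induction rule: walk_induct)
  case (snoc w v w' z)
  have "walk (rev_edges E) z w' v" using snoc(2) by (simp add: edge_walk snoc.hyps)
  from walk_trans[OF this snoc.IH] show ?case by (simp add: wadd_commute)
qed simp

lemma walk_rev [simp]: "walk (rev_edges E) v w u \<longleftrightarrow> walk E u w v"
  using walk_rev1 rev_rev_edges by metis

definition restr :: "'c edge set \<Rightarrow> nat \<Rightarrow> nat \<Rightarrow> 'c edge set" where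
  "restr E lo hi = {(u, w, v) \<in> E. fst u \<in> {lo..hi} \<and> fst v \<in> {lo..hi}}"

lemma restr_iff [simp]: "(u, w, v) \<in> restr E lo hi \<longleftrightarrow>
   (u, w, v) \<in> E \<and> fst u \<in> {lo..hi} \<and> fst v \<in> {lo..hi}"
  by (simp add: restr_def)

lemma restr_subset: "restr E lo hi \<subseteq> E"
  by (auto simp: restr_def)

lemma restr_mono: "lo' \<le> lo \<Longrightarrow> hi \<le> hi' \<Longrightarrow> restr E lo hi \<subseteq> restr E lo' hi'"
  by auto

lemma restr_rev [simp]: "restr (rev_edges E) lo hi = rev_edges (restr E lo hi)"
  by auto

abbreviation cwalk :: "'c edge set \<Rightarrow> nat \<Rightarrow> nat \<Rightarrow> 'c vertex \<Rightarrow> weight \<Rightarrow> 'c vertex \<Rightarrow> bool" where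
  "cwalk E lo hi \<equiv> walk (restr E lo hi)"

lemma cwalk_mono: "cwalk E lo hi u w v \<Longrightarrow> lo' \<le> lo \<Longrightarrow> hi \<le> hi' \<Longrightarrow> cwalk E lo' hi' u w v"
  by (erule walk_mono) (auto simp: restr_def)

text \<open>A sum that ignores the order of the indices, since pieces of a walk will be
  permuted.\<close>

definition wsum :: "(nat \<Rightarrow> weight) \<Rightarrow> nat set \<Rightarrow> weight" where
  "wsum f I = (\<exists>i\<in>I. fst (f i), \<Sum>i\<in>I. snd (f i))"

lemma fst_wsum [simp]: "fst (wsum f I) \<longleftrightarrow> (\<exists>i\<in>I. fst (f i))"
  and snd_wsum [simp]: "snd (wsum f I) = (\<Sum>i\<in>I. snd (f i))"
  by (simp_all add: wsum_def)

lemma wsum_empty [simp]: "wsum f {} = wzero"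
  by (simp add: wsum_def wzero_def)

lemma wsum_union: "finite I \<Longrightarrow> finite J \<Longrightarrow> I \<inter> J = {} \<Longrightarrow> wsum f (I \<union> J) = wadd (wsum f I) (wsum f J)"
  by (rule weight_eqI) (auto simp: sum.union_disjoint)

lemma wsum_ivl: "i \<le> j \<Longrightarrow> j \<le> k \<Longrightarrow> wsum f {i..<k} = wadd (wsum f {i..<j}) (wsum f {j..<k})"
  by (subst wsum_union[symmetric]) (auto simp: ivl_disj_un)

lemma wsum_Suc: "i \<le> j \<Longrightarrow> wsum f {i..<Suc j} = wadd (wsum f {i..<j}) (f j)"
  by (rule weight_eqI) (auto simp: less_Suc_eq)

lemma wsum_cong: "(\<And>i. i \<in> I \<Longrightarrow> f i = g i) \<Longrightarrow> wsum f I = wsum g I"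
  by (auto simp: wsum_def)

section \<open>A bound on pairs of words\<close>

lemma card_ge_2_obtain:
  assumes "2 \<le> card (M :: nat set)"
  obtains i j where "i \<in> M" "j \<in> M" "i < j"
proof -
  from assms have "\<not> card M \<le> Suc 0" by simp
  then obtain a b where "a \<in> M" "b \<in> M" "a \<noteq> b"
    by (metis card.infinite card_le_Suc0_iff_eq le0)
  then show ?thesis using that by (metis linorder_neqE_nat)
qed

lemma card_eq_sum_fibres:
  assumes "finite M" "finite D" "X ` M \<subseteq> D"
  shows "card M = (\<Sum>z\<in>D. card {i\<in>M. X i = z})"
proof -
  have "M = (\<Union>z\<in>D. {i\<in>M. X i = z})" using assms(3) by auto
  also have "card \<dots> = (\<Sum>z\<in>D. card {i\<in>M. X i = z})"
    using assms by (intro card_UN_disjoint) auto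
  finally show ?thesis .
qed

text \<open>With \<open>A = p\<close> and \<open>B = q + 1\<close> the square of
  \<open>A - B\<close> gives the case \<open>c = 0\<close>. The extra term
  \<open>c * (2 * (A + B) + c - 8)\<close> is negative only for \<open>A = 1\<close>,
  \<open>B = 2\<close>, \<open>c = 1\<close>, where both sides are equal to 16.\<close>

lemma quadratic_bound:
  fixes p q r a :: nat
  assumes "p + q + a \<le> r" and "0 < p" "0 < q"
  shows "4 * (p * (q + 1) + 2 * a) \<le> (r + 1)\<^sup>2"
proof -
  define A B c :: int where "A = int p" and "B = int q + 1" and "c = int a"
  have AB: "A \<ge> 1" "B \<ge> 2" "c \<ge> 0" using assms by (simp_all add: A_def B_def c_def)
  have "4 * (A * B + 2 * c) \<le> (A + B + c)\<^sup>2"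
  proof -
    have e: "(A + B + c)\<^sup>2 - 4 * (A * B + 2 * c) = (A - B)\<^sup>2 + c * (2 * (A + B) + c - 8)"
      by (simp add: power2_eq_square algebra_simps)
    show ?thesis
    proof (cases "c = 0 \<or> 2 * (A + B) + c \<ge> 8")
      case True
      then have "c * (2 * (A + B) + c - 8) \<ge> 0" using AB by (auto intro: mult_nonneg_nonneg)
      then show ?thesis using e by (smt (verit) zero_le_power2)
    next
      case False
      then have "A = 1" "B = 2" "c = 1" using AB by auto
      then show ?thesis by simp
    qed
  qed
  also have "\<dots> \<le> (int r + 1)\<^sup>2"
    using assms by (intro power_mono) (auto simp: A_def B_def c_def)
  finally have "int (4 * (p * (q + 1) + 2 * a)) \<le> int ((r + 1)\<^sup>2)"
    by (simp add: A_def B_def c_def algebra_simps)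
  then show ?thesis by linarith
qed

lemma le_square_of_double: "(m::nat) \<le> r \<Longrightarrow> 4 * m \<le> (r + 1)\<^sup>2"
proof -
  assume "m \<le> r"
  have "int (4 * r) \<le> int ((r + 1)\<^sup>2)"
    using zero_le_power2[of "int r - 1"] by (simp add: power2_eq_square algebra_simps)
  then have "4 * r \<le> (r + 1)\<^sup>2" by linarith
  then show ?thesis using \<open>m \<le> r\<close> by linarith
qed

text \<open>
  \<open>X\<close> and \<open>Y\<close> list the clocks met at consecutive cuts on the way up and on the way down.
  Each hypothesis excludes a shortening: \<open>RX\<close> and \<open>RY\<close> moving a loop to the other side,
  \<open>D\<close> cutting out two simultaneous loops, \<open>N\<close> exchanging two adjacent loops. The index \<open>k\<close> is the
  position of one strict edge, which cutting out must spare.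
\<close>

lemma two_word_bound:
  fixes X Y :: "nat \<Rightarrow> 'a"
  assumes S: "finite S" "X ` {..K} \<subseteq> S" "Y ` {..K} \<subseteq> S"
    and RX: "\<And>i i' j. i < i' \<Longrightarrow> i' \<le> K \<Longrightarrow> j \<le> K \<Longrightarrow> X i = X i' \<Longrightarrow> Y j \<noteq> X i"
    and RY: "\<And>i i' j. i < i' \<Longrightarrow> i' \<le> K \<Longrightarrow> j \<le> K \<Longrightarrow> Y i = Y i' \<Longrightarrow> X j \<noteq> Y i"
    and D: "\<And>i i'. i < i' \<Longrightarrow> i' \<le> K \<Longrightarrow> i' \<le> k \<or> k < i \<Longrightarrow> X i = X i' \<Longrightarrow> Y i \<noteq> Y i'"
    and N: "\<And>h i i'. h < i \<Longrightarrow> i \<le> k \<Longrightarrow> k < i' \<Longrightarrow> i' \<le> K \<Longrightarrow> X h = X i \<Longrightarrow> X i' \<noteq> X i"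
  shows "4 * (K + 1) \<le> (card S + 1)\<^sup>2"
proof -
  \<comment> \<open>Positions up to \<open>k\<close> and after \<open>k\<close> are kept apart,
    because \<open>D\<close> says nothing about a pair that straddles \<open>k\<close>.\<close>
  define lo where "lo z = {i. i \<le> K \<and> i \<le> k \<and> X i = z}" for z
  define up where "up z = {i. i \<le> K \<and> k < i \<and> X i = z}" for z
  define ys where "ys z = {i. i \<le> K \<and> Y i = z}" for z
  have fin [simp]: "finite (lo z)" "finite (up z)" "finite (ys z)" for z
    by (simp_all add: lo_def up_def ys_def)
  \<comment> \<open>\<open>P1\<close>, \<open>P2\<close> and \<open>Q\<close> collect the clocks
    repeated in the lower, upper and downward list; a clock of \<open>Z\<close> occurs at most once
    in each of the three.\<close>
  define P1 where "P1 = {z\<in>S. 2 \<le> card (lo z)}"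
  define P2 where "P2 = {z\<in>S. 2 \<le> card (up z)}"
  define Q where "Q = {z\<in>S. 2 \<le> card (ys z)}"
  define Z where "Z = S - (P1 \<union> P2) - Q"
  have finS [simp]: "finite P1" "finite P2" "finite Q" "finite Z"
    using S by (simp_all add: P1_def P2_def Q_def Z_def)
  have XS: "X i \<in> S" "Y i \<in> S" if "i \<le> K" for i using S that by auto
  have P1_up: "up z = {}" if "z \<in> P1" for z
  proof -
    from that have "2 \<le> card (lo z)" by (simp add: P1_def)
    then obtain i j where "i \<in> lo z" "j \<in> lo z" "i < j" by (rule card_ge_2_obtain)
    then show ?thesis using N[of i j] by (auto simp: lo_def up_def)
  qed
  have P_ys: "ys z = {}" if "z \<in> P1 \<union> P2" for z
  proof -
    from that obtain i j where "i < j" "j \<le> K" "X i = z" "X j = z"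
      using card_ge_2_obtain[of "lo z"] card_ge_2_obtain[of "up z"]
      by (auto simp: P1_def P2_def lo_def up_def) blast+
    then show ?thesis using RX[of i j] by (auto simp: ys_def)
  qed
  have Q_X: "X i \<noteq> z" if "z \<in> Q" "i \<le> K" for z i
  proof -
    from that have "2 \<le> card (ys z)" by (simp add: Q_def)
    then obtain i j where "i \<in> ys z" "j \<in> ys z" "i < j" by (rule card_ge_2_obtain)
    then show ?thesis using RY[of i j] that(2) by (auto simp: ys_def)
  qed
  have disj: "P1 \<inter> P2 = {}" using P1_up by (fastforce simp: P2_def)
  have PQ: "(P1 \<union> P2) \<inter> Q = {}" using P_ys by (fastforce simp: Q_def)
  have cards: "card (P1 \<union> P2) = card P1 + card P2" "card (P1 \<union> P2) + card Q + card Z \<le> card S"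
  proof -
    show "card (P1 \<union> P2) = card P1 + card P2" using disj by (simp add: card_Un_disjoint)
    have "card (P1 \<union> P2) + card Q + card Z = card ((P1 \<union> P2) \<union> Q \<union> Z)"
    proof -
      have "((P1 \<union> P2) \<union> Q) \<inter> Z = {}" by (auto simp: Z_def)
      then show ?thesis using PQ finS by (simp only: card_Un_disjoint finite_Un)
    qed
    also have "\<dots> \<le> card S" using S by (intro card_mono) (auto simp: P1_def P2_def Q_def Z_def)
    finally show "card (P1 \<union> P2) + card Q + card Z \<le> card S" .
  qed
  \<comment> \<open>A position that avoids \<open>Z\<close> pairs a clock of \<open>P1\<close> or
    \<open>P2\<close> with one of \<open>Q\<close>, and \<open>P1\<close> does not occur after
    \<open>k\<close>; this leaves three types. \<open>D\<close> injects \<open>T1\<close> and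
    \<open>T2\<close> into products. On \<open>T3\<close> already \<open>X\<close> is injective,
    since by \<open>N\<close> a clock repeated up to \<open>k\<close> cannot reappear after
    \<open>k\<close>, as clocks of \<open>P2\<close> do.\<close>
  define T1 where "T1 = {i. i \<le> K \<and> i \<le> k \<and> X i \<in> P1 \<and> Y i \<in> Q}"
  define T2 where "T2 = {i. i \<le> K \<and> k < i \<and> X i \<in> P2 \<and> Y i \<in> Q}"
  define T3 where "T3 = {i. i \<le> K \<and> i \<le> k \<and> X i \<in> P2 \<and> Y i \<in> Q}"
  define TX where "TX = {i. i \<le> K \<and> X i \<in> Z}"
  define TY where "TY = {i. i \<le> K \<and> Y i \<in> Z}"
  have finT [simp]: "finite T1" "finite T2" "finite T3" "finite TX" "finite TY"
    by (simp_all add: T1_def T2_def T3_def TX_def TY_def)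
  have cover: "{..K} \<subseteq> T1 \<union> T2 \<union> T3 \<union> TX \<union> TY"
  proof
    fix i assume "i \<in> {..K}"
    then have i: "i \<le> K" by simp
    have Y: "Y i \<in> Q \<or> Y i \<in> Z" using XS(2)[OF i] P_ys i by (auto simp: Z_def ys_def)
    have X: "X i \<in> P1 \<or> X i \<in> P2 \<or> X i \<in> Z" using XS(1)[OF i] Q_X[OF _ i] by (auto simp: Z_def)
    have "i \<le> k" if "X i \<in> P1" using P1_up[OF that] i by (auto simp: up_def not_less[symmetric])
    then show "i \<in> T1 \<union> T2 \<union> T3 \<union> TX \<union> TY"
      using X Y i by (cases "i \<le> k") (auto simp: T1_def T2_def T3_def TX_def TY_def)
  qed
  have "inj_on (\<lambda>i. (X i, Y i)) T1"
    using D unfolding T1_def inj_on_def by (auto) (metis linorder_neqE_nat)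
  then have T1: "card T1 \<le> card P1 * card Q"
    unfolding card_cartesian_product[symmetric]
    by (rule card_inj_on_le) (auto simp: T1_def)
  have "inj_on (\<lambda>i. (X i, Y i)) T2"
    using D unfolding T2_def inj_on_def by (auto) (metis linorder_neqE_nat)
  then have T2: "card T2 \<le> card P2 * card Q"
    unfolding card_cartesian_product[symmetric]
    by (rule card_inj_on_le) (auto simp: T2_def)
  have "inj_on X T3"
  proof (rule inj_onI, rule ccontr)
    fix i j assume ij: "i \<in> T3" "j \<in> T3" "X i = X j" "i \<noteq> j"
    then have "up (X i) = {}" using N[of i j] N[of j i]
      by (auto simp: T3_def up_def) (metis linorder_neqE_nat)
    then show False using ij by (simp add: T3_def P2_def)
  qed
  then have T3: "card T3 \<le> card P2" by (rule card_inj_on_le) (auto simp: T3_def)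
  \<comment> \<open>Two and not three: a clock met both up to \<open>k\<close> and after
    \<open>k\<close> is repeated in \<open>X\<close>, so \<open>RX\<close> bans it from
    \<open>Y\<close>.\<close>
  have Zle: "card {i\<in>TX. X i = z} + card {i\<in>TY. Y i = z} \<le> 2"
            "card {i\<in>TY. Y i = z} \<le> 1" "card {i\<in>TX. X i = z} \<le> 2" if z: "z \<in> Z" for z
  proof -
    have eq: "{i\<in>TX. X i = z} = lo z \<union> up z" "{i\<in>TY. Y i = z} = ys z"
      using z by (auto simp: TX_def TY_def lo_def up_def ys_def)
    have c: "card (lo z) \<le> 1" "card (up z) \<le> 1" "card (ys z) \<le> 1"
      using z by (auto simp: Z_def P1_def P2_def Q_def)
    have u: "card (lo z \<union> up z) = card (lo z) + card (up z)"
      by (rule card_Un_disjoint) (auto simp: lo_def up_def)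
    have "ys z = {}" if "lo z \<noteq> {}" "up z \<noteq> {}"
    proof -
      from that obtain i j where "i \<in> lo z" "j \<in> up z" by blast
      then show ?thesis using RX[of i j] by (auto simp: lo_def up_def ys_def)
    qed
    then show "card {i\<in>TX. X i = z} + card {i\<in>TY. Y i = z} \<le> 2"
      unfolding eq u using c by (cases "lo z = {}"; cases "up z = {}") auto
    show "card {i\<in>TY. Y i = z} \<le> 1" "card {i\<in>TX. X i = z} \<le> 2" unfolding eq u using c by auto
  qed
  have TX: "card TX = (\<Sum>z\<in>Z. card {i\<in>TX. X i = z})" and TY: "card TY = (\<Sum>z\<in>Z. card {i\<in>TY. Y i = z})"
    by (rule card_eq_sum_fibres; auto simp: TX_def TY_def)+
  have TXY: "card TX + card TY \<le> 2 * card Z"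
    unfolding TX TY sum.distrib[symmetric] using sum_bounded_above[of Z _ 2, OF Zle(1)] by (simp add: mult.commute)
  have TYle: "card TY \<le> card Z" unfolding TY using sum_bounded_above[of Z _ 1, OF Zle(2)] by simp
  have TXle: "card TX \<le> 2 * card Z" unfolding TX using sum_bounded_above[of Z _ 2, OF Zle(3)] by (simp add: mult.commute)
  have K: "K + 1 = card {..K}" by simp
  show ?thesis
  proof (cases "Q = {}")
    case True
    then have "{..K} \<subseteq> TY" using XS(2) P_ys by (fastforce simp: TY_def Z_def ys_def)
    then have "K + 1 \<le> card TY" unfolding K by (intro card_mono) auto
    also have "\<dots> \<le> card S" using TYle cards by linarith
    finally show ?thesis by (rule le_square_of_double)
  next
    case Q: False
    then have q: "0 < card Q" by (simp add: card_gt_0_iff)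
    show ?thesis
    proof (cases "P1 \<union> P2 = {}")
      case True
      then have "{..K} \<subseteq> TX" using XS(1) Q_X by (auto simp: TX_def Z_def)
      then have "K + 1 \<le> card TX" unfolding K by (intro card_mono) auto
      then have le: "K + 1 \<le> 2 * card Z" using TXle by linarith
      \<comment> \<open>As \<open>Q\<close> is nonempty, \<open>Z\<close> has at most
        \<open>card S - 1\<close> elements; with r for \<open>card S\<close>, the inequality is (r -
        3)^2 \<ge> 0.\<close>
      have "int (4 * (2 * (card S - 1))) \<le> int ((card S + 1)\<^sup>2)"
        using zero_le_power2[of "int (card S) - 3"] q cards
        by (simp add: power2_eq_square algebra_simps)
      then have bound: "4 * (2 * (card S - 1)) \<le> (card S + 1)\<^sup>2" by (simp only: of_nat_le_iff)
      have "card Z \<le> card S - 1" using q cards(2) by linarith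
      then have "2 * card Z \<le> 2 * (card S - 1)" by (rule mult_le_mono2)
      with le have "K + 1 \<le> 2 * (card S - 1)" by (rule order.trans)
      then have "4 * (K + 1) \<le> 4 * (2 * (card S - 1))" by (rule mult_le_mono2)
      then show ?thesis using bound by (rule order.trans)
    next
      case False
      then have p: "0 < card (P1 \<union> P2)" by (simp add: card_gt_0_iff)
      have "K + 1 \<le> card (T1 \<union> T2 \<union> T3 \<union> TX \<union> TY)" unfolding K using cover by (intro card_mono) auto
      also have "\<dots> \<le> card T1 + card T2 + card T3 + card TX + card TY"
        by (intro order.trans[OF card_Un_le] add_mono order.refl)
      also have "\<dots> \<le> card P1 * card Q + card P2 * card Q + card P2 + 2 * card Z"
        using T1 T2 T3 TXY by linarith
      also have "\<dots> \<le> card (P1 \<union> P2) * (card Q + 1) + 2 * card Z"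
        unfolding cards(1) by (simp add: algebra_simps)
      finally have "4 * (K + 1) \<le> 4 * (card (P1 \<union> P2) * (card Q + 1) + 2 * card Z)"
        by (rule mult_le_mono2)
      then show ?thesis using quadratic_bound[OF cards(2) p q] by (rule order.trans)
    qed
  qed
qed

section \<open>Lowering walks in a periodic strip\<close>

text \<open>
  The columns \<open>\<kappa> + l * C\<close> are those where a fixed clock of \<open>S\<close> is reset, so that there the reference
  clock is joined to it by edges of weight zero in both directions; hence a walk may be assumed to
  cross them at clocks of \<open>S\<close>, which saves one clock in the bound. \<open>A\<close> is \<open>S\<close> with the reference clock.
  The assumptions are invariant under reversing the edges and under reflecting the columns.
\<close>

locale strip =
  fixes E :: "'c edge set" and H C \<kappa> :: nat and S A :: "'c set"
  assumes C_pos: "0 < C"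
    and finite_S: "finite S" and S_subset: "S \<subseteq> A"
    and adjacent: "((i, x), w, (j, y)) \<in> E \<Longrightarrow> i \<le> H \<and> j \<le> H \<and> i \<le> Suc j \<and> j \<le> Suc i"
    and periodic: "i + C \<le> H \<Longrightarrow> j + C \<le> H \<Longrightarrow>
      ((i + C, x), w, (j + C, y)) \<in> E \<longleftrightarrow> ((i, x), w, (j, y)) \<in> E"
    and closed_A: "((i, x), w, (j, y)) \<in> E \<Longrightarrow> x = y \<or> x \<in> A \<and> y \<in> A"
    and at_cut: "z \<in> A \<Longrightarrow> \<kappa> + l * C \<le> H \<Longrightarrow> \<exists>z'\<in>S. z' = z \<or>
      ((\<kappa> + l * C, z), wzero, (\<kappa> + l * C, z')) \<in> E \<and> ((\<kappa> + l * C, z'), wzero, (\<kappa> + l * C, z)) \<in> E"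
    and pump: "x \<in> S \<Longrightarrow> y \<in> S \<Longrightarrow> 0 < g \<Longrightarrow>
      path E (\<kappa> + i * C, x) w (\<kappa> + (i + g) * C, x) \<Longrightarrow>
      path E (\<kappa> + (j + g) * C, y) w' (\<kappa> + j * C, y) \<Longrightarrow> 0 \<le> snd w + snd w'"
begin

section \<open>Cuts, translation by whole periods, first arrivals\<close>

definition cut :: "nat \<Rightarrow> nat" where "cut l = \<kappa> + l * C"

lemma cut_add: "cut (l + d) = cut l + d * C"
  by (simp add: cut_def algebra_simps)

lemma cut_mono: "l \<le> m \<Longrightarrow> cut l \<le> cut m"
  by (simp add: cut_def)

lemma cut_ge: "d \<le> l \<Longrightarrow> d * C \<le> cut l"
  by (simp add: cut_def trans_le_add2)

lemma cut_inj: "cut l = cut m \<longleftrightarrow> l = m"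
  using C_pos by (simp add: cut_def)

lemma edge_shift:
  "i + d * C \<le> H \<Longrightarrow> j + d * C \<le> H \<Longrightarrow>
    ((i + d * C, x), w, (j + d * C, y)) \<in> E \<longleftrightarrow> ((i, x), w, (j, y)) \<in> E"
proof (induction d)
  case (Suc d)
  then show ?case using periodic[of "i + d * C" "j + d * C" x w y] by (simp add: algebra_simps)
qed simp

lemma cwalk_shift_up:
  assumes "cwalk E lo hi u w v" "hi + d * C \<le> H"
  shows "cwalk E (lo + d * C) (hi + d * C) (fst u + d * C, snd u) w (fst v + d * C, snd v)"
  using assms(1)
proof (induction rule: walk_induct)
  case (snoc w v w' z)
  show ?case
    by (rule walk_snoc[OF snoc.IH])
       (use snoc.hyps(2) assms(2) in \<open>cases v; cases z; auto simp: edge_shift\<close>)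
qed simp

lemma cwalk_shift_down:
  assumes "cwalk E lo hi u w v" "d * C \<le> lo" "hi \<le> H"
  shows "cwalk E (lo - d * C) (hi - d * C) (fst u - d * C, snd u) w (fst v - d * C, snd v)"
  using assms(1)
proof (induction rule: walk_induct)
  case (snoc w v w' z)
  obtain i x j y where vz: "v = (i, x)" "z = (j, y)" by (cases v; cases z) auto
  have r: "lo \<le> i" "i \<le> hi" "lo \<le> j" "j \<le> hi" and e: "((i, x), w', (j, y)) \<in> E"
    using snoc.hyps(2) by (auto simp: vz)
  have "((i - d * C + d * C, x), w', (j - d * C + d * C, y)) \<in> E"
    using r e assms(2) by simp
  then have "((i - d * C, x), w', (j - d * C, y)) \<in> E"
    using r assms(2,3) by (subst (asm) edge_shift) auto
  then show ?case
    by (intro walk_snoc[OF snoc.IH]) (use r in \<open>auto simp: vz\<close>)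
qed simp

lemma cwalk_up:
  "cwalk E lo hi (cut l, x) w (cut m, y) \<Longrightarrow> hi + d * C \<le> H \<Longrightarrow>
    cwalk E (lo + d * C) (hi + d * C) (cut (l + d), x) w (cut (m + d), y)"
  by (drule (1) cwalk_shift_up) (simp add: cut_add)

lemma cwalk_down:
  "cwalk E lo hi (cut (l + d), x) w (cut (m + d), y) \<Longrightarrow> d * C \<le> lo \<Longrightarrow> hi \<le> H \<Longrightarrow>
    cwalk E (lo - d * C) (hi - d * C) (cut l, x) w (cut m, y)"
  by (drule (2) cwalk_shift_down) (simp add: cut_add)

lemma walk_A: "walk (restr E lo hi) u w v \<Longrightarrow> snd u \<in> A \<Longrightarrow> snd v \<in> A"
proof (induction rule: walk_induct)
  case (snoc w v w' z)
  then show ?case using closed_A[of "fst v" "snd v" w' "fst z" "snd z"] by auto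
qed

text \<open>Edges move by at most one column, so column \<open>c\<close> cannot be jumped over. What
  matters later is the smaller range of the first part: translated along with its end point it does
  not overshoot that point.\<close>

lemma first_arrival:
  assumes "cwalk E lo hi u w v" "fst u \<le> c" "c \<le> hi"
  shows "cwalk E lo c u w v \<and> fst v \<le> c \<or>
    (\<exists>z w1 w2. cwalk E lo c u w1 (c, z) \<and> cwalk E lo hi (c, z) w2 v \<and> w = wadd w1 w2)"
  using assms(1)
proof (induction rule: walk_induct)
  case refl
  then show ?case using assms(2) by simp
next
  case (snoc w v w' z)
  from snoc.IH show ?case
  proof (elim disjE exE conjE)
    assume w: "cwalk E lo c u w v" "fst v \<le> c"
    show ?thesis
    proof (cases "fst z \<le> c")
      case True
      then have "(v, w', z) \<in> restr E lo c" using snoc.hyps(2) w(2) by auto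
      then show ?thesis using True walk_snoc[OF w(1)] by blast
    next
      case False
      then have "v = (c, snd v)"
        using snoc.hyps(2) w(2) adjacent[of "fst v" "snd v" w' "fst z" "snd z"] by (auto simp: prod_eq_iff)
      then show ?thesis using w(1) edge_walk[OF snoc.hyps(2)] by metis
    qed
  next
    fix y w1 w2 assume "cwalk E lo c u w1 (c, y)" "cwalk E lo hi (c, y) w2 v" "w = wadd w1 w2"
    then show ?thesis using walk_snoc[OF _ snoc.hyps(2)] by (metis wadd_assoc)
  qed
qed

text \<open>If the arrival is at a clock outside \<open>S\<close>, the zero-weight edges of
  \<open>at_cut\<close> allow a free detour to a clock of \<open>S\<close> and back.\<close>

lemma first_arrival_at_cut:
  assumes w: "cwalk E lo hi u w v" and u: "fst u \<le> cut l" "snd u \<in> A" and v: "cut l \<le> fst v"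
    and r: "lo \<le> cut l" "cut l \<le> hi" "hi \<le> H"
  shows "\<exists>z\<in>S. \<exists>w1 w2. cwalk E lo (cut l) u w1 (cut l, z) \<and> cwalk E lo hi (cut l, z) w2 v \<and> w = wadd w1 w2"
proof -
  have "\<exists>z w1 w2. cwalk E lo (cut l) u w1 (cut l, z) \<and> cwalk E lo hi (cut l, z) w2 v \<and> w = wadd w1 w2"
    using first_arrival[OF w u(1) r(2)]
  proof
    assume *: "cwalk E lo (cut l) u w v \<and> fst v \<le> cut l"
    then have "v = (cut l, snd v)" using v by (auto simp: prod_eq_iff)
    then show ?thesis using * by (metis walk_refl wadd_wzero(2))
  qed
  then obtain z w1 w2 where z: "cwalk E lo (cut l) u w1 (cut l, z)" "cwalk E lo hi (cut l, z) w2 v" "w = wadd w1 w2"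
    by blast
  have "z \<in> A" using walk_A[OF z(1) u(2)] by simp
  then obtain z' where z': "z' \<in> S" "z' = z \<or> ((cut l, z), wzero, (cut l, z')) \<in> E \<and> ((cut l, z'), wzero, (cut l, z)) \<in> E"
    using at_cut[of z l] r by (auto simp: cut_def)
  have "cwalk E lo (cut l) (cut l, z) wzero (cut l, z')" "cwalk E lo hi (cut l, z') wzero (cut l, z)"
    using z'(2) r by (auto intro: edge_walk)
  then have "cwalk E lo (cut l) u w1 (cut l, z')" "cwalk E lo hi (cut l, z') w2 v"
    using walk_trans[OF z(1)] walk_trans[OF _ z(2)] by fastforce+
  then show ?thesis using z'(1) z(3) by blast
qed

text \<open>Used to lower the top column of a walk one at a time: only walks that really visit
  column \<open>hi\<close> need surgery.\<close>

lemma visit: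
  assumes "cwalk E lo hi u w v" "0 < hi"
  shows "cwalk E lo (hi - 1) u w v \<or>
    (\<exists>z w1 w2. cwalk E lo hi u w1 (hi, z) \<and> cwalk E lo hi (hi, z) w2 v \<and> w = wadd w1 w2)"
  using assms(1)
proof (induction rule: walk_induct)
  case (snoc w v w' z)
  have vz: "fst v \<le> hi" "fst z \<le> hi" "lo \<le> fst v" "lo \<le> fst z" "(v, w', z) \<in> E"
    using snoc.hyps(2) by auto
  from snoc.IH show ?case
  proof (elim disjE exE conjE)
    assume w: "cwalk E lo (hi - 1) u w v"
    then have w': "cwalk E lo hi u w v" by (rule cwalk_mono) auto
    consider "fst v = hi" | "fst z = hi" | "(v, w', z) \<in> restr E lo (hi - 1)"
      using vz by fastforce
    then show ?thesis
    proof cases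
      case 1
      then have "v = (hi, snd v)" by (simp add: prod_eq_iff)
      then show ?thesis using w' edge_walk[OF snoc.hyps(2)] by metis
    next
      case 2
      then have "z = (hi, snd z)" by (simp add: prod_eq_iff)
      then show ?thesis using walk_snoc[OF w' snoc.hyps(2)] by (metis walk_refl wadd_wzero(2))
    next
      case 3
      then show ?thesis using walk_snoc[OF w] by blast
    qed
  next
    fix y w1 w2 assume "cwalk E lo hi u w1 (hi, y)" "cwalk E lo hi (hi, y) w2 v" "w = wadd w1 w2"
    then show ?thesis using walk_snoc[OF _ snoc.hyps(2)] by (metis wadd_assoc)
  qed
qed simp

text \<open>In \<open>pump\<close> reversal exchanges the two loops. Reversal is available for
  walks, which become paths again because the ends of each loop lie in different columns.\<close>

lemma strip_rev: "strip (rev_edges E) H C \<kappa> S A"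
proof
  show "0 < C" "finite S" "S \<subseteq> A" by (rule C_pos finite_S S_subset)+
next
  fix i x w j y assume "((i, x), w, (j, y)) \<in> rev_edges E"
  then show "i \<le> H \<and> j \<le> H \<and> i \<le> Suc j \<and> j \<le> Suc i" "x = y \<or> x \<in> A \<and> y \<in> A"
    using adjacent[of j y w i x] closed_A[of j y w i x] by auto
next
  fix i j x w y assume "i + C \<le> H" "j + C \<le> H"
  then show "((i + C, x), w, (j + C, y)) \<in> rev_edges E \<longleftrightarrow> ((i, x), w, (j, y)) \<in> rev_edges E"
    by (simp add: periodic)
next
  fix z l assume "z \<in> A" "\<kappa> + l * C \<le> H"
  then show "\<exists>z'\<in>S. z' = z \<or> ((\<kappa> + l * C, z), wzero, (\<kappa> + l * C, z')) \<in> rev_edges E \<and>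
      ((\<kappa> + l * C, z'), wzero, (\<kappa> + l * C, z)) \<in> rev_edges E"
    using at_cut[of z l] by auto
next
  fix x y g i w j w'
  assume a: "x \<in> S" "y \<in> S" "0 < g" "path (rev_edges E) (\<kappa> + i * C, x) w (\<kappa> + (i + g) * C, x)"
    "path (rev_edges E) (\<kappa> + (j + g) * C, y) w' (\<kappa> + j * C, y)"
  have "path E (\<kappa> + (i + g) * C, x) w (\<kappa> + i * C, x)" "path E (\<kappa> + j * C, y) w' (\<kappa> + (j + g) * C, y)"
    using path_walk[OF a(4)] path_walk[OF a(5)] a(3) C_pos by (auto simp: walk_path)
  then show "0 \<le> snd w + snd w'" using pump[of y x g j w' i w] a(1-3) by simp
qed

text \<open>
  In a climb the pieces sit at consecutive cuts. A ladder holds each piece translated to the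
  lowest cut, which is what remains meaningful after reordering the pieces.
\<close>

definition climb :: "nat \<Rightarrow> (nat \<Rightarrow> 'c) \<Rightarrow> (nat \<Rightarrow> weight) \<Rightarrow> nat \<Rightarrow> bool" where
  "climb K x f n \<longleftrightarrow>
     (\<forall>i<n. cwalk E (cut K) (cut (Suc (K + i))) (cut (K + i), x i) (f i) (cut (Suc (K + i)), x (Suc i)))"

definition ladder :: "nat \<Rightarrow> (nat \<Rightarrow> 'c) \<Rightarrow> (nat \<Rightarrow> weight) \<Rightarrow> bool" where
  "ladder K x f \<longleftrightarrow>
     (\<forall>i<K. cwalk E 0 (cut (Suc K)) (cut K, x i) (f i) (cut (Suc K), x (Suc i)))"

lemma climb_walk:
  assumes "climb K x f n" "a \<le> b" "b \<le> n"
  shows "cwalk E (cut K) (cut (K + b)) (cut (K + a), x a) (wsum f {a..<b}) (cut (K + b), x b)"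
  using assms(2,3)
proof (induction b rule: dec_induct)
  case (step b)
  have "cwalk E (cut K) (cut (Suc (K + b))) (cut (K + a), x a) (wsum f {a..<b}) (cut (K + b), x b)"
    by (rule cwalk_mono[OF step.IH]) (use step in \<open>auto intro: cut_mono\<close>)
  moreover have "cwalk E (cut K) (cut (Suc (K + b))) (cut (K + b), x b) (f b) (cut (Suc (K + b)), x (Suc b))"
    using assms(1) step by (simp add: climb_def)
  ultimately show ?case using step(1) by (simp add: wsum_Suc walk_trans)
qed simp

text \<open>Each step splits the remaining walk \<open>r\<close> at its first arrival at the next
  cut.\<close>

lemma climb_exists:
  assumes "cwalk E (cut K) hi (cut K, u) w v" "u \<in> S" "hi \<le> H"
  shows "cut (K + n) \<le> hi \<Longrightarrow> cut (K + n) \<le> fst v \<Longrightarrow>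
    \<exists>x f r. x 0 = u \<and> (\<forall>i\<le>n. x i \<in> S) \<and> climb K x f n \<and>
      cwalk E (cut K) hi (cut (K + n), x n) r v \<and> w = wadd (wsum f {0..<n}) r"
proof (induction n)
  case 0
  show ?case using assms by (intro exI[of _ "\<lambda>_. u"] exI[of _ "\<lambda>_. wzero"] exI[of _ w]) (auto simp: climb_def)
next
  case (Suc n)
  have le: "cut (K + n) \<le> cut (Suc (K + n))" by (rule cut_mono) simp
  then obtain x f r where x: "x 0 = u" "\<forall>i\<le>n. x i \<in> S" "climb K x f n"
      "cwalk E (cut K) hi (cut (K + n), x n) r v" "w = wadd (wsum f {0..<n}) r"
    using Suc by auto
  have "\<exists>z\<in>S. \<exists>w1 w2. cwalk E (cut K) (cut (Suc (K + n))) (cut (K + n), x n) w1 (cut (Suc (K + n)), z) \<and>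
      cwalk E (cut K) hi (cut (Suc (K + n)), z) w2 v \<and> r = wadd w1 w2"
    by (rule first_arrival_at_cut[OF x(4)])
       (use x(2) S_subset Suc.prems assms(3) in \<open>auto intro: cut_mono\<close>)
  then obtain z w1 w2 where z: "z \<in> S"
      "cwalk E (cut K) (cut (Suc (K + n))) (cut (K + n), x n) w1 (cut (Suc (K + n)), z)"
      "cwalk E (cut K) hi (cut (Suc (K + n)), z) w2 v" "r = wadd w1 w2"
    by blast
  define X where "X = x(Suc n := z)"
  define F where "F = f(n := w1)"
  have "wsum F {0..<n} = wsum f {0..<n}" by (rule wsum_cong) (auto simp: F_def)
  then have "w = wadd (wsum F {0..<Suc n}) w2" by (simp add: wsum_Suc x(5) z(4) wadd_assoc F_def)
  moreover have "climb K X F (Suc n)" using x(3) z(2) by (auto simp: climb_def less_Suc_eq X_def F_def)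
  moreover have "X 0 = u" "\<forall>i\<le>Suc n. X i \<in> S" using x(1,2) z(1) by (auto simp: X_def le_Suc_eq)
  moreover have "cwalk E (cut K) hi (cut (K + Suc n), X (Suc n)) w2 v" using z(3) by (simp add: X_def)
  ultimately show ?case by blast
qed

text \<open>The piece that starts at cut \<open>K + i\<close> may fall back to cut \<open>K\<close>,
  that is, by \<open>i\<close> periods. Since \<open>i < K\<close>, there is that much room below
  cut \<open>K\<close> too, so its translate fits.\<close>

lemma climb_ladder:
  assumes "climb K x f K" "cut (2 * K) \<le> H"
  shows "ladder K x f"
  unfolding ladder_def
proof (intro allI impI)
  fix i assume i: "i < K"
  have h: "cut (Suc (K + i)) \<le> H" using i by (intro order.trans[OF cut_mono assms(2)]) simp
  have "cwalk E (cut K) (cut (Suc (K + i))) (cut (K + i), x i) (f i) (cut (Suc K + i), x (Suc i))"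
    using assms(1) i by (simp add: climb_def)
  from cwalk_down[OF this cut_ge h] i
  have "cwalk E (cut K - i * C) (cut (Suc (K + i)) - i * C) (cut K, x i) (f i) (cut (Suc K), x (Suc i))"
    by simp
  then show "cwalk E 0 (cut (Suc K)) (cut K, x i) (f i) (cut (Suc K), x (Suc i))"
    by (rule cwalk_mono) (simp_all add: cut_add[of "Suc K" i, simplified])
qed

text \<open>Ladder pieces are only ever moved upwards from cut \<open>K\<close>, so they can be
  stacked on any cut \<open>l \<ge> K\<close>.\<close>

lemma ladder_walk:
  assumes "ladder K x f" "a \<le> b" "b \<le> K" "K \<le> l"
  shows "cut (l + (b - a)) \<le> H \<Longrightarrow>
    cwalk E 0 (cut (l + (b - a))) (cut l, x a) (wsum f {a..<b}) (cut (l + (b - a)), x b)"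
  using assms(2,3)
proof (induction b rule: dec_induct)
  case (step b)
  let ?m = "l + (b - a)"
  have m: "l + (Suc b - a) = Suc ?m" using step by simp
  have le: "cut ?m \<le> cut (Suc ?m)" by (rule cut_mono) simp
  have "cwalk E 0 (cut ?m) (cut l, x a) (wsum f {a..<b}) (cut ?m, x b)"
    using step le m by simp
  then have 1: "cwalk E 0 (cut (Suc ?m)) (cut l, x a) (wsum f {a..<b}) (cut ?m, x b)"
    by (rule cwalk_mono) (use le in auto)
  have "cwalk E 0 (cut (Suc K)) (cut K, x b) (f b) (cut (Suc K), x (Suc b))"
    using assms(1) step by (simp add: ladder_def)
  from cwalk_up[OF this, of "?m - K"]
  have "cwalk E ((?m - K) * C) (cut (Suc ?m)) (cut ?m, x b) (f b) (cut (Suc ?m), x (Suc b))"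
    using step assms(4) m by (simp add: cut_add[symmetric])
  then have "cwalk E 0 (cut (Suc ?m)) (cut ?m, x b) (f b) (cut (Suc ?m), x (Suc b))"
    by (rule cwalk_mono) auto
  from walk_trans[OF 1 this] show ?case using step by (simp add: m wsum_Suc)
qed simp

lemma descend_walk:
  assumes "strip.climb (rev_edges E) C \<kappa> K y g n" "a \<le> b" "b \<le> n"
  shows "cwalk E (cut K) (cut (K + b)) (cut (K + b), y b) (wsum g {a..<b}) (cut (K + a), y a)"
  using strip.climb_walk[OF strip_rev assms] by simp

lemma descend_ladder_walk:
  assumes "strip.ladder (rev_edges E) C \<kappa> K y g" "a \<le> b" "b \<le> K" "K \<le> l" "cut (l + (b - a)) \<le> H"
  shows "cwalk E 0 (cut (l + (b - a))) (cut (l + (b - a)), y b) (wsum g {a..<b}) (cut l, y a)"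
  using strip.ladder_walk[OF strip_rev assms(1-4)] assms(5) by simp

section \<open>Surgery that lowers the peak of an excursion\<close>

text \<open>The loop is skipped on the way up, which makes everything up to the visit
  \<open>d\<close> on the way down sink by \<open>c' - c\<close> periods; there the loop is run
  through at the same clock and closes the gap. The same pieces are used, so the weight is unchanged
  while the peak is lower.\<close>

lemma shift_loop:
  assumes x: "climb K x f K" and y: "strip.climb (rev_edges E) C \<kappa> K y g K"
    and m: "cwalk E (cut K) hi (cut (2 * K), x K) \<mu> (cut (2 * K), y K)"
    and hi: "cut (2 * K) < hi" "hi \<le> H"
    and c: "c < c'" "c' \<le> K" "d \<le> K" "x c = x c'" "y d = x c"
  shows "cwalk E 0 (hi - 1) (cut K, x 0) (wadd (wsum f {0..<K}) (wadd \<mu> (wsum g {0..<K}))) (cut K, y 0)"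
proof -
  \<comment> \<open>The height of the loop. As \<open>a \<le> K\<close>, the subtraction in
    \<open>K + d - a\<close> below is not truncated.\<close>
  define a where "a = c' - c"
  have a: "0 < a" "c' = c + a" "a \<le> K" using c by (auto simp: a_def)
  have cK: "cut (K + j) \<le> hi" if "j \<le> K" for j
    using cut_mono[of "K + j" "2 * K"] that hi by simp
  have cK1: "cut (K + j) \<le> hi - 1" if "j \<le> K" for j
    using cut_mono[of "K + j" "2 * K"] that hi by simp
  have p1: "cwalk E 0 (hi - 1) (cut K, x 0) (wsum f {0..<c}) (cut (K + c), x c)"
    by (rule cwalk_mono[OF climb_walk[OF x, of 0 c, simplified]]) (use c cK1 in auto)
  have m1: "cwalk E (cut K) hi (cut (K + c'), x c') (wsum f {c'..<K}) (cut (2 * K), x K)"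
    by (rule cwalk_mono[OF climb_walk[OF x, of c' K, simplified, folded mult_2]])
       (use c cK[of K] in \<open>auto simp: mult_2\<close>)
  have m3: "cwalk E (cut K) hi (cut (2 * K), y K) (wsum g {d..<K}) (cut (K + d), y d)"
    by (rule cwalk_mono[OF descend_walk[OF y, of d K, simplified, folded mult_2]])
       (use c cK[of K] in \<open>auto simp: mult_2\<close>)
  have "cwalk E (cut K) hi (cut (K + c'), x c') (wadd (wsum f {c'..<K}) (wadd \<mu> (wsum g {d..<K}))) (cut (K + d), y d)"
    using walk_trans[OF m1 walk_trans[OF m m3]] .
  then have "cwalk E (cut K) hi (cut (K + c + a), x c) (wadd (wsum f {c'..<K}) (wadd \<mu> (wsum g {d..<K})))
      (cut (K + d - a + a), y d)"
    using a c by (simp add: algebra_simps)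
  from cwalk_down[OF this cut_ge hi(2)] a
  have "cwalk E (cut K - a * C) (hi - a * C) (cut (K + c), x c) (wadd (wsum f {c'..<K}) (wadd \<mu> (wsum g {d..<K})))
      (cut (K + d - a), y d)"
    by simp
  moreover have "1 \<le> a * C" using a(1) C_pos by simp
  then have "hi - a * C \<le> hi - 1" by linarith
  ultimately have p2: "cwalk E 0 (hi - 1) (cut (K + c), x c) (wadd (wsum f {c'..<K}) (wadd \<mu> (wsum g {d..<K})))
      (cut (K + d - a), y d)"
    by (elim cwalk_mono) auto
  have l: "cwalk E (cut K) (cut (K + c')) (cut (K + c), x c) (wsum f {c..<c'}) (cut (K + c'), x c)"
    using climb_walk[OF x, of c c'] c by simp
  have p3: "cwalk E 0 (hi - 1) (cut (K + d - a), y d) (wsum f {c..<c'}) (cut (K + d), y d)"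
  \<comment> \<open>The top of the loop moves from cut \<open>K + c'\<close> to cut
    \<open>K + d\<close>, so the loop is translated upwards or downwards according to this
    comparison.\<close>
  proof (cases "c' \<le> d")
    case True
    have eq: "K + c + (d - c') = K + d - a" "K + c' + (d - c') = K + d"
      using True a by auto
    have "cwalk E (cut K + (d - c') * C) (cut (K + c') + (d - c') * C) (cut (K + d - a), x c) (wsum f {c..<c'})
      (cut (K + d), x c)"
      using cwalk_up[OF l, of "d - c'", unfolded eq] cK[OF c(3)] hi(2) eq(2) by (simp add: cut_add[symmetric])
    then show ?thesis unfolding c(5)
      by (rule cwalk_mono) (use cK1[OF c(3)] eq(2) in \<open>auto simp: cut_add[symmetric]\<close>)
  next
    case False
    have eq: "K + c = K + d - a + (c' - d)" "K + c' = K + d + (c' - d)"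
      using False a by auto
    have "cwalk E (cut K - (c' - d) * C) (cut (K + c') - (c' - d) * C) (cut (K + d - a), x c) (wsum f {c..<c'})
      (cut (K + d), x c)"
    proof (rule cwalk_down)
      show "cwalk E (cut K) (cut (K + c')) (cut (K + d - a + (c' - d)), x c) (wsum f {c..<c'})
        (cut (K + d + (c' - d)), x c)"
        using l by (simp only: eq[symmetric])
      show "(c' - d) * C \<le> cut K" using c by (intro cut_ge) simp
      show "cut (K + c') \<le> H" using cK[OF c(2)] hi(2) by simp
    qed
    moreover have "cut (K + c') - (c' - d) * C = cut (K + d)"
      by (simp only: eq(2) cut_add[of "K + d"] diff_add_inverse2)
    ultimately show ?thesis unfolding c(5) using cK1[OF c(3)] by (elim cwalk_mono) auto
  qed
  have p4: "cwalk E 0 (hi - 1) (cut (K + d), y d) (wsum g {0..<d}) (cut K, y 0)"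
    by (rule cwalk_mono[OF descend_walk[OF y, of 0 d, simplified]]) (use c cK1 in auto)
  have "wadd (wsum f {0..<c}) (wadd (wadd (wsum f {c'..<K}) (wadd \<mu> (wsum g {d..<K})))
      (wadd (wsum f {c..<c'}) (wsum g {0..<d}))) = wadd (wsum f {0..<K}) (wadd \<mu> (wsum g {0..<K}))"
    using wsum_ivl[of 0 c K f] wsum_ivl[of c c' K f] wsum_ivl[of 0 d K g] c by (simp add: wadd_ac)
  then show ?thesis
    using walk_trans[OF p1 walk_trans[OF p2 walk_trans[OF p3 p4]]] by simp
qed

text \<open>Both flanks lose the same \<open>i' - i\<close> pieces, so the top part sinks by that
  number of periods and the ends meet again. Stated for ladders, because it is applied to reordered
  pieces.\<close>

lemma cut_out:
  assumes x: "ladder K x f" and y: "strip.ladder (rev_edges E) C \<kappa> K y g"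
    and m: "cwalk E (cut K) hi (cut (2 * K), x K) \<mu> (cut (2 * K), y K)"
    and hi: "cut (2 * K) < hi" "hi \<le> H"
    and c: "i < i'" "i' \<le> K" "x i = x i'" "y i = y i'"
  shows "cwalk E 0 (hi - 1) (cut K, x 0)
    (wadd (wadd (wsum f {0..<i}) (wsum f {i'..<K})) (wadd \<mu> (wadd (wsum g {i'..<K}) (wsum g {0..<i})))) (cut K, y 0)"
proof -
  define a where "a = i' - i"
  have a: "0 < a" "i' = i + a" "a \<le> K" using c by (auto simp: a_def)
  have cK1: "cut (K + j) \<le> hi - 1" "cut (K + j) \<le> H" if "j \<le> K" for j
    using cut_mono[of "K + j" "2 * K"] that hi by auto
  have eq: "K + i + (K - i') = 2 * K - a" "2 * K - a = K + (K - a)" using a c by auto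
  have p1: "cwalk E 0 (hi - 1) (cut K, x 0) (wsum f {0..<i}) (cut (K + i), x i)"
    by (rule cwalk_mono[OF ladder_walk[OF x, of 0 i K, simplified]]) (use c cK1 in auto)
  have p2: "cwalk E 0 (hi - 1) (cut (K + i), x i') (wsum f {i'..<K}) (cut (2 * K - a), x K)"
    by (rule cwalk_mono[OF ladder_walk[OF x, of i' K "K + i", unfolded eq(1)]])
       (use c cK1[of "K - a"] in \<open>auto simp: eq(2)\<close>)
  have "cwalk E (cut K) hi (cut (2 * K - a + a), x K) \<mu> (cut (2 * K - a + a), y K)"
    using m a by simp
  from cwalk_down[OF this cut_ge hi(2)] a
  have "cwalk E (cut K - a * C) (hi - a * C) (cut (2 * K - a), x K) \<mu> (cut (2 * K - a), y K)" by simp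
  moreover have "1 \<le> a * C" using a(1) C_pos by simp
  then have "hi - a * C \<le> hi - 1" by linarith
  ultimately have p3: "cwalk E 0 (hi - 1) (cut (2 * K - a), x K) \<mu> (cut (2 * K - a), y K)"
    by (elim cwalk_mono) auto
  have p4: "cwalk E 0 (hi - 1) (cut (2 * K - a), y K) (wsum g {i'..<K}) (cut (K + i), y i')"
    by (rule cwalk_mono[OF descend_ladder_walk[OF y, of i' K "K + i", unfolded eq(1)]])
       (use c cK1[of "K - a"] in \<open>auto simp: eq(2)\<close>)
  have p5: "cwalk E 0 (hi - 1) (cut (K + i), y i) (wsum g {0..<i}) (cut K, y 0)"
    by (rule cwalk_mono[OF descend_ladder_walk[OF y, of 0 i K, simplified]]) (use c cK1 in auto)
  show ?thesis
    using walk_trans[OF p1 walk_trans[OF p2[folded c(3)] walk_trans[OF p3 walk_trans[OF p4 p5[unfolded c(4)]]]]]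
    by (simp add: wadd_assoc)
qed

text \<open>Stacked on cut \<open>K\<close>, the two loops span the same cuts in opposite
  directions, as \<open>pump\<close> requires.\<close>

lemma loops_nonneg:
  assumes x: "ladder K x f" and y: "strip.ladder (rev_edges E) C \<kappa> K y g" and H: "cut (2 * K) \<le> H"
    and S: "x i \<in> S" "y i \<in> S" and c: "i < i'" "i' \<le> K" "x i = x i'" "y i = y i'"
  shows "0 \<le> snd (wsum f {i..<i'}) + snd (wsum g {i..<i'})"
proof -
  let ?g = "i' - i"
  have g: "0 < ?g" using c by simp
  have "K + ?g \<le> 2 * K" using c by simp
  then have gH: "cut (K + ?g) \<le> H" using H by (rule order.trans[OF cut_mono])
  have ne: "cut K \<noteq> cut (K + ?g)" using g by (simp only: cut_inj)
  have "cwalk E 0 (cut (K + ?g)) (cut K, x i) (wsum f {i..<i'}) (cut (K + ?g), x i')"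
    by (rule ladder_walk[OF x]) (use c gH in auto)
  then have 1: "path E (cut K, x i) (wsum f {i..<i'}) (cut (K + ?g), x i)"
    using ne c(3) by (metis walk_path walk_mono restr_subset prod.inject)
  have "cwalk E 0 (cut (K + ?g)) (cut (K + ?g), y i') (wsum g {i..<i'}) (cut K, y i)"
    by (rule descend_ladder_walk[OF y]) (use c gH in auto)
  then have 2: "path E (cut (K + ?g), y i) (wsum g {i..<i'}) (cut K, y i)"
    using ne c(4) by (metis walk_path walk_mono restr_subset prod.inject)
  show ?thesis using pump[OF S g(1) 1[unfolded cut_def] 2[unfolded cut_def]] .
qed

end

text \<open>\<open>x (Suc (\<rho> j))\<close> is the end of piece \<open>\<rho> j\<close>, so the
  last clause says that the pieces fit together in the new order. \<open>\<rho> K = K\<close> is a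
  sentinel for the final vertex, which starts no piece.\<close>

definition rearranges :: "nat \<Rightarrow> (nat \<Rightarrow> 'a) \<Rightarrow> (nat \<Rightarrow> nat) \<Rightarrow> bool" where
  "rearranges K x \<rho> \<longleftrightarrow> bij_betw \<rho> {..<K} {..<K} \<and> \<rho> K = K \<and> x (\<rho> 0) = x 0 \<and>
     (\<forall>j<K. x (Suc (\<rho> j)) = x (\<rho> (Suc j)))"

lemma rearranges_id: "rearranges K x id"
  by (simp add: rearranges_def)

text \<open>The common clock at \<open>h\<close>, \<open>i\<close> and \<open>i'\<close> makes the
  blocks from \<open>h\<close> to \<open>i\<close> and from \<open>i\<close> to \<open>i'\<close>
  adjacent closed loops; the index map lets the second come first.\<close>

lemma rearranges_swap_loops:
  assumes \<rho>: "rearranges K x \<rho>" and h: "h < i" "i < i'" "i' \<le> K"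
    and eq: "x (\<rho> h) = x (\<rho> i)" "x (\<rho> i') = x (\<rho> i)"
  shows "rearranges K x (\<lambda>j. \<rho> (if h \<le> j \<and> j < h + (i' - i) then j - h + i
           else if h + (i' - i) \<le> j \<and> j < i' then j - (i' - i) else j))"
proof -
  define \<tau> where "\<tau> j = (if h \<le> j \<and> j < h + (i' - i) then j - h + i
           else if h + (i' - i) \<le> j \<and> j < i' then j - (i' - i) else j)" for j
  have "inj_on \<tau> {..<K}"
    using h by (auto simp: inj_on_def \<tau>_def split: if_splits)
  moreover have "\<tau> ` {..<K} \<subseteq> {..<K}" using h by (auto simp: \<tau>_def)
  ultimately have "bij_betw \<tau> {..<K} {..<K}"
    by (simp add: bij_betw_def endo_inj_surj)
  then have "bij_betw (\<lambda>j. \<rho> (\<tau> j)) {..<K} {..<K}"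
    using \<rho> bij_betw_trans[of \<tau> _ _ \<rho>] by (simp add: rearranges_def comp_def)
  moreover have "\<tau> K = K" using h by (simp add: \<tau>_def)
  moreover have "x (\<rho> (\<tau> 0)) = x 0"
  proof (cases "h = 0")
    case True
    then have "\<tau> 0 = i" using h by (simp add: \<tau>_def)
    then show ?thesis using True eq \<rho> by (simp add: rearranges_def)
  next
    case False
    then have "\<tau> 0 = 0" by (simp add: \<tau>_def)
    then show ?thesis using \<rho> by (simp add: rearranges_def)
  qed
  moreover have "x (Suc (\<rho> (\<tau> j))) = x (\<rho> (\<tau> (Suc j)))" if j: "j < K" for j
  proof -
    have "\<tau> j < K" using j h by (auto simp: \<tau>_def)
    then have "x (Suc (\<rho> (\<tau> j))) = x (\<rho> (Suc (\<tau> j)))" using \<rho> by (simp add: rearranges_def)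
    also have "\<dots> = x (\<rho> (\<tau> (Suc j)))"
    proof -
      \<comment> \<open>The index map commutes with \<open>Suc\<close> except at the borders of the
        two blocks, and there both sides carry the common clock.\<close>
      consider "Suc j = h" | "Suc j = h + (i' - i)" | "Suc j = i'" "Suc j \<noteq> h + (i' - i)"
        | "Suc j \<noteq> h" "Suc j \<noteq> h + (i' - i)" "Suc j \<noteq> i'" by blast
      then show ?thesis
      proof cases
        case 1
        then have "Suc (\<tau> j) = h" "\<tau> (Suc j) = i" using h by (auto simp: \<tau>_def)
        then show ?thesis using eq by simp
      next
        case 2
        then have "Suc (\<tau> j) = i'" "\<tau> (Suc j) = h" using h by (auto simp: \<tau>_def)
        then show ?thesis using eq by simp
      next
        case 3
        then have "Suc (\<tau> j) = i" "\<tau> (Suc j) = i'" using h by (auto simp: \<tau>_def)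
        then show ?thesis using eq by simp
      next
        case 4
        then have "\<tau> (Suc j) = Suc (\<tau> j)" using h by (auto simp: \<tau>_def)
        then show ?thesis by simp
      qed
    qed
    finally show ?thesis .
  qed
  ultimately show ?thesis using \<rho> by (simp add: rearranges_def \<tau>_def)
qed

lemma wsum_reindex: "bij_betw \<rho> I J \<Longrightarrow> wsum (\<lambda>i. f (\<rho> i)) I = wsum f J"
  using sum.reindex_bij_betw[of \<rho> I J "\<lambda>i. snd (f i)"]
  by (intro weight_eqI) (auto simp: bij_betw_def)

context strip
begin

text \<open>Of the hypotheses of \<open>two_word_bound\<close> this derives \<open>D\<close>; the
  others are facts about the climb before reordering and are passed on.\<close>

lemma ladder_bound:
  assumes x: "ladder K x f" and y: "strip.ladder (rev_edges E) C \<kappa> K y g"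
    and m: "cwalk E (cut K) hi (cut (2 * K), x K) \<mu> (cut (2 * K), y K)"
    and hi: "cut (2 * K) < hi" "hi \<le> H"
    and S: "x ` {..K} \<subseteq> S" "y ` {..K} \<subseteq> S"
    and w: "w = wadd (wsum f {0..<K}) (wadd \<mu> (wsum g {0..<K}))"
    and strict: "fst w \<Longrightarrow> fst \<mu> \<or> k < K \<and> fst (f k)"
    and no: "\<nexists>w'. wle w' w \<and> cwalk E 0 (hi - 1) (cut K, x 0) w' (cut K, y 0)"
    and RX: "\<And>i i' j. i < i' \<Longrightarrow> i' \<le> K \<Longrightarrow> j \<le> K \<Longrightarrow> x i = x i' \<Longrightarrow> y j \<noteq> x i"
    and RY: "\<And>i i' j. i < i' \<Longrightarrow> i' \<le> K \<Longrightarrow> j \<le> K \<Longrightarrow> y i = y i' \<Longrightarrow> x j \<noteq> y i"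
    and N: "\<And>h i i'. h < i \<Longrightarrow> i \<le> k \<Longrightarrow> k < i' \<Longrightarrow> i' \<le> K \<Longrightarrow> x h = x i \<Longrightarrow> x i' \<noteq> x i"
  shows "4 * (K + 1) \<le> (card S + 1)\<^sup>2"
proof (rule two_word_bound[OF finite_S S, where k = k])
  show "y j \<noteq> x i" if "i < i'" "i' \<le> K" "j \<le> K" "x i = x i'" for i i' j by (rule RX[OF that])
  show "x j \<noteq> y i" if "i < i'" "i' \<le> K" "j \<le> K" "y i = y i'" for i i' j by (rule RY[OF that])
  show "x i' \<noteq> x i" if "h < i" "i \<le> k" "k < i'" "i' \<le> K" "x h = x i" for h i i' by (rule N[OF that])
next
  fix i i' assume i: "i < i'" "i' \<le> K" "i' \<le> k \<or> k < i" "x i = x i'"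
  show "y i \<noteq> y i'"
  proof
    assume y_eq: "y i = y i'"
    let ?w = "wadd (wadd (wsum f {0..<i}) (wsum f {i'..<K})) (wadd \<mu> (wadd (wsum g {i'..<K}) (wsum g {0..<i})))"
    have xS: "x i \<in> S" "y i \<in> S" using S i by auto
    have n: "0 \<le> snd (wsum f {i..<i'}) + snd (wsum g {i..<i'})"
      by (rule loops_nonneg[OF x y _ xS i(1,2,4) y_eq]) (use hi in simp)
    have split: "wsum h {0..<K} = wadd (wsum h {0..<i}) (wadd (wsum h {i..<i'}) (wsum h {i'..<K}))" for h
      using wsum_ivl[of 0 i K h] wsum_ivl[of i i' K h] i by simp
    have w_eq: "w = wadd (wadd (wsum f {i..<i'}) (wsum g {i..<i'})) ?w"
      unfolding w split by (simp add: wadd_ac)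
    \<comment> \<open>The removed range does not contain \<open>k\<close>, so a strict piece at
      \<open>k\<close> survives, and \<open>\<mu>\<close> is kept anyway.\<close>
    have "fst ?w" if "fst w"
      using strict[OF that] i(3) by (auto intro: bexI[of _ k])
    moreover have "snd ?w \<le> snd w" using n by (simp add: w_eq del: snd_wsum)
    ultimately have "wle ?w w" unfolding wle_iff le_less by blast
    then show False
      using no cut_out[OF x y m hi i(1,2,4) y_eq] by blast
  qed
qed

text \<open>
  If the only strict edges lie in upward pieces, fix one such piece \<open>p\<close> and reorder the pieces so that it
  comes as early as possible; minimality gives hypothesis \<open>N\<close> of two_word_bound.
\<close>

lemma climb_bound:
  assumes x: "climb K x f K" and y: "strip.climb (rev_edges E) C \<kappa> K y g K"
    and m: "cwalk E (cut K) hi (cut (2 * K), x K) \<mu> (cut (2 * K), y K)"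
    and hi: "cut (2 * K) < hi" "hi \<le> H"
    and S: "x ` {..K} \<subseteq> S" "y ` {..K} \<subseteq> S"
    and w: "w = wadd (wsum f {0..<K}) (wadd \<mu> (wsum g {0..<K}))"
    and strict: "fst w \<Longrightarrow> fst \<mu> \<or> (\<exists>i<K. fst (f i))"
    and no: "\<nexists>w'. wle w' w \<and> cwalk E 0 (hi - 1) (cut K, x 0) w' (cut K, y 0)"
  shows "4 * (K + 1) \<le> (card S + 1)\<^sup>2"
proof -
  have H: "cut (2 * K) \<le> H" using hi by simp
  have x': "ladder K x f" by (rule climb_ladder[OF x H])
  have y': "strip.ladder (rev_edges E) C \<kappa> K y g" by (rule strip.climb_ladder[OF strip_rev y H])
  have RX: "y j \<noteq> x i" if "i < i'" "i' \<le> K" "j \<le> K" "x i = x i'" for i i' j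
  proof
    assume "y j = x i"
    from shift_loop[OF x y m hi that this] show False using no wle_refl unfolding w by blast
  qed
  have RY: "x j \<noteq> y i" if "i < i'" "i' \<le> K" "j \<le> K" "y i = y i'" for i i' j
  proof
    assume eq: "x j = y i"
    \<comment> \<open>The same surgery in the reversed graph, where the descent is the
      climb.\<close>
    have "cwalk (rev_edges E) 0 (hi - 1) (cut K, y 0) (wadd (wsum g {0..<K}) (wadd \<mu> (wsum f {0..<K}))) (cut K, x 0)"
      by (rule strip.shift_loop[OF strip_rev, where c = i and c' = i' and d = j])
         (use x y m hi that eq in simp_all)
    then have "cwalk E 0 (hi - 1) (cut K, x 0) w (cut K, y 0)" by (simp add: w wadd_ac)
    then show False using no wle_refl by blast
  qed
  show ?thesis
  proof (cases "fst w \<and> \<not> fst \<mu>")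
    case False
    show ?thesis
    \<comment> \<open>No piece has to be spared here, and with \<open>k = K\<close> the hypothesis
      \<open>N\<close> is vacuous.\<close>
    proof (rule ladder_bound[OF x' y' m hi S w _ no, of K])
      show "fst \<mu> \<or> K < K \<and> fst (f K)" if "fst w" using that False by blast
    qed (fact RX RY | simp)+
  next
    case True
    then obtain p where p: "p < K" "fst (f p)" using strict by blast
    define good where "good k \<rho> \<longleftrightarrow> rearranges K x \<rho> \<and> k < K \<and> \<rho> k = p" for k \<rho>
    have "\<exists>k \<rho>. good k \<rho>" using p rearranges_id[of K x]
      by (intro exI[of _ p] exI[of _ id]) (simp add: good_def)
    then have "\<exists>\<rho>. good (LEAST k. \<exists>\<rho>. good k \<rho>) \<rho>" by (rule LeastI_ex)
    moreover define k where "k = (LEAST k. \<exists>\<rho>. good k \<rho>)"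
    ultimately have "\<exists>\<rho>. good k \<rho>" by simp
    then obtain \<rho> where \<rho>: "good k \<rho>" ..
    have least: "\<nexists>\<rho>. good k' \<rho>" if "k' < k" for k'
      using that unfolding k_def by (rule not_less_Least)
    from \<rho> have r: "rearranges K x \<rho>" "k < K" "\<rho> k = p" by (simp_all add: good_def)
    have bij: "bij_betw \<rho> {..<K} {..<K}" and rK: "\<rho> K = K" and r0: "x (\<rho> 0) = x 0"
      and rS: "\<And>j. j < K \<Longrightarrow> x (Suc (\<rho> j)) = x (\<rho> (Suc j))"
      using r by (simp_all add: rearranges_def)
    have rlt: "\<rho> j < K" if "j < K" for j using bij that by (auto simp: bij_betw_def)
    have rle: "\<rho> j \<le> K" if "j \<le> K" for j using rlt[of j] rK that by (cases "j = K") auto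
    have rinj: "\<rho> i \<noteq> \<rho> j" if "i < j" "j \<le> K" for i j
    proof (cases "j = K")
      case True
      then show ?thesis using rlt[of i] rK that by simp
    next
      case False
      then show ?thesis using bij that by (auto simp: bij_betw_def dest: inj_onD)
    qed
    define X F where "X i = x (\<rho> i)" and "F i = f (\<rho> i)" for i
    have lad: "ladder K X F"
      unfolding ladder_def
    proof (intro allI impI)
      fix i assume i: "i < K"
      then have "cwalk E 0 (cut (Suc K)) (cut K, x (\<rho> i)) (f (\<rho> i)) (cut (Suc K), x (Suc (\<rho> i)))"
        using x' rlt by (simp add: ladder_def)
      then show "cwalk E 0 (cut (Suc K)) (cut K, X i) (F i) (cut (Suc K), X (Suc i))"
        by (simp only: X_def F_def rS[OF i])
    qed
    have w': "w = wadd (wsum F {0..<K}) (wadd \<mu> (wsum g {0..<K}))"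
      unfolding w using wsum_reindex[OF bij, of f] by (simp add: F_def[abs_def] lessThan_atLeast0)
    show ?thesis
    proof (rule ladder_bound[OF lad y' _ hi _ S(2) w'])
      show "cwalk E (cut K) hi (cut (2 * K), X K) \<mu> (cut (2 * K), y K)" using m by (simp add: X_def rK)
      show "X ` {..K} \<subseteq> S" using S(1) rle by (auto simp: X_def)
      show "fst \<mu> \<or> k < K \<and> fst (F k)" using r p by (simp add: F_def)
      show "\<nexists>w'. wle w' w \<and> cwalk E 0 (hi - 1) (cut K, X 0) w' (cut K, y 0)"
        using no by (simp add: X_def r0)
      show "y j \<noteq> X i" if "i < i'" "i' \<le> K" "j \<le> K" "X i = X i'" for i i' j
      \<comment> \<open>Reordering may invert the two positions, but \<open>RX\<close> is symmetric
        in them.\<close>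
      proof (cases "\<rho> i < \<rho> i'")
        case True
        then show ?thesis using RX[OF True] rle[of i'] that by (simp add: X_def)
      next
        case False
        then have "\<rho> i' < \<rho> i" using rinj[OF that(1,2)] by simp
        then show ?thesis using RX[of "\<rho> i'" "\<rho> i" j] rle[of i] that by (simp add: X_def)
      qed
      show "X j \<noteq> y i" if "i < i'" "i' \<le> K" "j \<le> K" "y i = y i'" for i i' j
        using RY[OF that(1,2) rle[OF that(3)] that(4)] by (simp add: X_def)
      show "X i' \<noteq> X i" if h: "h < i" "i \<le> k" "k < i'" "i' \<le> K" "X h = X i" for h i i'
      proof
        assume eq: "X i' = X i"
        \<comment> \<open>Putting the loop that contains position \<open>k\<close> first advances
          \<open>p\<close> by the length \<open>i - h\<close> of the other loop, against the
          minimality of \<open>k\<close>.\<close>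
        have "good (k - (i - h)) (\<lambda>j. \<rho> (if h \<le> j \<and> j < h + (i' - i) then j - h + i
           else if h + (i' - i) \<le> j \<and> j < i' then j - (i' - i) else j))"
          unfolding good_def
        proof (intro conjI)
          show "rearranges K x (\<lambda>j. \<rho> (if h \<le> j \<and> j < h + (i' - i) then j - h + i
             else if h + (i' - i) \<le> j \<and> j < i' then j - (i' - i) else j))"
            by (rule rearranges_swap_loops[OF r(1) h(1) _ h(4)]) (use h eq in \<open>simp_all add: X_def\<close>)
        qed (use h r in auto)
        moreover have "k - (i - h) < k" using h by simp
        ultimately show False using least by blast
      qed
    qed
  qed
qed

text \<open>Otherwise the walk visits column \<open>hi\<close> above cut \<open>2 * K\<close>, so
  its words up and down both have \<open>K\<close> pieces, too many for \<open>climb_bound\<close>.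
  The new walk may go below cut \<open>K\<close>, hence the range from 0.\<close>

lemma lower_excursion:
  assumes big: "(card S + 1)\<^sup>2 < 4 * (K + 1)" and hi: "cut (2 * K) < hi" "hi \<le> H"
    and w: "cwalk E (cut K) hi (cut K, u) w (cut K, v)" and S: "u \<in> S" "v \<in> S"
  shows "\<exists>w'. wle w' w \<and> cwalk E 0 (hi - 1) (cut K, u) w' (cut K, v)"
proof (rule ccontr)
  assume no: "\<nexists>w'. wle w' w \<and> cwalk E 0 (hi - 1) (cut K, u) w' (cut K, v)"
  have "\<not> cwalk E (cut K) (hi - 1) (cut K, u) w (cut K, v)"
    using no cwalk_mono[of E "cut K" "hi - 1" _ _ _ 0 "hi - 1"] wle_refl by blast
  then obtain z w1 w2 where z: "cwalk E (cut K) hi (cut K, u) w1 (hi, z)"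
      "cwalk E (cut K) hi (hi, z) w2 (cut K, v)" "w = wadd w1 w2"
    using visit[OF w] hi by auto
  have le: "cut (K + K) \<le> hi" using hi by (simp add: mult_2)
  from climb_exists[OF z(1) S(1) hi(2) le]
  obtain x f r where x: "x 0 = u" "\<forall>i\<le>K. x i \<in> S" "climb K x f K"
      "cwalk E (cut K) hi (cut (K + K), x K) r (hi, z)" "w1 = wadd (wsum f {0..<K}) r"
    using le by auto
  have z2: "cwalk (rev_edges E) (cut K) hi (cut K, v) w2 (hi, z)" using z(2) by simp
  from strip.climb_exists[OF strip_rev z2 S(2) hi(2) le]
  obtain y g r' where y: "y 0 = v" "\<forall>i\<le>K. y i \<in> S" "strip.climb (rev_edges E) C \<kappa> K y g K"
      "cwalk (rev_edges E) (cut K) hi (cut (K + K), y K) r' (hi, z)" "w2 = wadd (wsum g {0..<K}) r'"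
    using le by auto
  have m: "cwalk E (cut K) hi (cut (2 * K), x K) (wadd r r') (cut (2 * K), y K)"
    using walk_trans[OF x(4)] y(4) by (simp add: mult_2)
  have w_eq: "w = wadd (wsum f {0..<K}) (wadd (wadd r r') (wsum g {0..<K}))"
    by (simp add: z(3) x(5) y(5) wadd_ac)
  have "4 * (K + 1) \<le> (card S + 1)\<^sup>2"
  proof (cases "fst (wadd r r') \<or> (\<exists>i<K. fst (f i)) \<or> \<not> fst w")
    case True
    show ?thesis
      by (rule climb_bound[OF x(3) y(3) m hi _ _ w_eq]) (use True no x(1,2) y(1,2) in auto)
  next
    case False
    \<comment> \<open>All strict edges lie on the way down, so the bound is applied to the reversed
      strip, where that side is the climb.\<close>
    then have "\<exists>i<K. fst (g i)" by (auto simp: w_eq)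
    show ?thesis
    proof (rule strip.climb_bound[OF strip_rev y(3), where g = f and y = x and w = w and \<mu> = "wadd r r'" and hi = hi])
      show "strip.climb (rev_edges (rev_edges E)) C \<kappa> K x f K" using x(3) by simp
      show "cwalk (rev_edges E) (cut K) hi (cut (2 * K), y K) (wadd r r') (cut (2 * K), x K)" using m by simp
      show "cut (2 * K) < hi" "hi \<le> H" by (rule hi)+
      show "y ` {..K} \<subseteq> S" "x ` {..K} \<subseteq> S" using x(2) y(2) by auto
      show "w = wadd (wsum g {0..<K}) (wadd (wadd r r') (wsum f {0..<K}))"
        unfolding w_eq by (simp only: wadd_ac)
      show "fst (wadd r r') \<or> (\<exists>i<K. fst (g i))" using \<open>\<exists>i<K. fst (g i)\<close> ..
      show "\<nexists>w'. wle w' w \<and> cwalk (rev_edges E) 0 (hi - 1) (cut K, y 0) w' (cut K, x 0)"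
        using no x(1) y(1) by simp
    qed
  qed
  then show False using big by simp
qed

text \<open>Both ends are moved to clocks of \<open>S\<close> along the free edges of
  \<open>at_cut\<close>, and back afterwards.\<close>

lemma lower_excursion_A:
  assumes big: "(card S + 1)\<^sup>2 < 4 * (K + 1)" and hi: "cut (2 * K) < hi" "hi \<le> H"
    and w: "cwalk E (cut K) hi (cut K, u) w (cut K, v)" and A: "u \<in> A"
  shows "\<exists>w'. wle w' w \<and> cwalk E 0 (hi - 1) (cut K, u) w' (cut K, v)"
proof -
  have vA: "v \<in> A" using walk_A[OF w] A by simp
  have cK: "cut K \<le> hi - 1" using cut_mono[of K "2 * K"] hi by simp
  have hi1: "hi - 1 \<le> H" using hi by simp
  have "\<exists>u'\<in>S. cwalk E lo h (cut K, u) wzero (cut K, u') \<and> cwalk E lo h (cut K, u') wzero (cut K, u)"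
    if "u \<in> A" "lo \<le> cut K" "cut K \<le> h" "h \<le> H" for u lo h
  proof -
    have "\<kappa> + K * C \<le> H" using that by (simp add: cut_def)
    from at_cut[OF that(1) this, folded cut_def]
    obtain u' where "u' \<in> S" "u' = u \<or> ((cut K, u), wzero, (cut K, u')) \<in> E \<and> ((cut K, u'), wzero, (cut K, u)) \<in> E"
      by blast
    then show ?thesis using that by (cases "u' = u") (auto intro!: bexI[of _ u'] intro: edge_walk)
  qed
  note conn = this
  obtain u' where u': "u' \<in> S" "cwalk E (cut K) (hi - 1) (cut K, u) wzero (cut K, u')"
      "cwalk E (cut K) (hi - 1) (cut K, u') wzero (cut K, u)"
    using conn[OF A order.refl cK hi1] by blast
  obtain v' where v': "v' \<in> S" "cwalk E (cut K) (hi - 1) (cut K, v) wzero (cut K, v')"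
      "cwalk E (cut K) (hi - 1) (cut K, v') wzero (cut K, v)"
    using conn[OF vA order.refl cK hi1] by blast
  note up = cwalk_mono[where lo' = "cut K" and hi' = hi] cwalk_mono[where lo' = 0 and hi' = "hi - 1"]
  have "cwalk E (cut K) hi (cut K, u') w (cut K, v')"
    using walk_trans[OF up(1)[OF u'(3)] walk_trans[OF w up(1)[OF v'(2)]]] by simp
  from lower_excursion[OF big hi this u'(1) v'(1)]
  obtain w' where w': "wle w' w" "cwalk E 0 (hi - 1) (cut K, u') w' (cut K, v')" by blast
  have "cwalk E 0 (hi - 1) (cut K, u) w' (cut K, v)"
    using walk_trans[OF up(2)[OF u'(2)] walk_trans[OF w'(2) up(2)[OF v'(3)]]] by simp
  then show ?thesis using w'(1) by blast
qed

text \<open>Excursions above cut \<open>K\<close> are replaced one by one. Since an excursion can be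
  replaced only after it has returned, the induction carries a lowered prefix ending at cut
  \<open>K\<close> together with a pending excursion that is still unchanged.\<close>

lemma lower_walk:
  assumes big: "(card S + 1)\<^sup>2 < 4 * (K + 1)" and hi: "cut (2 * K) < hi" "hi \<le> H"
    and w: "cwalk E 0 hi u w v" and u: "fst u \<le> cut K" "snd u \<in> A" and v: "fst v \<le> cut K"
  shows "\<exists>w'. wle w' w \<and> cwalk E 0 (hi - 1) u w' v"
proof -
  have K: "cut K < hi" using cut_mono[of K "2 * K"] hi by simp
  have "if fst v \<le> cut K then \<exists>w'. wle w' w \<and> cwalk E 0 (hi - 1) u w' v
    else \<exists>z w1 w2 w'. wle w' w1 \<and> cwalk E 0 (hi - 1) u w' (cut K, z) \<and>
        cwalk E (cut K) hi (cut K, z) w2 v \<and> w = wadd w1 w2"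
    using w
  proof (induction rule: walk_induct)
    case refl
    show ?case using u by (metis wle_refl walk_refl)
  next
    case (snoc w v w' z)
    have e: "(v, w', z) \<in> E" "fst v \<le> hi" "fst z \<le> hi" "fst z \<le> Suc (fst v)" "fst v \<le> Suc (fst z)"
      using snoc.hyps(2) adjacent[of "fst v" "snd v" w' "fst z" "snd z"] by auto
    show ?case
    proof (cases "fst v \<le> cut K")
      case v: True
      then obtain w1 where w1: "wle w1 w" "cwalk E 0 (hi - 1) u w1 v" using snoc.IH by auto
      show ?thesis
      proof (cases "fst z \<le> cut K")
        case True
        then have "(v, w', z) \<in> restr E 0 (hi - 1)" using e v K by auto
        with w1(2) have "cwalk E 0 (hi - 1) u (wadd w1 w') z" by (rule walk_snoc)
        moreover have "wle (wadd w1 w') (wadd w w')" by (rule wadd_mono[OF w1(1) wle_refl])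
        ultimately show ?thesis using True by (simp only: if_True) blast
      next
        case False
        then have veq: "v = (cut K, snd v)" using e v by (auto simp: prod_eq_iff)
        have "cwalk E (cut K) hi v w' z" using e v False K by (intro edge_walk) auto
        then have "cwalk E (cut K) hi (cut K, snd v) w' z" "cwalk E 0 (hi - 1) u w1 (cut K, snd v)"
          using veq w1(2) by metis+
        then show ?thesis using False w1(1) by (simp only: if_False) blast
      qed
    next
      case v: False
      then obtain y w1 w2 w'' where y: "wle w'' w1" "cwalk E 0 (hi - 1) u w'' (cut K, y)"
          "cwalk E (cut K) hi (cut K, y) w2 v" "w = wadd w1 w2"
        using snoc.IH by auto
      have "(v, w', z) \<in> restr E (cut K) hi" using e v by auto
      from walk_snoc[OF y(3) this] have y2: "cwalk E (cut K) hi (cut K, y) (wadd w2 w') z" .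
      show ?thesis
      proof (cases "fst z \<le> cut K")
        case True
        then have z: "z = (cut K, snd z)" using e v by (auto simp: prod_eq_iff)
        have "y \<in> A" using walk_A[OF y(2)] u by simp
        moreover have "cwalk E (cut K) hi (cut K, y) (wadd w2 w') (cut K, snd z)" using y2 z by simp
        ultimately obtain w3 where w3: "wle w3 (wadd w2 w')" "cwalk E 0 (hi - 1) (cut K, y) w3 (cut K, snd z)"
          using lower_excursion_A[OF big hi] by blast
        have "wle (wadd w'' w3) (wadd w w')" using wadd_mono[OF y(1) w3(1)] y(4) by (simp add: wadd_assoc)
        moreover have "cwalk E 0 (hi - 1) u (wadd w'' w3) z" using walk_trans[OF y(2) w3(2)] z by simp
        ultimately show ?thesis using True by (simp only: if_True) blast
      next
        case False
        then show ?thesis using y y2 by (metis wadd_assoc)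
      qed
    qed
  qed
  then show ?thesis using v by simp
qed

end

section \<open>Reflection of the columns\<close>

text \<open>Subtraction is truncated, so this is a reflection only of graphs whose columns are at
  most \<open>H\<close>.\<close>

definition flip :: "nat \<Rightarrow> 'c edge set \<Rightarrow> 'c edge set" where
  "flip H E = (\<lambda>(u, w, v). ((H - fst u, snd u), w, (H - fst v, snd v))) ` E"

lemma walk_flip:
  assumes "walk E u w v"
  shows "walk (flip H E) (H - fst u, snd u) w (H - fst v, snd v)"
  using assms
proof (induction rule: walk_induct)
  case (snoc w v w' z)
  have "((H - fst v, snd v), w', (H - fst z, snd z)) \<in> flip H E"
    unfolding flip_def using snoc.hyps(2) by force
  with snoc.IH show ?case by (rule walk_snoc)
qed simp

lemma flip_iff:
  assumes "\<And>u w v. (u, w, v) \<in> E \<Longrightarrow> fst u \<le> H \<and> fst v \<le> H" "i \<le> H" "j \<le> H"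
  shows "((i, x), w, (j, y)) \<in> flip H E \<longleftrightarrow> ((H - i, x), w, (H - j, y)) \<in> E"
proof
  assume "((i, x), w, (j, y)) \<in> flip H E"
  then obtain u v where uv: "(u, w, v) \<in> E" "i = H - fst u" "x = snd u" "j = H - fst v" "y = snd v"
    unfolding flip_def by auto
  then have "fst u = H - i" "fst v = H - j" using assms(1)[OF uv(1)] by auto
  then show "((H - i, x), w, (H - j, y)) \<in> E" using uv by (metis prod.collapse)
next
  assume *: "((H - i, x), w, (H - j, y)) \<in> E"
  show "((i, x), w, (j, y)) \<in> flip H E"
    unfolding flip_def by (rule image_eqI[OF _ *]) (use assms in simp)
qed

lemma flip_bound: "((i, x), w, (j, y)) \<in> flip H E \<Longrightarrow> i \<le> H \<and> j \<le> H"
  unfolding flip_def by auto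

lemma flip_flip:
  assumes "\<And>u w v. (u, w, v) \<in> E \<Longrightarrow> fst u \<le> H \<and> fst v \<le> H"
  shows "flip H (flip H E) = E"
proof -
  have "(case (case e of (u, w, v) \<Rightarrow> ((H - fst u, snd u), w, (H - fst v, snd v))) of
      (u, w, v) \<Rightarrow> ((H - fst u, snd u), w, (H - fst v, snd v))) = e" if "e \<in> E" for e
  proof -
    obtain i x w j y where "e = ((i, x), w, (j, y))" by (metis prod.collapse)
    then show ?thesis using assms[of "(i, x)" w "(j, y)"] that by simp
  qed
  then show ?thesis by (simp add: flip_def image_image)
qed

context strip
begin

lemma edge_bound: "(u, w, v) \<in> E \<Longrightarrow> fst u \<le> H \<and> fst v \<le> H"
  using adjacent[of "fst u" "snd u" w "fst v" "snd v"] by simp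

text \<open>Since \<open>Suc H\<close> is a multiple of \<open>C\<close>, cuts are mapped to cuts,
  with offset \<open>C - 1 - \<kappa>\<close> and in reverse order. Loops change direction, so
  \<open>pump\<close> is used with the two clocks exchanged.\<close>

lemma strip_flip:
  assumes "Suc H = M * C" "\<kappa> < C"
  shows "strip (flip H E) H C (C - 1 - \<kappa>) S A"
proof -
  have f_iff: "((i, x), w, (j, y)) \<in> flip H E \<longleftrightarrow> i \<le> H \<and> j \<le> H \<and> ((H - i, x), w, (H - j, y)) \<in> E"
    for i x w j y
    by (cases "i \<le> H \<and> j \<le> H") (use flip_iff[of E H i j x w y, OF edge_bound] flip_bound[of i x w j y H E] in auto)
  have level: "l < M" "H - (C - 1 - \<kappa> + l * C) = \<kappa> + (M - 1 - l) * C" if "C - 1 - \<kappa> + l * C \<le> H" for l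
  proof -
    show lM: "l < M"
    proof (rule ccontr)
      assume "\<not> l < M"
      then have "M * C \<le> l * C" by simp
      then show False using assms that by linarith
    qed
    then obtain d where d: "M = Suc (l + d)" using less_iff_Suc_add by auto
    have "Suc H = C + l * C + d * C" using assms(1) unfolding d by (simp add: algebra_simps)
    moreover have "M - 1 - l = d" using d by simp
    ultimately show "H - (C - 1 - \<kappa> + l * C) = \<kappa> + (M - 1 - l) * C"
      using assms(2) by simp
  qed
  show ?thesis
  proof
    show "0 < C" "finite S" "S \<subseteq> A" by (rule C_pos finite_S S_subset)+
  next
    fix i x w j y assume "((i, x), w, (j, y)) \<in> flip H E"
    then show "i \<le> H \<and> j \<le> H \<and> i \<le> Suc j \<and> j \<le> Suc i" "x = y \<or> x \<in> A \<and> y \<in> A"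
      using adjacent[of "H - i" x w "H - j" y] closed_A[of "H - i" x w "H - j" y] by (auto simp: f_iff)
  next
    fix i j x w y assume "i + C \<le> H" "j + C \<le> H"
    then have "H - i = H - (i + C) + C" "H - j = H - (j + C) + C"
      by auto
    then show "((i + C, x), w, (j + C, y)) \<in> flip H E \<longleftrightarrow> ((i, x), w, (j, y)) \<in> flip H E"
      using \<open>i + C \<le> H\<close> \<open>j + C \<le> H\<close> periodic[of "H - (i + C)" "H - (j + C)" x w y]
      by (simp add: f_iff)
  next
    fix z l assume "z \<in> A" and l: "C - 1 - \<kappa> + l * C \<le> H"
    have "\<kappa> + (M - 1 - l) * C \<le> H" using level(2)[OF l] by (metis diff_le_self)
    from at_cut[OF \<open>z \<in> A\<close> this]
    show "\<exists>z'\<in>S. z' = z \<or> ((C - 1 - \<kappa> + l * C, z), wzero, (C - 1 - \<kappa> + l * C, z')) \<in> flip H E \<and>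
        ((C - 1 - \<kappa> + l * C, z'), wzero, (C - 1 - \<kappa> + l * C, z)) \<in> flip H E"
      by (simp only: f_iff level(2)[OF l] l simp_thms)
  next
    fix x y g i w j w'
    assume a: "x \<in> S" "y \<in> S" "0 < g"
      "path (flip H E) (C - 1 - \<kappa> + i * C, x) w (C - 1 - \<kappa> + (i + g) * C, x)"
      "path (flip H E) (C - 1 - \<kappa> + (j + g) * C, y) w' (C - 1 - \<kappa> + j * C, y)"
    have ends: "fst u \<le> H \<and> fst v \<le> H" if "path (flip H E) u w v" for u w v
      using that by (induction rule: path.induct) (auto simp: f_iff split_paired_all)
    have le: "C - 1 - \<kappa> + (i + g) * C \<le> H" "C - 1 - \<kappa> + i * C \<le> H"
        "C - 1 - \<kappa> + (j + g) * C \<le> H" "C - 1 - \<kappa> + j * C \<le> H"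
      using ends[OF a(4)] ends[OF a(5)] by simp_all
    have unflip: "walk E (H - fst u, snd u) w (H - fst v, snd v)" if "path (flip H E) u w v" for u w v
      using walk_flip[OF path_walk[OF that], of H] flip_flip[OF edge_bound] by simp
    note lt = level(1)[OF le(1)] level(1)[OF le(3)]
    have i: "M - 1 - i = M - 1 - (i + g) + g" "M - 1 - j = M - 1 - (j + g) + g" using lt by auto
    have ne: "\<kappa> + (M - 1 - i) * C \<noteq> \<kappa> + (M - 1 - (i + g)) * C" "\<kappa> + (M - 1 - j) * C \<noteq> \<kappa> + (M - 1 - (j + g)) * C"
      unfolding i using a(3) C_pos by simp_all
    have "walk E (\<kappa> + (M - 1 - i) * C, x) w (\<kappa> + (M - 1 - (i + g)) * C, x)"
      using unflip[OF a(4)] by (simp only: level(2)[OF le(1)] level(2)[OF le(2)] fst_conv snd_conv)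
    then have "path E (\<kappa> + (M - 1 - i) * C, x) w (\<kappa> + (M - 1 - (i + g)) * C, x)"
      using ne(1) by (simp only: walk_path prod.inject simp_thms not_False_eq_True)
    moreover have "walk E (\<kappa> + (M - 1 - (j + g)) * C, y) w' (\<kappa> + (M - 1 - j) * C, y)"
      using unflip[OF a(5)] by (simp only: level(2)[OF le(3)] level(2)[OF le(4)] fst_conv snd_conv)
    then have "path E (\<kappa> + (M - 1 - (j + g)) * C, y) w' (\<kappa> + (M - 1 - j) * C, y)"
      using ne(2)[symmetric] by (simp only: walk_path prod.inject simp_thms not_False_eq_True)
    ultimately show "0 \<le> snd w + snd w'"
      using pump[OF a(2,1,3), of "M - 1 - (j + g)" w' "M - 1 - (i + g)" w, folded i]
      by (simp only: add.commute)
  qed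
qed

lemma lower_walk_to:
  assumes big: "(card S + 1)\<^sup>2 < 4 * (K + 1)" and h: "cut (2 * K) \<le> h" "h \<le> hi" and hi: "hi \<le> H"
    and u: "fst u \<le> cut K" "snd u \<in> A" and v: "fst v \<le> cut K"
  shows "cwalk E 0 hi u w v \<Longrightarrow> \<exists>w'. wle w' w \<and> cwalk E 0 h u w' v"
  using h(2) hi
proof (induction hi arbitrary: w rule: dec_induct)
  case base
  then show ?case using wle_refl by blast
next
  case (step k)
  have "cut (2 * K) < Suc k" using h(1) step by simp
  from lower_walk[OF big this step.prems(2,1) u v]
  obtain w' where w': "wle w' w" "cwalk E 0 k u w' v" by auto
  from step.IH[OF w'(2)] step.prems(2) obtain w'' where "wle w'' w'" "cwalk E 0 h u w'' v" by auto
  then show ?case using wle_trans[OF _ w'(1)] by blast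
qed

lemma walk_from_bottom:
  assumes "(card S + 1)\<^sup>2 < 4 * (K + 1)" "cut (2 * K) \<le> h" "h \<le> H" "x \<in> A"
    and "walk E (0, x) w (0, y)"
  shows "\<exists>w'. wle w' w \<and> cwalk E 0 h (0, x) w' (0, y)"
proof -
  have "E \<subseteq> restr E 0 H"
  proof (rule subsetI)
    fix e assume e: "e \<in> E"
    obtain u w v where "e = (u, w, v)" by (metis prod.collapse)
    then show "e \<in> restr E 0 H" using e edge_bound[of u w v] by simp
  qed
  from lower_walk_to[OF assms(1,2,3) order.refl _ _ _ walk_mono[OF assms(5) this]] assms(4)
  show ?thesis by simp
qed

text \<open>The condition \<open>2 * K < m\<close> places the reflected cut \<open>2 * K\<close>
  inside the last \<open>m\<close> periods.\<close>

lemma walk_from_top: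
  assumes H: "Suc H = M * C" "\<kappa> < C" and big: "(card S + 1)\<^sup>2 < 4 * (K + 1)"
    and m: "2 * K < m" "m \<le> M" and x: "x \<in> A" and w: "walk E (H, x) w (H, y)"
  shows "\<exists>w'. wle w' w \<and> cwalk E (H - (m * C - 1)) H (H, x) w' (H, y)"
proof -
  interpret F: strip "flip H E" H C "C - 1 - \<kappa>" S A
    by (rule strip_flip[OF H])
  have "F.cut (2 * K) < Suc (2 * K) * C" using H(2) unfolding F.cut_def by simp
  moreover have "Suc (2 * K) * C \<le> m * C" using m(1) by (intro mult_le_mono1) simp
  ultimately have cut: "F.cut (2 * K) \<le> m * C - 1" by linarith
  have "m * C \<le> M * C" using m(2) by (rule mult_le_mono1)
  then have h: "m * C - 1 \<le> H" using H(1) by linarith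
  have "walk (flip H E) (0, x) w (0, y)" using walk_flip[OF w, of H] by simp
  from F.walk_from_bottom[OF big cut h x this]
  obtain w' where w': "wle w' w" "cwalk (flip H E) 0 (m * C - 1) (0, x) w' (0, y)" by blast
  have "flip H (restr (flip H E) 0 (m * C - 1)) \<subseteq> restr E (H - (m * C - 1)) H"
  proof (rule subsetI)
    fix e assume "e \<in> flip H (restr (flip H E) 0 (m * C - 1))"
    then obtain i x w j y where e: "e = ((H - i, x), w, (H - j, y))"
      and f: "((i, x), w, (j, y)) \<in> flip H E" "i \<le> m * C - 1" "j \<le> m * C - 1"
      unfolding flip_def[of H "restr _ _ _"] by (auto simp: split_paired_all)
    have "((H - i, x), w, (H - j, y)) \<in> E"
      using f(1) flip_bound[OF f(1)] by (subst (asm) flip_iff[OF edge_bound]) simp_all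
    then show "e \<in> restr E (H - (m * C - 1)) H" using diff_le_mono2[OF f(2), of H] diff_le_mono2[OF f(3), of H] by (simp add: e)
  qed
  from walk_mono[OF walk_flip[OF w'(2), of H] this] show ?thesis using w'(1) by (intro exI[of _ w']) simp
qed

end

section \<open>Difference constraints and the unrolled graph\<close>

definition wsat :: "real \<Rightarrow> weight \<Rightarrow> bool" where
  "wsat r w \<longleftrightarrow> (if fst w then r < of_int (snd w) else r \<le> of_int (snd w))"

lemma wsat_wadd: "wsat r w \<Longrightarrow> wsat r' w' \<Longrightarrow> wsat (r + r') (wadd w w')"
  by (auto simp: wsat_def split: if_splits)

lemma wsat_mono: "wsat r w \<Longrightarrow> wle w w' \<Longrightarrow> wsat r w'"
  by (auto simp: wsat_def wle_iff split: if_splits)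

lemma wsat_0: "wsat 0 w \<longleftrightarrow> \<not> wneg w"
  by (auto simp: wsat_def wneg_iff)

lemma wsat_wzero: "wsat r wzero \<longleftrightarrow> r \<le> 0"
  by (simp add: wsat_def)

text \<open>A feasible potential: a solution of the system of difference constraints that the edges
  stand for.\<close>

definition sat :: "('c vertex \<Rightarrow> real) \<Rightarrow> 'c edge set \<Rightarrow> bool" where
  "sat f E \<longleftrightarrow> (\<forall>u w v. (u, w, v) \<in> E \<longrightarrow> wsat (f v - f u) w)"

lemma sat_path:
  assumes "sat f E"
  shows "path E u w v \<Longrightarrow> wsat (f v - f u) w"
proof (induction rule: path.induct)
  case (snoc u w v w' z)
  then have "wsat (f v - f u + (f z - f v)) (wadd w w')"
    using assms unfolding sat_def by (intro wsat_wadd) blast+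
  then show ?case by simp
qed (use assms in \<open>auto simp: sat_def\<close>)

lemma sat_no_neg: "sat f E \<Longrightarrow> path E u w u \<Longrightarrow> \<not> wneg w"
  using sat_path[of f E u w u] by (simp add: wsat_0)

lemma sat_subset: "sat f E \<Longrightarrow> E' \<subseteq> E \<Longrightarrow> sat f E'"
  by (auto simp: sat_def)

text \<open>Transition \<open>t i\<close> occupies columns \<open>3 * i\<close> to
  \<open>3 * i + 2\<close>. In one infinite graph the finite compositions become restrictions, and
  translation by a period is an equivalence without side conditions on an upper end.\<close>

definition inf_graph :: "'c \<Rightarrow> (nat \<Rightarrow> 'c transition) \<Rightarrow> 'c edge set" where
  "inf_graph x0 t = (\<Union>i. shift (3 * i) (snd (trans_graph x0 (t i))))
     \<union> (\<Union>i. {((3 * i + 2, x), wzero, (3 * i + 3, x)) | x. True} \<union> {((3 * i + 3, x), wzero, (3 * i + 2, x)) | x. True})"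

lemma shift_iff: "((a, x), w, (b, y)) \<in> shift k E \<longleftrightarrow> k \<le> a \<and> k \<le> b \<and> ((a - k, x), w, (b - k, y)) \<in> E"
proof
  assume "k \<le> a \<and> k \<le> b \<and> ((a - k, x), w, (b - k, y)) \<in> E"
  then show "((a, x), w, (b, y)) \<in> shift k E"
    unfolding shift_def by (intro CollectI exI[of _ "a - k"] exI[of _ x] exI[of _ w] exI[of _ "b - k"] exI[of _ y]) auto
qed (auto simp: shift_def)

lemma trans_graph_fst [simp]: "fst (trans_graph x0 t) = 3"
  by (cases t) (simp add: trans_graph_def)

text \<open>The only clock without an edge from column 1 back to column 0 is \<open>x0\<close>: this
  asymmetry encodes that delays are nonnegative, and it lets the reference clock move right, but not
  left, for free.\<close>

lemma trans_edge_iff: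
  "((a, x), w, (b, y)) \<in> snd (trans_graph x0 (g, R)) \<longleftrightarrow>
     a = 0 \<and> b = 1 \<and> y = x \<and> w = wzero
   \<or> a = 1 \<and> b = 0 \<and> y = x \<and> x \<noteq> x0 \<and> w = wzero
   \<or> a = 1 \<and> b = 1 \<and> x = x0 \<and> (\<exists>r c. (y, r, c) \<in> set g \<and> is_upper r \<and> w = (r = Lt, int c))
   \<or> a = 1 \<and> b = 1 \<and> y = x0 \<and> (\<exists>r c. (x, r, c) \<in> set g \<and> is_lower r \<and> w = (r = Gt, - int c))
   \<or> a = 1 \<and> b = 2 \<and> y = x \<and> w = wzero
   \<or> a = 2 \<and> b = 1 \<and> y = x \<and> x \<notin> R \<and> w = wzero
   \<or> a = 2 \<and> b = 2 \<and> (x = x0 \<and> y \<in> R \<or> y = x0 \<and> x \<in> R) \<and> w = wzero"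
  (is "?L \<longleftrightarrow> ?R")
proof
  assume ?L
  then show ?R unfolding trans_graph_def split_conv snd_conv Un_iff by (elim disjE) auto
next
  assume ?R
  then show ?L unfolding trans_graph_def split_conv snd_conv Un_iff
    by (elim disjE) (cases "x = x0"; cases "x \<in> R"; auto)+
qed

lemma trans_edge_bound: "((a, x), w, (b, y)) \<in> snd (trans_graph x0 t) \<Longrightarrow> a \<le> 2 \<and> b \<le> 2"
  by (cases t) (auto simp: trans_edge_iff)

lemma inf_edge_iff:
  "((a, x), w, (b, y)) \<in> inf_graph x0 t \<longleftrightarrow>
     (\<exists>i. 3 * i \<le> a \<and> 3 * i \<le> b \<and> ((a - 3 * i, x), w, (b - 3 * i, y)) \<in> snd (trans_graph x0 (t i)))
   \<or> (\<exists>i. w = wzero \<and> y = x \<and> (a = 3 * i + 2 \<and> b = 3 * i + 3 \<or> a = 3 * i + 3 \<and> b = 3 * i + 2))"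
  unfolding inf_graph_def by (auto simp: shift_iff)

lemma inf_edge_adjacent:
  assumes "((a, x), w, (b, y)) \<in> inf_graph x0 t"
  shows "a \<le> Suc b \<and> b \<le> Suc a"
  using assms unfolding inf_edge_iff
proof (elim disjE exE conjE)
  fix i assume i: "3 * i \<le> a" "3 * i \<le> b" "((a - 3 * i, x), w, (b - 3 * i, y)) \<in> snd (trans_graph x0 (t i))"
  obtain g R where "t i = (g, R)" by (cases "t i")
  with i(3) have "a - 3 * i \<le> Suc (b - 3 * i) \<and> b - 3 * i \<le> Suc (a - 3 * i)"
    by (auto simp: trans_edge_iff)
  then show ?thesis using i by auto
qed auto

lemma inf_graph_right: "((a, x), wzero, (Suc a, x)) \<in> inf_graph x0 t"
proof -
  define i where "i = a div 3"
  obtain g R where t: "t i = (g, R)" by (cases "t i")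
  have "a = 3 * i + a mod 3" by (simp add: i_def)
  moreover have "a mod 3 = 0 \<or> a mod 3 = 1 \<or> a mod 3 = 2" by linarith
  ultimately consider "a = 3 * i" | "a = 3 * i + 1" | "a = 3 * i + 2" by linarith
  then show ?thesis
  proof cases
    case 1
    then show ?thesis unfolding inf_edge_iff
      by (intro disjI1 exI[of _ i]) (simp add: t trans_edge_iff)
  next
    case 2
    then show ?thesis unfolding inf_edge_iff
      by (intro disjI1 exI[of _ i]) (simp add: t trans_edge_iff)
  next
    case 3
    then show ?thesis unfolding inf_edge_iff by (intro disjI2 exI[of _ i]) simp
  qed
qed

lemma inf_graph_shift:
  assumes "\<And>i. t (i + N) = t i"
  shows "((a + 3 * N, x), w, (b + 3 * N, y)) \<in> inf_graph x0 t \<longleftrightarrow> ((a, x), w, (b, y)) \<in> inf_graph x0 t"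
proof
  assume "((a, x), w, (b, y)) \<in> inf_graph x0 t"
  then show "((a + 3 * N, x), w, (b + 3 * N, y)) \<in> inf_graph x0 t"
    unfolding inf_edge_iff
  proof (elim disjE exE)
    fix i assume "3 * i \<le> a \<and> 3 * i \<le> b \<and> ((a - 3 * i, x), w, (b - 3 * i, y)) \<in> snd (trans_graph x0 (t i))"
    then show "(\<exists>i. 3 * i \<le> a + 3 * N \<and> 3 * i \<le> b + 3 * N \<and>
        ((a + 3 * N - 3 * i, x), w, b + 3 * N - 3 * i, y) \<in> snd (trans_graph x0 (t i))) \<or>
      (\<exists>i. w = wzero \<and> y = x \<and> (a + 3 * N = 3 * i + 2 \<and> b + 3 * N = 3 * i + 3 \<or> a + 3 * N = 3 * i + 3 \<and> b + 3 * N = 3 * i + 2))"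
      by (intro disjI1 exI[of _ "i + N"]) (auto simp: assms)
  next
    fix i assume "w = wzero \<and> y = x \<and> (a = 3 * i + 2 \<and> b = 3 * i + 3 \<or> a = 3 * i + 3 \<and> b = 3 * i + 2)"
    then show "(\<exists>i. 3 * i \<le> a + 3 * N \<and> 3 * i \<le> b + 3 * N \<and>
        ((a + 3 * N - 3 * i, x), w, b + 3 * N - 3 * i, y) \<in> snd (trans_graph x0 (t i))) \<or>
      (\<exists>i. w = wzero \<and> y = x \<and> (a + 3 * N = 3 * i + 2 \<and> b + 3 * N = 3 * i + 3 \<or> a + 3 * N = 3 * i + 3 \<and> b + 3 * N = 3 * i + 2))"
      by (intro disjI2 exI[of _ "i + N"]) auto
  qed
next
  assume "((a + 3 * N, x), w, (b + 3 * N, y)) \<in> inf_graph x0 t"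
  then show "((a, x), w, (b, y)) \<in> inf_graph x0 t"
    unfolding inf_edge_iff[of "a + 3 * N"]
  proof (elim disjE exE conjE)
    fix i assume i: "3 * i \<le> a + 3 * N" "3 * i \<le> b + 3 * N"
      and e: "((a + 3 * N - 3 * i, x), w, b + 3 * N - 3 * i, y) \<in> snd (trans_graph x0 (t i))"
    have "N \<le> i" using trans_edge_bound[OF e] by linarith
    then obtain j where j: "i = j + N" by (metis add.commute le_Suc_ex)
    show ?thesis
      unfolding inf_edge_iff using i e by (intro disjI1 exI[of _ j]) (simp add: j assms)
  next
    fix i assume w: "w = wzero" "y = x" and a: "a + 3 * N = 3 * i + 2" "b + 3 * N = 3 * i + 3"
    then have "N \<le> i" by linarith
    then obtain j where j: "i = j + N" by (metis add.commute le_Suc_ex)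
    show ?thesis unfolding inf_edge_iff using w a by (intro disjI2 exI[of _ j]) (simp add: j)
  next
    fix i assume w: "w = wzero" "y = x" and a: "a + 3 * N = 3 * i + 3" "b + 3 * N = 3 * i + 2"
    then have "N \<le> i" by linarith
    then obtain j where j: "i = j + N" by (metis add.commute le_Suc_ex)
    show ?thesis unfolding inf_edge_iff using w a by (intro disjI2 exI[of _ j]) (simp add: j)
  qed
qed

lemma edge_set_eqI:
  "(\<And>a x w b y. ((a, x), w, (b, y)) \<in> E \<longleftrightarrow> ((a, x), w, (b, y)) \<in> E') \<Longrightarrow> E = (E' :: 'c edge set)"
  by (auto simp: set_eq_iff split_paired_all)

lemma inf_graph_Suc:
  fixes x0 :: 'c
  shows "inf_graph x0 t = snd (trans_graph x0 (t 0)) \<union> shift 3 (inf_graph x0 (\<lambda>i. t (Suc i)))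
     \<union> {((2, x), wzero, (3, x)) | x. True} \<union> {((3, x), wzero, (2, x)) | x. True}"
proof (rule edge_set_eqI)
  fix a b :: nat and x y :: 'c and w :: weight
  show "((a, x), w, (b, y)) \<in> inf_graph x0 t \<longleftrightarrow> ((a, x), w, (b, y)) \<in>
      snd (trans_graph x0 (t 0)) \<union> shift 3 (inf_graph x0 (\<lambda>i. t (Suc i)))
     \<union> {((2, x), wzero, (3, x)) | x. True} \<union> {((3, x), wzero, (2, x)) | x. True}"
    (is "?L \<longleftrightarrow> ?R")
  proof
    assume ?L
    then show ?R unfolding inf_edge_iff[of a]
    proof (elim disjE exE conjE)
      fix i assume i: "3 * i \<le> a" "3 * i \<le> b" "((a - 3 * i, x), w, (b - 3 * i, y)) \<in> snd (trans_graph x0 (t i))"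
      show ?R
      proof (cases i)
        case 0
        then show ?thesis using i by simp
      next
        case (Suc j)
        then have "((a - 3, x), w, (b - 3, y)) \<in> inf_graph x0 (\<lambda>i. t (Suc i))"
          unfolding inf_edge_iff using i by (intro disjI1 exI[of _ j]) (auto simp: diff_diff_add)
        then show ?thesis using i Suc by (simp add: shift_iff)
      qed
    next
      fix i assume i: "w = wzero" "y = x" "a = 3 * i + 2" "b = 3 * i + 3"
      show ?R
      proof (cases i)
        case (Suc j)
        then have "((a - 3, x), w, (b - 3, y)) \<in> inf_graph x0 (\<lambda>i. t (Suc i))"
          unfolding inf_edge_iff using i by (intro disjI2 exI[of _ j]) simp
        then show ?thesis using i Suc by (simp add: shift_iff)
      qed (use i in simp)
    next
      fix i assume i: "w = wzero" "y = x" "a = 3 * i + 3" "b = 3 * i + 2"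
      show ?R
      proof (cases i)
        case (Suc j)
        then have "((a - 3, x), w, (b - 3, y)) \<in> inf_graph x0 (\<lambda>i. t (Suc i))"
          unfolding inf_edge_iff using i by (intro disjI2 exI[of _ j]) simp
        then show ?thesis using i Suc by (simp add: shift_iff)
      qed (use i in simp)
    qed
  next
    assume ?R
    then consider "((a, x), w, (b, y)) \<in> snd (trans_graph x0 (t 0))"
      | "3 \<le> a" "3 \<le> b" "((a - 3, x), w, (b - 3, y)) \<in> inf_graph x0 (\<lambda>i. t (Suc i))"
      | "w = wzero" "y = x" "a = 2 \<and> b = 3 \<or> a = 3 \<and> b = 2"
      by (auto simp: shift_iff)
    then show ?L
    proof cases
      case 1
      then show ?thesis unfolding inf_edge_iff by (intro disjI1 exI[of _ 0]) simp
    next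
      case 2
      show ?thesis using 2(3) unfolding inf_edge_iff[of "a - 3"]
      proof (elim disjE exE conjE)
        fix i assume "3 * i \<le> a - 3" "3 * i \<le> b - 3"
          "((a - 3 - 3 * i, x), w, (b - 3 - 3 * i, y)) \<in> snd (trans_graph x0 (t (Suc i)))"
        then show ?thesis unfolding inf_edge_iff using 2(1,2)
          by (intro disjI1 exI[of _ "Suc i"]) (auto simp: diff_diff_add)
      next
        fix i assume "w = wzero" "y = x" "a - 3 = 3 * i + 2" "b - 3 = 3 * i + 3"
        then show ?thesis unfolding inf_edge_iff using 2(1,2) by (intro disjI2 exI[of _ "Suc i"]) auto
      next
        fix i assume "w = wzero" "y = x" "a - 3 = 3 * i + 3" "b - 3 = 3 * i + 2"
        then show ?thesis unfolding inf_edge_iff using 2(1,2) by (intro disjI2 exI[of _ "Suc i"]) auto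
      qed
    next
      case 3
      then show ?thesis unfolding inf_edge_iff by (intro disjI2 exI[of _ 0]) auto
    qed
  qed
qed

lemma seq_graph_inf:
  fixes x0 :: 'c
  shows "ts \<noteq> [] \<Longrightarrow> (\<And>i. i < length ts \<Longrightarrow> t i = ts ! i) \<Longrightarrow>
    seq_graph x0 ts = (3 * length ts, restr (inf_graph x0 t) 0 (3 * length ts - 1))"
proof (induction x0 ts arbitrary: t rule: seq_graph.induct)
  case (2 x0 s)
  have t0: "t 0 = s" using 2(2)[of 0] by simp
  have "snd (trans_graph x0 s) = restr (inf_graph x0 t) 0 2"
  proof (rule edge_set_eqI)
    fix a b :: nat and x y :: 'c and w :: weight
    show "((a, x), w, b, y) \<in> snd (trans_graph x0 s) \<longleftrightarrow> ((a, x), w, b, y) \<in> restr (inf_graph x0 t) 0 2"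
      unfolding inf_graph_Suc[of x0 t] t0 using trans_edge_bound[of a x w b y x0 s] by (auto simp: shift_iff)
  qed
  then show ?case by (simp add: prod_eq_iff)
next
  case (3 x0 s s' ts)
  let ?t = "\<lambda>i. t (Suc i)"
  let ?n = "length (s' # ts)"
  have "?t i = (s' # ts) ! i" if "i < ?n" for i using "3.prems"(2)[of "Suc i"] that by simp
  then have IH: "seq_graph x0 (s' # ts) = (3 * ?n, restr (inf_graph x0 ?t) 0 (3 * ?n - 1))"
    by (intro "3.IH") simp_all
  have t0: "t 0 = s" using "3.prems"(2)[of 0] by simp
  have "compose (3, E) (3 * ?n, restr (inf_graph x0 ?t) 0 (3 * ?n - 1)) =
      (3 * length (s # s' # ts), restr (inf_graph x0 t) 0 (3 * length (s # s' # ts) - 1))"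
    if E: "E = snd (trans_graph x0 s)" for E
  proof -
    have "E \<union> shift 3 (restr (inf_graph x0 ?t) 0 (3 * ?n - 1))
       \<union> {((2, x), wzero, (3, x)) | x. True} \<union> {((3, x), wzero, (2, x)) | x. True}
       = restr (inf_graph x0 t) 0 (3 * length (s # s' # ts) - 1)"
    proof (rule edge_set_eqI)
      fix a b :: nat and x y :: 'c and w :: weight
      show "((a, x), w, b, y) \<in> E \<union> shift 3 (restr (inf_graph x0 ?t) 0 (3 * ?n - 1))
       \<union> {((2, x), wzero, (3, x)) | x. True} \<union> {((3, x), wzero, (2, x)) | x. True} \<longleftrightarrow>
       ((a, x), w, b, y) \<in> restr (inf_graph x0 t) 0 (3 * length (s # s' # ts) - 1)"
        unfolding inf_graph_Suc[of x0 t] t0 E[symmetric]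
        using trans_edge_bound[of a x w b y x0 s, folded E] by (auto simp: shift_iff)
    qed
    then show ?thesis by simp
  qed
  from this[OF refl] show ?case
    unfolding seq_graph.simps(3) IH by (metis prod.collapse trans_graph_fst)
qed simp

section \<open>Canonical forms\<close>

declare split_paired_All [simp del] split_paired_Ex [simp del]

definition neg_free :: "'c edge set \<Rightarrow> bool" where
  "neg_free E \<longleftrightarrow> (\<forall>u w. path E u w u \<longrightarrow> \<not> wneg w)"

lemma has_neg_cycle_iff: "has_neg_cycle (k, E) \<longleftrightarrow> \<not> neg_free E"
  by (auto simp: has_neg_cycle_def neg_free_def)

lemma neg_free_subset: "neg_free E \<Longrightarrow> E' \<subseteq> E \<Longrightarrow> neg_free E'"
  unfolding neg_free_def using path_mono by blast

lemma neg_free_walk: "neg_free E \<Longrightarrow> walk E u w u \<Longrightarrow> \<not> wneg w"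
  by (auto simp: walk_def neg_free_def wneg_iff)

lemma walk_edge_path: "walk E u w v \<Longrightarrow> (v, w', z) \<in> E \<Longrightarrow> path E u (wadd w w') z"
  by (auto simp: walk_def intro: path.intros)

text \<open>The walk is cut at its last visit to \<open>u\<close>; what precedes is a closed walk
  and not negative. Comparing integer parts suffices, as only a lower bound on weights is
  sought.\<close>

lemma walk_from_source:
  assumes "neg_free E" "walk E u w v"
  shows "v = u \<and> 0 \<le> snd w \<or> v \<noteq> u \<and>
    (\<exists>z w1 w2. (u, w1, z) \<in> E \<and> z \<noteq> u \<and> walk {(a, c, b) \<in> E. a \<noteq> u \<and> b \<noteq> u} z w2 v \<and> snd w1 + snd w2 \<le> snd w)"
  using assms(2)
proof (induction rule: walk_induct)
  case (snoc w v w' y)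
  show ?case
  proof (cases "y = u")
    case True
    have "\<not> wneg (wadd w w')"
      using walk_edge_path[OF snoc.hyps] assms(1) True unfolding neg_free_def by blast
    then have "0 \<le> snd (wadd w w')" by (simp add: wneg_iff)
    then show ?thesis using True by blast
  next
    case y: False
    show ?thesis
    proof (cases "v = u")
      case True
      then have "(u, w', y) \<in> E" "snd w' + snd wzero \<le> snd (wadd w w')"
        using snoc.hyps(2) snoc.IH by auto
      then show ?thesis using y walk_refl by blast
    next
      case False
      then obtain z w1 w2 where z: "(u, w1, z) \<in> E" "z \<noteq> u"
          "walk {(a, c, b) \<in> E. a \<noteq> u \<and> b \<noteq> u} z w2 v" "snd w1 + snd w2 \<le> snd w"
        using snoc.IH by auto
      have "(v, w', y) \<in> {(a, c, b) \<in> E. a \<noteq> u \<and> b \<noteq> u}" using snoc.hyps(2) False y by simp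
      from walk_snoc[OF z(3) this] have "walk {(a, c, b) \<in> E. a \<noteq> u \<and> b \<noteq> u} z (wadd w2 w') y" .
      moreover have "snd w1 + snd (wadd w2 w') \<le> snd (wadd w w')" using z(4) by simp
      ultimately show ?thesis using y z(1,2) by blast
    qed
  qed
qed simp

text \<open>Deleting the start vertex and paying \<open>B\<close> for the edge that leaves it
  replaces a reduction to simple paths. The bound guarantees that minimal weights exist although
  walks are arbitrarily long.\<close>

lemma neg_free_bound:
  assumes "finite V" "0 \<le> B"
  shows "neg_free E \<Longrightarrow> (\<And>a w b. (a, w, b) \<in> E \<Longrightarrow> a \<in> V \<and> b \<in> V \<and> - B \<le> snd w) \<Longrightarrow>
    walk E u w v \<Longrightarrow> - (B * int (card V)) \<le> snd w"
  using assms(1)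
proof (induction "card V" arbitrary: V E u w v)
  case 0
  have "V = {}" using 0(1,5) by simp
  then have no_edge: "(a, c, b) \<notin> E" for a c b using 0(3)[of a c b] by blast
  have "\<not> path E u w v"
  proof
    assume "path E u w v"
    then show False by (cases rule: path.cases) (use no_edge in blast)+
  qed
  then have "w = wzero" using 0(4) by (simp add: walk_def)
  then show ?case using 0(1) by simp
next
  case (Suc n)
  show ?case
    using walk_from_source[OF Suc.prems(1,3)]
  proof (elim disjE conjE exE)
    assume "0 \<le> snd w"
    moreover have "0 \<le> B * int (card V)" using assms(2) by simp
    ultimately show ?thesis by linarith
  next
    fix z w1 w2 assume z: "(u, w1, z) \<in> E" "z \<noteq> u" "snd w1 + snd w2 \<le> snd w"
      and walk: "walk {(a, c, b) \<in> E. a \<noteq> u \<and> b \<noteq> u} z w2 v"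
    let ?E = "{(a, c, b) \<in> E. a \<noteq> u \<and> b \<noteq> u}"
    have u: "u \<in> V" "- B \<le> snd w1" using Suc.prems(2)[OF z(1)] by auto
    have "- (B * int (card (V - {u}))) \<le> snd w2"
    proof (rule Suc.hyps(1)[OF _ _ _ walk])
      show "n = card (V - {u})" using Suc.hyps(2) card.remove[OF Suc.prems(4) u(1)] by simp
      show "neg_free ?E" by (rule neg_free_subset[OF Suc.prems(1)]) auto
      show "a \<in> V - {u} \<and> b \<in> V - {u} \<and> - B \<le> snd w" if "(a, w, b) \<in> ?E" for a w b
        using Suc.prems(2)[of a w b] that by blast
      show "finite (V - {u})" using Suc.prems(4) by simp
    qed
    moreover have "card V = Suc (card (V - {u}))"
      using card.remove[OF Suc.prems(4) u(1)] by simp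
    then have "B * int (card V) = B * int (card (V - {u})) + B" by (simp add: algebra_simps)
    ultimately show ?thesis using z(3) u(2) by linarith
  qed
qed

definition is_min_weight :: "'c edge set \<Rightarrow> 'c vertex \<Rightarrow> 'c vertex \<Rightarrow> weight \<Rightarrow> bool" where
  "is_min_weight E u v w \<longleftrightarrow> path E u w v \<and> (\<forall>w'. path E u w' v \<longrightarrow> wle w w')"

lemma min_weight_alt: "min_weight E u v = (SOME w. is_min_weight E u v w)"
  by (simp add: min_weight_def is_min_weight_def)

text \<open>The integer part is minimised first; among paths attaining it a strict one is
  preferred.\<close>

lemma ex_min_weight:
  assumes "path E u w v" "\<And>w'. path E u w' v \<Longrightarrow> L \<le> snd w'"
  shows "is_min_weight E u v (min_weight E u v)"
proof -
  define d where "d = (LEAST n. \<exists>w. path E u w v \<and> n = nat (snd w - L))"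
  have "\<exists>n. \<exists>w. path E u w v \<and> n = nat (snd w - L)" using assms(1) by blast
  then have "\<exists>w. path E u w v \<and> d = nat (snd w - L)" unfolding d_def by (rule LeastI_ex)
  then obtain w1 where w1: "path E u w1 v" "d = nat (snd w1 - L)" by blast
  have least: "snd w1 \<le> snd w'" if "path E u w' v" for w'
  proof -
    have "d \<le> nat (snd w' - L)" unfolding d_def by (rule Least_le) (use that in blast)
    then show ?thesis using w1 assms(2)[OF that] assms(2)[OF w1(1)] by linarith
  qed
  have "\<exists>w. is_min_weight E u v w"
  proof (cases "\<exists>w'. path E u w' v \<and> snd w' = snd w1 \<and> fst w'")
    case True
    then obtain w' where "path E u w' v" "snd w' = snd w1" "fst w'" by blast
    then have "is_min_weight E u v w'"
      unfolding is_min_weight_def wle_iff using least by (metis order.order_iff_strict)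
    then show ?thesis ..
  next
    case False
    then have "is_min_weight E u v w1"
      unfolding is_min_weight_def wle_iff using least w1 by (metis order.order_iff_strict)
    then show ?thesis ..
  qed
  then show ?thesis unfolding min_weight_alt by (rule someI_ex)
qed

text \<open>Mutual domination makes the two predicates \<open>is_min_weight\<close> equal, hence
  also the choices by \<open>SOME\<close>, whether or not a minimum exists.\<close>

lemma min_weight_cong:
  fixes E E' :: "'c edge set"
  assumes "\<And>w. path E u w v \<Longrightarrow> \<exists>w'. wle w' w \<and> path E' u' w' v'"
    and "\<And>w. path E' u' w v' \<Longrightarrow> \<exists>w'. wle w' w \<and> path E u w' v"
  shows "min_weight E u v = min_weight E' u' v'" "(\<exists>w. path E u w v) \<longleftrightarrow> (\<exists>w. path E' u' w v')"
proof -
  have "is_min_weight F' a' b' w"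
    if 1: "\<And>w. path F a w b \<Longrightarrow> \<exists>w'. wle w' w \<and> path F' a' w' b'"
      and 2: "\<And>w. path F' a' w b' \<Longrightarrow> \<exists>w'. wle w' w \<and> path F a w' b"
      and w: "is_min_weight F a b w"
    for F F' :: "'c edge set" and a b a' b' w
  proof -
    have le: "wle w w'" if p: "path F' a' w' b'" for w'
    proof -
      obtain w2 where "wle w2 w'" "path F a w2 b" using 2[OF p] by blast
      then show ?thesis using w wle_trans[of w w2 w'] by (simp add: is_min_weight_def)
    qed
    have "path F a w b" using w by (simp add: is_min_weight_def)
    then obtain w' where w': "wle w' w" "path F' a' w' b'" using 1 by blast
    then have "w' = w" using le[OF w'(2)] by (intro wle_antisym)
    then show ?thesis using w' le by (simp add: is_min_weight_def)
  qed
  from this[OF assms] this[OF assms(2,1)] have "is_min_weight E u v = is_min_weight E' u' v'"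
    by (intro ext iffI) blast+
  then show "min_weight E u v = min_weight E' u' v'" by (simp add: min_weight_alt)
  show "(\<exists>w. path E u w v) \<longleftrightarrow> (\<exists>w. path E' u' w v')" using assms by blast
qed

definition end_col :: "nat \<Rightarrow> nat \<Rightarrow> nat" where
  "end_col k a = (if a = 0 then 0 else k - 1)"

lemma close_edge_iff:
  assumes "1 < k"
  shows "((a, x), w, (b, y)) \<in> snd (close (k, E)) \<longleftrightarrow> a \<le> 1 \<and> b \<le> 1 \<and> (a, x) \<noteq> (b, y) \<and>
    (\<exists>w'. path E (end_col k a, x) w' (end_col k b, y)) \<and> w = min_weight E (end_col k a, x) (end_col k b, y)"
    (is "?L \<longleftrightarrow> ?R")
proof
  assume ?L
  then obtain i x' j y' where e: "((a, x), w, (b, y)) = ((renum i, x'), min_weight E (i, x') (j, y'), (renum j, y'))"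
    and "i \<in> {0, k - 1}" "j \<in> {0, k - 1}" "(i, x') \<noteq> (j, y')" "\<exists>w. path E (i, x') w (j, y')"
    unfolding close.simps snd_conv mem_Collect_eq by blast
  moreover have "a = renum i" "b = renum j" "x' = x" "y' = y" "w = min_weight E (i, x) (j, y)" using e by simp_all
  ultimately have "a = renum i" "b = renum j" "w = min_weight E (i, x) (j, y)" "i \<in> {0, k - 1}"
      "j \<in> {0, k - 1}" "(i, x) \<noteq> (j, y)" "\<exists>w. path E (i, x) w (j, y)"
    by simp_all
  then show ?R using assms by (auto simp: end_col_def renum_def split: if_splits)
next
  assume ?R
  then have R: "a = renum (end_col k a)" "b = renum (end_col k b)" "end_col k a \<in> {0, k - 1}" "end_col k b \<in> {0, k - 1}"
      "(end_col k a, x) \<noteq> (end_col k b, y)" "\<exists>w'. path E (end_col k a, x) w' (end_col k b, y)"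
      "w = min_weight E (end_col k a, x) (end_col k b, y)"
    using assms by (auto simp: end_col_def renum_def)
  have "((a, x), w, (b, y)) =
      ((renum (end_col k a), x), min_weight E (end_col k a, x) (end_col k b, y), (renum (end_col k b), y))"
    by (simp only: R(1)[symmetric] R(2)[symmetric] R(7)[symmetric])
  then show ?L unfolding close.simps snd_conv mem_Collect_eq using R(3-6) by blast
qed

lemma close_fst [simp]: "fst (close G) = 2"
  by (cases G) simp

section \<open>Powers of a periodic graph\<close>

text \<open>The law \<open>G^m \<cdot> G^m = G^(2m)\<close> needs only periodicity and free two-way
  links as the sole edges between consecutive periods; finiteness bounds the weights.\<close>

locale periodic_graph =
  fixes E :: "'c::finite edge set" and C :: nat
  assumes C_gt_1: "1 < C"
    and adjacent: "((i, x), w, (j, y)) \<in> E \<Longrightarrow> i \<le> Suc j \<and> j \<le> Suc i"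
    and periodic: "((i + C, x), w, (j + C, y)) \<in> E \<longleftrightarrow> ((i, x), w, (j, y)) \<in> E"
    and connect: "0 < m \<Longrightarrow> ((m * C - 1, x), w, (m * C, y)) \<in> E \<longleftrightarrow> w = wzero \<and> x = y"
      "0 < m \<Longrightarrow> ((m * C, x), w, (m * C - 1, y)) \<in> E \<longleftrightarrow> w = wzero \<and> x = y"
    and finite_restr: "finite (restr E 0 h)"
begin

definition copies :: "nat \<Rightarrow> 'c edge set" where
  "copies m = restr E 0 (m * C - 1)"

lemma copies_mono: "m \<le> n \<Longrightarrow> copies m \<subseteq> copies n"
  unfolding copies_def by (intro restr_mono) (auto intro: diff_le_mono)

lemma shift_edge: "((i + d * C, x), w, (j + d * C, y)) \<in> E \<longleftrightarrow> ((i, x), w, (j, y)) \<in> E"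
proof (induction d)
  case (Suc d)
  then show ?case using periodic[of "i + d * C" x w "j + d * C" y] by (simp add: algebra_simps)
qed simp

lemma cwalk_shift:
  "cwalk E lo hi u w v \<Longrightarrow> cwalk E (lo + d * C) (hi + d * C) (fst u + d * C, snd u) w (fst v + d * C, snd v)"
proof (induction rule: walk_induct)
  case (snoc w v w' z)
  have "((fst v + d * C, snd v), w', (fst z + d * C, snd z)) \<in> restr E (lo + d * C) (hi + d * C)"
    using snoc.hyps(2) by (auto simp: shift_edge)
  then show ?case by (rule walk_snoc[OF snoc.IH])
qed simp

lemma cwalk_unshift:
  assumes "d * C \<le> lo" "cwalk E lo hi u w v"
  shows "cwalk E (lo - d * C) (hi - d * C) (fst u - d * C, snd u) w (fst v - d * C, snd v)"
  using assms(2)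
proof (induction rule: walk_induct)
  case (snoc w v w' z)
  have r: "lo \<le> fst v" "fst v \<le> hi" "lo \<le> fst z" "fst z \<le> hi" and e: "(v, w', z) \<in> E"
    using snoc.hyps(2) by auto
  have "((fst v - d * C + d * C, snd v), w', (fst z - d * C + d * C, snd z)) \<in> E"
    using r e assms(1) by simp
  then have "((fst v - d * C, snd v), w', (fst z - d * C, snd z)) \<in> E" by (simp only: shift_edge)
  then have "((fst v - d * C, snd v), w', (fst z - d * C, snd z)) \<in> restr E (lo - d * C) (hi - d * C)"
    using r by auto
  then show ?case by (rule walk_snoc[OF snoc.IH])
qed simp

lemma copies_min_weight:
  assumes "neg_free (copies m)" "path (copies m) u w v"
  shows "is_min_weight (copies m) u v (min_weight (copies m) u v)"
proof -
  let ?E = "copies m"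
  define B where "B = Max (insert 0 ((\<lambda>(u, w, v). \<bar>snd w\<bar>) ` ?E))"
  have fin: "finite ?E" unfolding copies_def by (rule finite_restr)
  have B: "0 \<le> B" unfolding B_def using fin by simp
  have bound: "- B \<le> snd w" if "(a, w, b) \<in> ?E" for a w b
  proof -
    have "\<bar>snd w\<bar> \<le> B" unfolding B_def by (rule Max_ge) (use fin that in force)+
    then show ?thesis by linarith
  qed
  have V: "finite ({0..m * C - 1} \<times> (UNIV :: 'c set))" by simp
  show ?thesis
  proof (rule ex_min_weight[OF assms(2)])
    fix w' assume "path ?E u w' v"
    then show "- (B * int (card ({0..m * C - 1} \<times> (UNIV :: 'c set)))) \<le> snd w'"
      by (intro neg_free_bound[OF V B assms(1) _ path_walk])
         (use bound in \<open>auto simp: copies_def mem_Times_iff\<close>)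
  qed
qed

section \<open>The canonical form of \<open>m\<close> copies and its composition with itself\<close>

text \<open>The power \<open>G^m\<close>, obtained in one go from \<open>m\<close> copies instead of
  by repeated multiplication.\<close>

definition summary :: "nat \<Rightarrow> 'c tgraph" where
  "summary m = close (m * C, copies m)"

lemma one_less: "0 < m \<Longrightarrow> 1 < m * C"
  using C_gt_1 by (cases m) auto

text \<open>
  \<open>col m i\<close> is the column of \<open>2 * m\<close> copies that corresponds to column \<open>i\<close> of the composition of
  \<open>summary m\<close> with itself.
\<close>

definition col :: "nat \<Rightarrow> nat \<Rightarrow> nat" where
  "col m i = (if i = 0 then 0 else if i = 1 then m * C - 1 else if i = 2 then m * C else 2 * m * C - 1)"

definition doubled :: "nat \<Rightarrow> 'c edge set" where
  "doubled m = snd (compose (summary m) (summary m))"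

lemma compose_summary: "compose (summary m) (summary m) = (4, doubled m)"
proof -
  obtain F where F: "summary m = (2, F)" by (metis close_fst prod.collapse summary_def)
  show ?thesis unfolding doubled_def F by simp
qed

lemma doubled_iff:
  "((a, x), w, (b, y)) \<in> doubled m \<longleftrightarrow> ((a, x), w, (b, y)) \<in> snd (summary m) \<or>
    2 \<le> a \<and> 2 \<le> b \<and> ((a - 2, x), w, (b - 2, y)) \<in> snd (summary m) \<or>
    w = wzero \<and> x = y \<and> (a = 1 \<and> b = 2 \<or> a = 2 \<and> b = 1)"
proof -
  obtain F where F: "summary m = (2, F)" by (metis close_fst prod.collapse summary_def)
  show ?thesis unfolding doubled_def F by (auto simp: shift_iff)
qed

text \<open>\<open>b\<close> is true for the right half of \<open>2 * m\<close> copies.\<close>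

definition half :: "nat \<Rightarrow> bool \<Rightarrow> 'c edge set" where
  "half m b = (if b then restr E (m * C) (2 * m * C - 1) else restr E 0 (m * C - 1))"

lemma summary_edge_walk:
  assumes m: "0 < m" and nf: "neg_free (copies m)"
  shows "((a, x), w, (b, y)) \<in> snd (summary m) \<Longrightarrow> a \<le> 1 \<and> b \<le> 1 \<and> path (copies m) (col m a, x) w (col m b, y)"
  unfolding summary_def close_edge_iff[OF one_less[OF m]]
  using copies_min_weight[OF nf] by (auto simp: end_col_def col_def is_min_weight_def)

lemma doubled_edge_walk:
  assumes m: "0 < m" and nf: "neg_free (copies m)" and e: "((a, x), w, (b, y)) \<in> doubled m"
  shows "a \<le> 3 \<and> b \<le> 3 \<and> walk (copies (2 * m)) (col m a, x) w (col m b, y)"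
proof -
  have low: "cwalk E 0 (m * C - 1) (col m a, x) w (col m b, y) \<and> a \<le> 1 \<and> b \<le> 1"
    if "((a, x), w, (b, y)) \<in> snd (summary m)" for a b
    using summary_edge_walk[OF m nf that] by (simp add: copies_def walk_def)
  consider "((a, x), w, (b, y)) \<in> snd (summary m)" | "2 \<le> a" "2 \<le> b" "((a - 2, x), w, (b - 2, y)) \<in> snd (summary m)"
    | "w = wzero" "x = y" "a = 1 \<and> b = 2 \<or> a = 2 \<and> b = 1"
    using e unfolding doubled_iff by blast
  then show ?thesis
  proof cases
    case 1
    have "copies m \<subseteq> copies (2 * m)" by (rule copies_mono) simp
    then show ?thesis using low[OF 1] walk_mono by (fastforce simp: copies_def)
  next
    case 2
    have c: "col m (a - 2) + m * C = col m a" "col m (b - 2) + m * C = col m b"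
      using low[OF 2(3)] 2(1,2) m C_gt_1 by (auto simp: col_def mult_2 add_mult_distrib)
    have "cwalk E (0 + m * C) (m * C - 1 + m * C) (col m a, x) w (col m b, y)"
      using cwalk_shift[OF low[OF 2(3), THEN conjunct1], of m] c by simp
    then have "walk (copies (2 * m)) (col m a, x) w (col m b, y)"
      unfolding copies_def by (rule cwalk_mono) (auto simp: mult_2 add_mult_distrib)
    then show ?thesis using low[OF 2(3)] by auto
  next
    case 3
    then have "((col m a, x), w, (col m b, y)) \<in> copies (2 * m)"
      using connect[OF m, of x wzero x] m C_gt_1 by (auto simp: copies_def col_def mult_2 add_mult_distrib)
    then show ?thesis using 3 by (auto intro: edge_walk)
  qed
qed

lemma doubled_walk:
  assumes "0 < m" "neg_free (copies m)" "walk (doubled m) u w v"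
  shows "walk (copies (2 * m)) (col m (fst u), snd u) w (col m (fst v), snd v)"
  using assms(3)
proof (induction rule: walk_induct)
  case (snoc w v w' z)
  have "walk (copies (2 * m)) (col m (fst v), snd v) w' (col m (fst z), snd z)"
    using doubled_edge_walk[OF assms(1,2), of "fst v" "snd v" w' "fst z" "snd z"] snoc.hyps(2) by simp
  then show ?case by (rule walk_trans[OF snoc.IH])
qed simp

text \<open>Between distinct vertices the canonical form has an edge of minimal weight. It has none
  from a vertex to itself, but there the walk is closed, so it is not negative and is dominated by
  the empty walk.\<close>

lemma half_path_doubled:
  assumes m: "0 < m" and nf: "neg_free (copies m)"
    and w: "walk (half m b) (col m i, x) w (col m j, y)"
    and ij: "i \<le> 3" "j \<le> 3" "2 \<le> i \<longleftrightarrow> b" "2 \<le> j \<longleftrightarrow> b"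
  shows "\<exists>w'. wle w' w \<and> walk (doubled m) (i, x) w' (j, y)"
proof -
  define k where "k = (if b then 2 else 0 :: nat)"
  have kij: "i - k \<le> 1" "j - k \<le> 1" "k \<le> i" "k \<le> j" using ij by (auto simp: k_def)
  have c: "col m i - (k div 2) * m * C = end_col (m * C) (i - k)" "col m j - (k div 2) * m * C = end_col (m * C) (j - k)"
    using ij by (auto simp: k_def col_def end_col_def mult_2 add_mult_distrib)
  have "cwalk E 0 (m * C - 1) (end_col (m * C) (i - k), x) w (end_col (m * C) (j - k), y)"
  proof (cases b)
    case True
    have "cwalk E (m * C - m * C) (2 * m * C - 1 - m * C) (end_col (m * C) (i - k), x) w (end_col (m * C) (j - k), y)"
      using cwalk_unshift[OF order.refl w[unfolded half_def, simplified True if_True], of ] c True by (simp add: k_def)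
    then show ?thesis by (rule cwalk_mono) (auto simp: mult_2 add_mult_distrib)
  next
    case False
    then show ?thesis using w c by (simp add: half_def k_def)
  qed
  then have w': "walk (copies m) (end_col (m * C) (i - k), x) w (end_col (m * C) (j - k), y)"
    by (simp add: copies_def)
  show ?thesis
  proof (cases "(i - k, x) = (j - k, y)")
    case True
    then have eq: "(i, x) = (j, y)" using kij by auto
    have "\<not> wneg w" using neg_free_walk[OF nf, of "(end_col (m * C) (i - k), x)" w] w' True by simp
    then have "wle wzero w" using wle_wadd_nonneg[of w wzero] by simp
    then show ?thesis using eq by (metis walk_refl)
  next
    case False
    have ne: "(end_col (m * C) (i - k), x) \<noteq> (end_col (m * C) (j - k), y)"
      using False kij one_less[OF m] by (auto simp: end_col_def split: if_splits)
    have p: "path (copies m) (end_col (m * C) (i - k), x) w (end_col (m * C) (j - k), y)"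
      using walk_path[OF w' ne] .
    define w0 where "w0 = min_weight (copies m) (end_col (m * C) (i - k), x) (end_col (m * C) (j - k), y)"
    have "wle w0 w" using copies_min_weight[OF nf p] p by (auto simp: is_min_weight_def w0_def)
    moreover have "((i - k, x), w0, (j - k, y)) \<in> snd (summary m)"
      unfolding summary_def close_edge_iff[OF one_less[OF m]] using False kij p by (auto simp: w0_def)
    then have "((i, x), w0, (j, y)) \<in> doubled m"
      unfolding doubled_iff using kij by (auto simp: k_def split: if_splits)
    ultimately show ?thesis by (blast intro: edge_walk)
  qed
qed

definition in_half :: "nat \<Rightarrow> bool \<Rightarrow> 'c vertex \<Rightarrow> bool" where
  "in_half m b v \<longleftrightarrow> (if b then m * C \<le> fst v else fst v \<le> m * C - 1)"

lemma copies_double_edge: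
  assumes m: "0 < m" and e: "(v, w, z) \<in> copies (2 * m)" and b: "in_half m b v"
  shows "(v, w, z) \<in> half m b \<and> in_half m b z \<or>
    w = wzero \<and> v = (col m (if b then 2 else 1), snd v) \<and> z = (col m (if b then 1 else 2), snd v)"
proof -
  obtain i x j y where vz: "v = (i, x)" "z = (j, y)" by (cases v; cases z) auto
  have E: "((i, x), w, (j, y)) \<in> E" "i \<le> 2 * m * C - 1" "j \<le> 2 * m * C - 1"
    using e by (auto simp: vz copies_def)
  have adj: "i \<le> Suc j" "j \<le> Suc i" using adjacent[OF E(1)] by auto
  have mC: "0 < m * C" using one_less[OF m] by linarith
  show ?thesis
  proof (cases b)
    case True
    then have i: "m * C \<le> i" using b by (simp add: in_half_def vz)
    show ?thesis
    proof (cases "m * C \<le> j")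
      case True
      then show ?thesis using E i \<open>b\<close> by (auto simp: vz half_def in_half_def)
    next
      case False
      then have ij: "i = m * C" "j = m * C - 1" using i adj by auto
      then have "w = wzero \<and> x = y" using E(1) connect(2)[OF m] by auto
      then show ?thesis using ij \<open>b\<close> by (simp add: vz col_def)
    qed
  next
    case False
    then have i: "i \<le> m * C - 1" using b by (simp add: in_half_def vz)
    show ?thesis
    proof (cases "j \<le> m * C - 1")
      case True
      then show ?thesis using E i \<open>\<not> b\<close> by (auto simp: vz half_def in_half_def)
    next
      case j: False
      then have ij: "i = m * C - 1" "j = m * C" using i adj mC by linarith+
      then have "w = wzero \<and> x = y" using E(1) connect(1)[OF m] by auto
      then show ?thesis using ij \<open>\<not> b\<close> by (simp add: vz col_def)
    qed
  qed
qed

lemma if_half: "(if b then 2 else 1 :: nat) \<le> 3" "2 \<le> (if b then 2 else 1 :: nat) \<longleftrightarrow> b"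
  by simp_all

text \<open>Columns 1 and 2 of the composed graph are the two columns facing the middle. The walk is
  cut at its first and last crossing of the middle; at each further crossing the pending part
  \<open>w3\<close> runs between such columns of one half and can be absorbed into the walk
  \<open>w2\<close> of \<open>doubled m\<close>.\<close>

lemma copies_double_walk:
  assumes m: "0 < m" and nf: "neg_free (copies m)"
    and w: "walk (copies (2 * m)) u w v" and u: "in_half m b u"
  shows "walk (half m b) u w v \<and> in_half m b v \<or>
    (\<exists>x y b' w1 w2 w3. walk (half m b) u w1 (col m (if b then 2 else 1), x) \<and>
        walk (doubled m) (if b then 2 else 1, x) w2 (if b' then 2 else 1, y) \<and>
        walk (half m b') (col m (if b' then 2 else 1), y) w3 v \<and> in_half m b' v \<and>
        wle (wadd w1 (wadd w2 w3)) w)"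
  using w
proof (induction rule: walk_induct)
  case refl
  then show ?case using u by simp
next
  case (snoc w v w' z)
  have cross: "walk (doubled m) (if b then 2 else 1, x) wzero (if \<not> b then 2 else 1, x)" for b x
    by (rule edge_walk) (auto simp: doubled_iff)
  have inh: "in_half m b (col m (if b then 2 else 1), x)" for b x
    by (auto simp: in_half_def col_def)
  from snoc.IH show ?case
  proof (elim disjE exE conjE)
    assume v: "walk (half m b) u w v" "in_half m b v"
    from copies_double_edge[OF m snoc.hyps(2) v(2)] show ?thesis
    proof (elim disjE conjE)
      assume "(v, w', z) \<in> half m b" "in_half m b z"
      then show ?thesis using walk_snoc[OF v(1)] by blast
    next
      assume c: "w' = wzero" "v = (col m (if b then 2 else 1), snd v)" "z = (col m (if b then 1 else 2), snd v)"
      have z: "z = (col m (if \<not> b then 2 else 1), snd v)" using c by simp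
      have "walk (half m b) u w (col m (if b then 2 else 1), snd v)" using v(1) c(2) by simp
      moreover have "walk (half m (\<not> b)) (col m (if \<not> b then 2 else 1), snd v) wzero z"
        unfolding z by simp
      moreover have "in_half m (\<not> b) z" unfolding z by (rule inh)
      moreover have "wle (wadd w (wadd wzero wzero)) (wadd w w')" using c by simp
      ultimately show ?thesis using cross by blast
    qed
  next
    fix x y b' w1 w2 w3
    assume a: "walk (half m b) u w1 (col m (if b then 2 else 1), x)"
      "walk (doubled m) (if b then 2 else 1, x) w2 (if b' then 2 else 1, y)"
      "walk (half m b') (col m (if b' then 2 else 1), y) w3 v" "in_half m b' v"
      "wle (wadd w1 (wadd w2 w3)) w"
    from copies_double_edge[OF m snoc.hyps(2) a(4)] show ?thesis
    proof (elim disjE conjE)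
      assume z: "(v, w', z) \<in> half m b'" "in_half m b' z"
      have "wle (wadd w1 (wadd w2 (wadd w3 w'))) (wadd w w')"
        using wadd_mono[OF a(5) wle_refl[of w']] by (simp add: wadd_assoc)
      then show ?thesis using a(1,2) walk_snoc[OF a(3) z(1)] z(2) by blast
    next
      assume c: "w' = wzero" "v = (col m (if b' then 2 else 1), snd v)" "z = (col m (if b' then 1 else 2), snd v)"
      have z: "z = (col m (if \<not> b' then 2 else 1), snd v)" using c by simp
      have "walk (half m b') (col m (if b' then 2 else 1), y) w3 (col m (if b' then 2 else 1), snd v)"
        using a(3) c(2) by simp
      from half_path_doubled[OF m nf this if_half(1) if_half(1) if_half(2) if_half(2)]
      obtain w3' where w3': "wle w3' w3" "walk (doubled m) (if b' then 2 else 1, y) w3' (if b' then 2 else 1, snd v)"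
        by blast
      have "walk (doubled m) (if b then 2 else 1, x) (wadd w2 w3') (if \<not> b' then 2 else 1, snd v)"
        using walk_trans[OF walk_trans[OF a(2) w3'(2)] cross] by simp
      moreover have "walk (half m (\<not> b')) (col m (if \<not> b' then 2 else 1), snd v) wzero z"
        unfolding z by simp
      moreover have "in_half m (\<not> b') z" unfolding z by (rule inh)
      moreover have "wle (wadd w1 (wadd w2 w3')) (wadd w1 (wadd w2 w3))"
        by (intro wadd_mono wle_refl w3')
      then have "wle (wadd w1 (wadd (wadd w2 w3') wzero)) (wadd w w')"
        using wle_trans[OF _ a(5)] c by simp
      ultimately show ?thesis using a(1) by blast
    qed
  qed
qed

lemma copies_double_walk_doubled:
  assumes m: "0 < m" and nf: "neg_free (copies m)"
    and w: "walk (copies (2 * m)) (col m i, x) w (col m j, y)" and ij: "i \<le> 3" "j \<le> 3"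
  shows "\<exists>w'. wle w' w \<and> walk (doubled m) (i, x) w' (j, y)"
proof -
  have mC: "1 < m * C" by (rule one_less[OF m])
  have inh: "in_half m b (col m k, z) \<Longrightarrow> k \<le> 3 \<Longrightarrow> b \<longleftrightarrow> 2 \<le> k" for b k z
    using mC by (auto simp: in_half_def col_def mult_2 add_mult_distrib split: if_splits)
  have u: "in_half m (2 \<le> i) (col m i, x)"
    using mC ij by (auto simp: in_half_def col_def mult_2 add_mult_distrib)
  from copies_double_walk[OF m nf w u] show ?thesis
  proof (elim disjE exE conjE)
    assume "walk (half m (2 \<le> i)) (col m i, x) w (col m j, y)" "in_half m (2 \<le> i) (col m j, y)"
    then show ?thesis using half_path_doubled[OF m nf _ ij] inh ij by blast
  next
    fix z z' b' w1 w2 w3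
    assume a: "walk (half m (2 \<le> i)) (col m i, x) w1 (col m (if 2 \<le> i then 2 else 1), z)"
      "walk (doubled m) (if 2 \<le> i then 2 else 1, z) w2 (if b' then 2 else 1, z')"
      "walk (half m b') (col m (if b' then 2 else 1), z') w3 (col m j, y)" "in_half m b' (col m j, y)"
      "wle (wadd w1 (wadd w2 w3)) w"
    obtain v1 where v1: "wle v1 w1" "walk (doubled m) (i, x) v1 (if 2 \<le> i then 2 else 1, z)"
      using half_path_doubled[OF m nf a(1) ij(1) if_half(1) refl if_half(2)] by blast
    obtain v3 where v3: "wle v3 w3" "walk (doubled m) (if b' then 2 else 1, z') v3 (j, y)"
      using half_path_doubled[OF m nf a(3) if_half(1) ij(2) if_half(2) inh[OF a(4) ij(2), symmetric]] by blast
    have "wle (wadd v1 (wadd w2 v3)) w"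
      by (rule wle_trans[OF _ a(5)]) (intro wadd_mono wle_refl v1 v3)
    then show ?thesis using walk_trans[OF v1(2) walk_trans[OF a(2) v3(2)]] by blast
  qed
qed

text \<open>A cycle that stays in one half is a cycle of \<open>m\<close> copies. Any other is
  rotated: its last and first parts join to a walk inside one half between middle vertices, which
  closes \<open>w2\<close> to a cycle of \<open>doubled m\<close>.\<close>

lemma neg_free_double:
  assumes m: "0 < m" and nf: "neg_free (copies m)" "neg_free (doubled m)"
  shows "neg_free (copies (2 * m))"
  unfolding neg_free_def
proof (intro allI impI notI)
  fix u w assume p: "path (copies (2 * m)) u w u" and neg: "wneg w"
  have half_nf: "\<not> wneg w'" if "walk (half m b) v w' v" for b v w'
  proof (cases b)
    case True
    have "cwalk E (m * C - m * C) (2 * m * C - 1 - m * C) (fst v - m * C, snd v) w' (fst v - m * C, snd v)"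
      using cwalk_unshift[of m "m * C" "2 * m * C - 1" v w' v] that True by (simp add: half_def)
    then have "walk (copies m) (fst v - m * C, snd v) w' (fst v - m * C, snd v)"
      unfolding copies_def by (rule cwalk_mono) (auto simp: mult_2 add_mult_distrib)
    then show ?thesis by (rule neg_free_walk[OF nf(1)])
  next
    case False
    then show ?thesis using neg_free_walk[OF nf(1)] that by (simp add: half_def copies_def)
  qed
  define b where "b = (m * C \<le> fst u)"
  have u: "in_half m b u" by (auto simp: in_half_def b_def)
  from copies_double_walk[OF m nf(1) path_walk[OF p] u] show False
  proof (elim disjE exE conjE)
    assume "walk (half m b) u w u"
    then show False using half_nf neg by blast
  next
    fix x y b' w1 w2 w3
    assume a: "walk (half m b) u w1 (col m (if b then 2 else 1), x)"
      "walk (doubled m) (if b then 2 else 1, x) w2 (if b' then 2 else 1, y)"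
      "walk (half m b') (col m (if b' then 2 else 1), y) w3 u" "in_half m b' u"
      "wle (wadd w1 (wadd w2 w3)) w"
    have b': "b' = b" using a(4) u one_less[OF m] by (auto simp: in_half_def split: if_splits)
    have "walk (half m b) (col m (if b then 2 else 1), y) (wadd w3 w1) (col m (if b then 2 else 1), x)"
      using walk_trans[OF a(3)[unfolded b'] a(1)] .
    from half_path_doubled[OF m nf(1) this if_half(1) if_half(1) if_half(2) if_half(2)]
    obtain v where v: "wle v (wadd w3 w1)" "walk (doubled m) (if b then 2 else 1, y) v (if b then 2 else 1, x)"
      by blast
    have "\<not> wneg (wadd w2 v)"
      using neg_free_walk[OF nf(2)] walk_trans[OF a(2)[unfolded b'] v(2)] by blast
    moreover have "wle (wadd w2 v) w"
      by (rule wle_trans[OF _ a(5)]) (use wadd_mono[OF wle_refl v(1), of w2] in \<open>simp add: wadd_ac\<close>)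
    ultimately show False using neg by (auto simp: wle_iff wneg_iff)
  qed
qed

lemma neg_free_doubled:
  assumes m: "0 < m" and nf: "neg_free (copies (2 * m))"
  shows "neg_free (doubled m)"
proof -
  have "neg_free (copies m)" by (rule neg_free_subset[OF nf copies_mono]) simp
  then have "\<not> wneg w" if "path (doubled m) u w u" for u w
    using neg_free_walk[OF nf doubled_walk[OF m _ path_walk[OF that]]] by blast
  then show ?thesis unfolding neg_free_def by blast
qed

lemma gmult_summary:
  assumes m: "0 < m" and nf: "neg_free (copies (2 * m))"
  shows "gmult (summary m) (summary m) = summary (2 * m)"
proof -
  have nf': "neg_free (copies m)" by (rule neg_free_subset[OF nf copies_mono]) simp
  have c: "end_col (2 * m * C) a = col m (end_col 4 a)" if "a \<le> 1" for a
    using that m by (auto simp: end_col_def col_def)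
  have "snd (close (4, doubled m)) = snd (close (2 * m * C, copies (2 * m)))"
  proof (rule edge_set_eqI)
    fix a b :: nat and x y :: 'c and w
    show "((a, x), w, (b, y)) \<in> snd (close (4, doubled m)) \<longleftrightarrow>
      ((a, x), w, (b, y)) \<in> snd (close (2 * m * C, copies (2 * m)))"
    proof (cases "a \<le> 1 \<and> b \<le> 1 \<and> (a, x) \<noteq> (b, y)")
      case True
      define u v where "u = (end_col 4 a, x)" and "v = (end_col 4 b, y)"
      define u' v' where "u' = (end_col (2 * m * C) a, x)" and "v' = (end_col (2 * m * C) b, y)"
      have ne: "u \<noteq> v" "u' \<noteq> v'"
        using True one_less[of "2 * m"] m by (auto simp: u_def v_def u'_def v'_def end_col_def split: if_splits)
      have "\<exists>w'. wle w' w \<and> path (copies (2 * m)) u' w' v'" if "path (doubled m) u w v" for w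
      proof -
        have "walk (copies (2 * m)) u' w v'"
          using doubled_walk[OF m nf' path_walk[OF that]] True by (simp add: u_def v_def u'_def v'_def c)
        then show ?thesis using walk_path[OF _ ne(2)] wle_refl by blast
      qed
      note to_copies = this
      have to_doubled: "\<exists>w'. wle w' w \<and> path (doubled m) u w' v" if "path (copies (2 * m)) u' w v'" for w
      proof -
        have "walk (copies (2 * m)) (col m (end_col 4 a), x) w (col m (end_col 4 b), y)"
          using path_walk[OF that] True by (simp add: u'_def v'_def c)
        moreover have "end_col 4 a \<le> 3" "end_col 4 b \<le> 3" by (simp_all add: end_col_def)
        ultimately show ?thesis
          using copies_double_walk_doubled[OF m nf'] walk_path[OF _ ne(1)] by (fastforce simp: u_def v_def)
      qed
      from min_weight_cong[OF to_copies to_doubled] show ?thesis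
        using True one_less[of "2 * m"] m
        by (simp add: close_edge_iff u_def v_def u'_def v'_def del: close.simps)
    next
      case False
      have "1 < (4 :: nat)" "1 < 2 * m * C" using one_less[of "2 * m"] m by simp_all
      then show ?thesis using False by (simp only: close_edge_iff) blast
    qed
  qed
  then show ?thesis
    unfolding gmult_def compose_summary summary_def[of "2 * m"] by (simp only: prod_eq_iff close_fst simp_thms)
qed

end

section \<open>Runs and solutions\<close>

text \<open>Compatibility of each lower with each upper bound suffices on a line. The midpoint of
  the greatest lower and the least upper bound respects strict bounds too, since a strict bound
  attaining one of these extremes forces a gap.\<close>

lemma ex_between:
  fixes f :: "'a \<Rightarrow> real" and lo up :: "'a \<Rightarrow> weight"
  assumes fin: "finite I" "finite J"
    and le: "\<And>a b. a \<in> I \<Longrightarrow> b \<in> J \<Longrightarrow> wsat (f a - f b) (wadd (up b) (lo a))"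
  shows "\<exists>r. (\<forall>a\<in>I. wsat (f a - r) (lo a)) \<and> (\<forall>b\<in>J. wsat (r - f b) (up b))"
proof -
  define l where "l a = f a - of_int (snd (lo a))" for a
  define u where "u b = f b + of_int (snd (up b))" for b
  have lu: "l a \<le> u b" "fst (lo a) \<or> fst (up b) \<Longrightarrow> l a < u b" if "a \<in> I" "b \<in> J" for a b
    using le[OF that] by (auto simp: wsat_def l_def u_def split: if_splits)
  have I: "wsat (f a - r) (lo a)" if "l a \<le> r" "fst (lo a) \<Longrightarrow> l a < r" for a r
    using that by (auto simp: wsat_def l_def)
  have J: "wsat (r - f b) (up b)" if "r \<le> u b" "fst (up b) \<Longrightarrow> r < u b" for b r
    using that by (auto simp: wsat_def u_def)
  consider "I = {}" | "J = {}" | "I \<noteq> {}" "J \<noteq> {}" by blast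
  then show ?thesis
  proof cases
    case 1
    show ?thesis
    proof (cases "J = {}")
      case False
      have "Min (u ` J) - 1 < u b" if "b \<in> J" for b
      proof -
        have "Min (u ` J) \<le> u b" by (rule Min_le) (use fin that in auto)
        then show ?thesis by linarith
      qed
      then show ?thesis using 1 J by (intro exI[of _ "Min (u ` J) - 1"]) (auto simp: less_imp_le)
    qed (use 1 in simp)
  next
    case 2
    show ?thesis
    proof (cases "I = {}")
      case False
      have "l a < Max (l ` I) + 1" if "a \<in> I" for a
      proof -
        have "l a \<le> Max (l ` I)" by (rule Max_ge) (use fin that in auto)
        then show ?thesis by linarith
      qed
      then show ?thesis using 2 I by (intro exI[of _ "Max (l ` I) + 1"]) (auto simp: less_imp_le)
    qed (use 2 in simp)
  next
    case 3
    define a0 where "a0 = Max (l ` I)"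
    define b0 where "b0 = Min (u ` J)"
    have "a0 \<in> l ` I" unfolding a0_def using fin 3 by (intro Max_in) auto
    then obtain a where a: "a \<in> I" "l a = a0" by blast
    have "b0 \<in> u ` J" unfolding b0_def using fin 3 by (intro Min_in) auto
    then obtain b where b: "b \<in> J" "u b = b0" by blast
    have la: "l a' \<le> a0" if "a' \<in> I" for a' unfolding a0_def using fin that by simp
    have ub: "b0 \<le> u b'" if "b' \<in> J" for b' unfolding b0_def using fin that by simp
    have ab: "a0 \<le> b0" using lu(1)[OF a(1) b(1)] a b by simp
    let ?r = "(a0 + b0) / 2"
    have "wsat (f a' - ?r) (lo a')" if a': "a' \<in> I" for a'
    proof (rule I)
      show "l a' \<le> ?r" using la[OF a'] ab by simp
      show "l a' < ?r" if "fst (lo a')" using lu(2)[OF a' b(1)] that la[OF a'] ab b(2) by simp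
    qed
    moreover have "wsat (?r - f b') (up b')" if b': "b' \<in> J" for b'
    proof (rule J)
      show "?r \<le> u b'" using ub[OF b'] ab by simp
      show "?r < u b'" if "fst (up b')" using lu(2)[OF a(1) b'] that ub[OF b'] ab a(2) by simp
    qed
    ultimately show ?thesis by blast
  qed
qed

text \<open>Fourier-Motzkin elimination read backwards: values are assigned one vertex at a time,
  and a lower and an upper bound on the new value are compatible because together they come from a
  path between old vertices through \<open>z\<close>.\<close>

lemma extend_assignment:
  fixes f :: "'c vertex \<Rightarrow> real"
  assumes nf: "neg_free E"
    and min: "\<And>u w v. path E u w v \<Longrightarrow> is_min_weight E u v (min_weight E u v)"
    and A: "finite A" "\<And>a w b. a \<in> A \<Longrightarrow> b \<in> A \<Longrightarrow> path E a w b \<Longrightarrow> wsat (f b - f a) w"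
    and B: "finite B"
  shows "\<exists>g. (\<forall>a\<in>A. g a = f a) \<and> (\<forall>a\<in>A \<union> B. \<forall>b\<in>A \<union> B. \<forall>w. path E a w b \<longrightarrow> wsat (g b - g a) w)"
  using B
proof (induction rule: finite_induct)
  case empty
  show ?case by (rule exI[of _ f]) (use A(2) in auto)
next
  case (insert z B)
  then obtain g where g: "\<forall>a\<in>A. g a = f a"
      "\<forall>a\<in>A \<union> B. \<forall>b\<in>A \<union> B. \<forall>w. path E a w b \<longrightarrow> wsat (g b - g a) w"
    by blast
  show ?case
  proof (cases "z \<in> A \<union> B")
    case True
    then have "A \<union> insert z B = A \<union> B" by blast
    then show ?thesis using g by auto
  next
    case False
    define I where "I = {a \<in> A \<union> B. \<exists>w. path E z w a}"
    define J where "J = {a \<in> A \<union> B. \<exists>w. path E a w z}"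
    have fin: "finite I" "finite J" using A(1) insert.hyps(1) by (simp_all add: I_def J_def)
    have I: "path E z (min_weight E z a) a" "path E z w a \<Longrightarrow> wle (min_weight E z a) w" if "a \<in> I" for a w
    proof -
      have "is_min_weight E z a (min_weight E z a)" using min that unfolding I_def by blast
      then show "path E z (min_weight E z a) a" "path E z w a \<Longrightarrow> wle (min_weight E z a) w"
        by (simp_all add: is_min_weight_def)
    qed
    have J: "path E a (min_weight E a z) z" "path E a w z \<Longrightarrow> wle (min_weight E a z) w" if "a \<in> J" for a w
    proof -
      have "is_min_weight E a z (min_weight E a z)" using min that unfolding J_def by blast
      then show "path E a (min_weight E a z) z" "path E a w z \<Longrightarrow> wle (min_weight E a z) w"
        by (simp_all add: is_min_weight_def)
    qed
    have "wsat (g a - g b) (wadd (min_weight E b z) (min_weight E z a))" if "a \<in> I" "b \<in> J" for a b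
      using g(2) path_trans[OF I(1)[OF that(1)] J(1)[OF that(2)]] that by (auto simp: I_def J_def)
    from ex_between[where f = g and lo = "\<lambda>a. min_weight E z a" and up = "\<lambda>b. min_weight E b z", OF fin this]
    obtain r where r: "\<And>a. a \<in> I \<Longrightarrow> wsat (g a - r) (min_weight E z a)"
        "\<And>b. b \<in> J \<Longrightarrow> wsat (r - g b) (min_weight E b z)"
      by blast
    have "wsat ((g(z := r)) b - (g(z := r)) a) w"
      if ab: "a \<in> A \<union> insert z B" "b \<in> A \<union> insert z B" and p: "path E a w b" for a b w
    proof -
      consider "a = z" "b = z" | "a = z" "b \<noteq> z" | "a \<noteq> z" "b = z" | "a \<noteq> z" "b \<noteq> z" by blast
      then show ?thesis
      proof cases
        case 1
        then show ?thesis using nf p by (auto simp: neg_free_def wsat_0)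
      next
        case 2
        then have "b \<in> I" using ab p by (auto simp: I_def)
        then show ?thesis using wsat_mono[OF r(1) I(2)] p 2 by simp
      next
        case 3
        then have "a \<in> J" using ab p by (auto simp: J_def)
        then show ?thesis using wsat_mono[OF r(2) J(2)] p 3 by simp
      next
        case 4
        then show ?thesis using g(2) ab p by auto
      qed
    qed
    moreover have "\<forall>a\<in>A. (g(z := r)) a = f a" using g(1) False by auto
    ultimately show ?thesis by blast
  qed
qed

lemma glue_traces:
  fixes M :: nat
  assumes M: "0 < M" and t: "\<And>i. t (i + M) = t i"
    and tr: "\<And>j. \<exists>W D. W 0 = vs j \<and> W M = vs (Suc j) \<and> (\<forall>i<M. P (W i) (t i) (D i) (W (Suc i)))"
  shows "\<exists>ws ds. ws 0 = vs 0 \<and> (\<forall>i. P (ws i) (t i) (ds i) (ws (Suc i)))"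
proof -
  obtain W D where W: "\<And>j. W j 0 = vs j" "\<And>j. W j M = vs (Suc j)"
      "\<And>i j. i < M \<Longrightarrow> P (W j i) (t i) (D j i) (W j (Suc i))"
    using tr by metis
  have t_mod: "t (i mod M) = t i" for i
  proof -
    have "t (k * M + r) = t r" for k r
    proof (induction k)
      case (Suc k)
      have "Suc k * M + r = k * M + r + M" by simp
      then show ?case using Suc by (simp only: t)
    qed simp
    then have "t (i div M * M + i mod M) = t (i mod M)" .
    then show ?thesis by simp
  qed
  define ws where "ws i = W (i div M) (i mod M)" for i
  define ds where "ds i = D (i div M) (i mod M)" for i
  have "P (ws i) (t i) (ds i) (ws (Suc i))" for i
  proof -
    have "P (ws i) (t i) (ds i) (W (i div M) (Suc (i mod M)))"
      using W(3)[of "i mod M" "i div M"] M by (simp add: ws_def ds_def t_mod)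
    moreover have "ws (Suc i) = W (i div M) (Suc (i mod M))"
    proof (cases "Suc (i mod M) = M")
      case True
      then have "Suc i mod M = 0" "Suc i div M = Suc (i div M)" by (simp_all add: mod_Suc div_Suc)
      then show ?thesis using True by (simp add: ws_def W)
    next
      case False
      then have "Suc i mod M = Suc (i mod M)" "Suc i div M = i div M" by (simp_all add: mod_Suc div_Suc)
      then show ?thesis by (simp add: ws_def)
    qed
    ultimately show ?thesis by simp
  qed
  moreover have "ws 0 = vs 0" by (simp add: ws_def W)
  ultimately show ?thesis by blast
qed

lemma run_iff_trace:
  "run x0 v ts v' \<longleftrightarrow> (\<exists>ws ds. ws 0 = v \<and> ws (length ts) = v' \<and>
     (\<forall>i<length ts. step x0 (ws i) (ts ! i) (ds i) (ws (Suc i))))"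
proof (induction ts arbitrary: v)
  case Nil
  show ?case by (auto intro: exI[of _ "\<lambda>_. v"])
next
  case (Cons t ts)
  show ?case
  proof
    assume "run x0 v (t # ts) v'"
    then obtain d w where dw: "step x0 v t d w" "run x0 w ts v'" by auto
    from dw(2)[unfolded Cons.IH] obtain ws ds where ws: "ws 0 = w" "ws (length ts) = v'"
        "\<forall>i<length ts. step x0 (ws i) (ts ! i) (ds i) (ws (Suc i))" by blast
    define ws' where "ws' i = (case i of 0 \<Rightarrow> v | Suc j \<Rightarrow> ws j)" for i
    define ds' where "ds' i = (case i of 0 \<Rightarrow> d | Suc j \<Rightarrow> ds j)" for i
    have "step x0 (ws' i) ((t # ts) ! i) (ds' i) (ws' (Suc i))" if "i < length (t # ts)" for i
      using that dw(1) ws by (cases i) (simp_all add: ws'_def ds'_def)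
    moreover have "ws' 0 = v" "ws' (length (t # ts)) = v'" using ws by (simp_all add: ws'_def)
    ultimately show "\<exists>ws ds. ws 0 = v \<and> ws (length (t # ts)) = v' \<and>
       (\<forall>i<length (t # ts). step x0 (ws i) ((t # ts) ! i) (ds i) (ws (Suc i)))"
      by blast
  next
    assume "\<exists>ws ds. ws 0 = v \<and> ws (length (t # ts)) = v' \<and>
       (\<forall>i<length (t # ts). step x0 (ws i) ((t # ts) ! i) (ds i) (ws (Suc i)))"
    then obtain ws ds where ws: "ws 0 = v" "ws (length (t # ts)) = v'"
      and st: "\<And>i. i < length (t # ts) \<Longrightarrow> step x0 (ws i) ((t # ts) ! i) (ds i) (ws (Suc i))" by blast
    have "run x0 (ws (Suc 0)) ts v'"
      unfolding Cons.IH
      by (rule exI[of _ "\<lambda>i. ws (Suc i)"], rule exI[of _ "\<lambda>i. ds (Suc i)"])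
         (use ws st[of "Suc i" for i] in simp)
    then show "run x0 v (t # ts) v'" using st[of 0] ws(1) by auto
  qed
qed

text \<open>Differences to the reference clock are the clock values, and minus the value at
  \<open>x0\<close> is absolute time, so its increase over the first edge is the delay.\<close>

lemma step_of_sat:
  assumes sat: "\<And>a x w b y. ((a, x), w, (b, y)) \<in> snd (trans_graph x0 (g, R)) \<Longrightarrow> wsat (f (c + b, y) - f (c + a, x)) w"
    and x0: "x0 \<notin> R"
  shows "step x0 (\<lambda>x. f (c, x) - f (c, x0)) (g, R) (f (c, x0) - f (Suc c, x0)) (\<lambda>x. f (c + 2, x) - f (c + 2, x0))"
proof -
  have 1: "f (Suc c, x0) \<le> f (c, x0)"
    using sat[of 0 x0 wzero 1 x0] by (simp add: trans_edge_iff wsat_wzero)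
  have 2: "f (Suc c, x) = f (c, x)" if "x \<noteq> x0" for x
    using sat[of 0 x wzero 1 x] sat[of 1 x wzero 0 x] that by (simp add: trans_edge_iff wsat_wzero)
  have 3: "f (c + 2, x) = f (Suc c, x)" if "x \<notin> R" for x
    using sat[of 1 x wzero 2 x] sat[of 2 x wzero 1 x] that by (simp add: trans_edge_iff wsat_wzero)
  have 4: "f (c + 2, x) = f (c + 2, x0)" if "x \<in> R" for x
    using sat[of 2 x0 wzero 2 x] sat[of 2 x wzero 2 x0] that by (simp add: trans_edge_iff wsat_wzero)
  have del: "delay x0 (\<lambda>x. f (c, x) - f (c, x0)) (f (c, x0) - f (Suc c, x0)) = (\<lambda>x. f (Suc c, x) - f (Suc c, x0))"
    using 2 by (auto simp: delay_def)
  have "sat_atom (\<lambda>x. f (Suc c, x) - f (Suc c, x0)) a" if "a \<in> set g" for a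
  proof -
    obtain x r k where a: "a = (x, r, k)" by (cases a) auto
    have u: "wsat (f (Suc c, x) - f (Suc c, x0)) (r = Lt, int k)" if "is_upper r"
      using sat[of 1 x0 "(r = Lt, int k)" 1 x] that \<open>a \<in> set g\<close> by (auto simp: trans_edge_iff a)
    have l: "wsat (f (Suc c, x0) - f (Suc c, x)) (r = Gt, - int k)" if "is_lower r"
      using sat[of 1 x "(r = Gt, - int k)" 1 x0] that \<open>a \<in> set g\<close> by (auto simp: trans_edge_iff a)
    show ?thesis using u l by (cases r) (auto simp: a wsat_def is_upper_def is_lower_def)
  qed
  moreover have "(\<lambda>x. f (c + 2, x) - f (c + 2, x0)) = reset R (\<lambda>x. f (Suc c, x) - f (Suc c, x0))"
    using 3 4 x0 by (auto simp: reset_def)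
  ultimately show ?thesis using 1 by (simp add: step_def del)
qed

lemma sat_of_step:
  assumes st: "step x0 v (g, R) d v'" and v: "valuation x0 v" and x0: "x0 \<notin> R"
    and f0: "\<And>x. f 0 x = v x - T" and f1: "\<And>x. f 1 x = delay x0 v d x - (T + d)"
    and f2: "\<And>x. f 2 x = v' x - (T + d)"
    and e: "((a, x), w, (b, y)) \<in> snd (trans_graph x0 (g, R))"
  shows "wsat (f b y - f a x) w"
proof -
  have d: "0 \<le> d" and g: "\<And>a. a \<in> set g \<Longrightarrow> sat_atom (delay x0 v d) a" and v': "v' = reset R (delay x0 v d)"
    using st by (auto simp: step_def)
  have v0: "v x0 = 0" "\<And>x. 0 \<le> v x" using v by (auto simp: valuation_def)
  have f0': "f (Suc 0) x = delay x0 v d x - (T + d)" for x using f1 by simp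
  have up: "wsat (delay x0 v d y) (r = Lt, int k)" if "(y, r, k) \<in> set g" "is_upper r" for y r k
    using g[OF that(1)] that(2) by (cases r) (auto simp: wsat_def is_upper_def)
  have lo: "wsat (- delay x0 v d y) (r = Gt, - int k)" if "(y, r, k) \<in> set g" "is_lower r" for y r k
    using g[OF that(1)] that(2) by (cases r) (auto simp: wsat_def is_lower_def)
  have dx0: "delay x0 v d x0 = 0" and dge: "0 \<le> delay x0 v d x" for x
    using v0 d by (auto simp: delay_def)
  show ?thesis using e unfolding trans_edge_iff
  proof (elim disjE conjE exE)
    fix r k assume "(y, r, k) \<in> set g" "is_upper r" "w = (r = Lt, int k)" "a = 1" "b = 1" "x = x0"
    then show ?thesis using up by (simp add: f0' dx0)
  next
    fix r k assume "(x, r, k) \<in> set g" "is_lower r" "w = (r = Gt, - int k)" "a = 1" "b = 1" "y = x0"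
    then show ?thesis using lo by (simp add: f0' dx0)
  qed (use d v0 dge x0 in \<open>auto simp: wsat_wzero f0 f0' f2 v' reset_def delay_def split: if_splits\<close>)
qed

lemma step_valuation: "step x0 v t d v' \<Longrightarrow> valuation x0 v \<Longrightarrow> x0 \<notin> snd t \<Longrightarrow> valuation x0 v'"
  by (auto simp: step_def valuation_def reset_def delay_def)

section \<open>Iterating a sequence whose guarded clocks are all reset\<close>

text \<open>The situation after reduction. Guards on reset clocks only keep all edges between
  different clocks inside \<open>clocks\<close>, and a reset clock is needed to tie the reference
  clock down at the cuts.\<close>

locale timed_loop =
  fixes x0 :: "'c::finite" and \<tau> :: "'c transition list"
  assumes wf: "wf_seq x0 \<tau>"
    and guarded: "t \<in> set \<tau> \<Longrightarrow> (x, r, c) \<in> set (fst t) \<Longrightarrow> x \<in> reset_clocks \<tau>"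
    and resets: "reset_clocks \<tau> \<noteq> {}"
begin

definition N :: nat where "N = length \<tau>"
definition trn :: "nat \<Rightarrow> 'c transition" where "trn i = \<tau> ! (i mod N)"
definition G :: "'c edge set" where "G = inf_graph x0 trn"
definition clocks :: "'c set" where "clocks = insert x0 (reset_clocks \<tau>)"

lemma N_pos: "0 < N"
  using resets by (auto simp: N_def reset_clocks_def)

lemma trn_periodic: "trn (i + N) = trn i"
  by (simp add: trn_def)

lemma trn_in: "trn i \<in> set \<tau>"
  using N_pos by (simp add: trn_def N_def)

lemma x0_not_reset: "x0 \<notin> snd (trn i)" "x0 \<notin> reset_clocks \<tau>"
  using wf trn_in[of i] by (force simp: wf_seq_def reset_clocks_def)+

lemma G_edge_iff:
  "((a, x), w, (b, y)) \<in> G \<longleftrightarrow>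
     (\<exists>i. 3 * i \<le> a \<and> 3 * i \<le> b \<and> ((a - 3 * i, x), w, (b - 3 * i, y)) \<in> snd (trans_graph x0 (trn i)))
   \<or> (\<exists>i. w = wzero \<and> y = x \<and> (a = 3 * i + 2 \<and> b = 3 * i + 3 \<or> a = 3 * i + 3 \<and> b = 3 * i + 2))"
  unfolding G_def by (rule inf_edge_iff)

lemma G_trans_edge:
  "((a, x), w, (b, y)) \<in> snd (trans_graph x0 (trn i)) \<Longrightarrow> ((3 * i + a, x), w, (3 * i + b, y)) \<in> G"
  unfolding G_edge_iff by (intro disjI1 exI[of _ i]) simp

lemma G_connect:
  assumes "0 < m"
  shows "((m * (3 * N) - 1, x), w, (m * (3 * N), y)) \<in> G \<longleftrightarrow> w = wzero \<and> x = y"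
    "((m * (3 * N), x), w, (m * (3 * N) - 1, y)) \<in> G \<longleftrightarrow> w = wzero \<and> x = y"
proof -
  obtain k where k: "m * N = Suc k" using assms N_pos by (metis gr0_implies_Suc nat_0_less_mult_iff)
  have m: "m * (3 * N) = 3 * k + 3" using k by (simp add: algebra_simps)
  have no: "\<not> (3 * i \<le> 3 * k + 2 \<and> 3 * i \<le> 3 * k + 3 \<and> 3 * k + 3 - 3 * i \<le> 2)" for i
    by presburger
  show "((m * (3 * N) - 1, x), w, (m * (3 * N), y)) \<in> G \<longleftrightarrow> w = wzero \<and> x = y"
  proof
    assume "((m * (3 * N) - 1, x), w, (m * (3 * N), y)) \<in> G"
    then have "((3 * k + 2, x), w, (3 * k + 3, y)) \<in> G" by (simp add: m)
    then show "w = wzero \<and> x = y"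
      unfolding G_edge_iff
    proof (elim disjE exE conjE)
      fix i assume i: "3 * i \<le> 3 * k + 2" "3 * i \<le> 3 * k + 3"
      assume "((3 * k + 2 - 3 * i, x), w, (3 * k + 3 - 3 * i, y)) \<in> snd (trans_graph x0 (trn i))"
      then have "3 * k + 3 - 3 * i \<le> 2" by (rule trans_edge_bound[THEN conjunct2])
      then show ?thesis using no i by blast
    qed simp_all
  next
    assume "w = wzero \<and> x = y"
    then have "((3 * k + 2, x), w, (3 * k + 3, y)) \<in> G"
      unfolding G_edge_iff by (intro disjI2 exI[of _ k]) simp
    then show "((m * (3 * N) - 1, x), w, (m * (3 * N), y)) \<in> G" by (simp add: m)
  qed
  show "((m * (3 * N), x), w, (m * (3 * N) - 1, y)) \<in> G \<longleftrightarrow> w = wzero \<and> x = y"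
  proof
    assume "((m * (3 * N), x), w, (m * (3 * N) - 1, y)) \<in> G"
    then have "((3 * k + 3, x), w, (3 * k + 2, y)) \<in> G" by (simp add: m)
    then show "w = wzero \<and> x = y"
      unfolding G_edge_iff
    proof (elim disjE exE conjE)
      fix i assume i: "3 * i \<le> 3 * k + 2" "3 * i \<le> 3 * k + 3"
      assume "((3 * k + 3 - 3 * i, x), w, (3 * k + 2 - 3 * i, y)) \<in> snd (trans_graph x0 (trn i))"
      then have "3 * k + 3 - 3 * i \<le> 2" by (rule trans_edge_bound[THEN conjunct1])
      then show ?thesis using no i by blast
    qed simp_all
  next
    assume "w = wzero \<and> x = y"
    then have "((3 * k + 3, x), w, (3 * k + 2, y)) \<in> G"
      unfolding G_edge_iff by (intro disjI2 exI[of _ k]) simp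
    then show "((m * (3 * N), x), w, (m * (3 * N) - 1, y)) \<in> G" by (simp add: m)
  qed
qed

text \<open>An overestimate of the weights in transition \<open>i\<close>, for the finiteness of
  \<open>restr G 0 h\<close>.\<close>

definition trn_weights :: "nat \<Rightarrow> weight set" where
  "trn_weights i = insert wzero ((\<lambda>(x, r, c). (r = Lt, int c)) ` set (fst (trn i))
     \<union> (\<lambda>(x, r, c). (r = Gt, - int c)) ` set (fst (trn i)))"

lemma finite_G_restr: "finite (restr G 0 h)"
proof (rule finite_subset)
  let ?V = "{0..h} \<times> (UNIV :: 'c set)"
  show "finite (?V \<times> (\<Union>i\<le>h. trn_weights i) \<times> ?V)"
    by (intro finite_cartesian_product finite_UN_I) (auto simp: trn_weights_def)
  show "restr G 0 h \<subseteq> ?V \<times> (\<Union>i\<le>h. trn_weights i) \<times> ?V"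
  proof (rule subsetI)
    fix e assume e: "e \<in> restr G 0 h"
    obtain a x w b y where e': "e = ((a, x), w, (b, y))" by (metis prod.collapse)
    then have ab: "a \<le> h" "b \<le> h" and "((a, x), w, (b, y)) \<in> G" using e by auto
    from this(3) have "\<exists>i\<le>h. w \<in> trn_weights i"
      unfolding G_edge_iff
    proof (elim disjE exE conjE)
      fix i assume i: "3 * i \<le> a" "((a - 3 * i, x), w, (b - 3 * i, y)) \<in> snd (trans_graph x0 (trn i))"
      obtain g R where t: "trn i = (g, R)" by (cases "trn i")
      have "w \<in> trn_weights i"
        using i(2) unfolding t trans_edge_iff
        by (elim disjE exE conjE) (force simp: trn_weights_def t)+
      moreover have "i \<le> h" using i(1) ab by linarith
      ultimately show ?thesis by blast
    qed (auto simp: trn_weights_def)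
    then show "e \<in> ?V \<times> (\<Union>i\<le>h. trn_weights i) \<times> ?V" using ab by (auto simp: e')
  qed
qed

sublocale periodic_graph G "3 * N"
proof
  show "1 < 3 * N" using N_pos by simp
  show "i \<le> Suc j \<and> j \<le> Suc i" if "((i, x), w, (j, y)) \<in> G" for i x w j y
    using inf_edge_adjacent that unfolding G_def by fast
  show "((i + 3 * N, x), w, (j + 3 * N, y)) \<in> G \<longleftrightarrow> ((i, x), w, (j, y)) \<in> G" for i x w j y
    unfolding G_def by (rule inf_graph_shift) (rule trn_periodic)
qed (use G_connect finite_G_restr in simp_all)

lemma closed_clocks:
  assumes "((a, x), w, (b, y)) \<in> G"
  shows "x = y \<or> x \<in> clocks \<and> y \<in> clocks"
  using assms unfolding G_edge_iff
proof (elim disjE exE conjE)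
  fix i assume e: "((a - 3 * i, x), w, (b - 3 * i, y)) \<in> snd (trans_graph x0 (trn i))"
  obtain g R where t: "trn i = (g, R)" by (cases "trn i")
  have g: "z \<in> clocks" if "(z, r, c) \<in> set g" for z r c
    using guarded[OF trn_in, of z r c i] that by (simp add: t clocks_def)
  have R: "z \<in> clocks" if "z \<in> R" for z
    using trn_in[of i] that by (force simp: t clocks_def reset_clocks_def)
  have "x0 \<in> clocks" by (simp add: clocks_def)
  then show ?thesis
    using e unfolding t trans_edge_iff by (elim disjE exE conjE) (use g R in simp_all)
qed auto

lemma walk_clocks: "walk G u w v \<Longrightarrow> snd u \<in> clocks \<or> snd v = snd u"
proof (induction rule: walk_induct)
  case (snoc w v w' z)
  then show ?case using closed_clocks[of "fst v" "snd v" w' "fst z" "snd z"] by auto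
qed simp

lemma G_edge_right: "((c, x), wzero, (Suc c, x)) \<in> G"
  unfolding G_def by (rule inf_graph_right)

lemma walk_right: "walk G (c, x) wzero (c + d, x)"
proof (induction d)
  case (Suc d)
  from walk_snoc[OF Suc.IH G_edge_right] show ?case by simp
qed simp

text \<open>In column \<open>3 * reset_pos x + 2\<close> of each period \<open>x\<close> has just
  been reset and equals the reference clock.\<close>

definition reset_pos :: "'c \<Rightarrow> nat" where
  "reset_pos x = (SOME p. p < N \<and> x \<in> snd (\<tau> ! p))"

lemma reset_pos: "x \<in> reset_clocks \<tau> \<Longrightarrow> reset_pos x < N \<and> x \<in> snd (\<tau> ! reset_pos x)"
  unfolding reset_pos_def
proof (rule someI_ex)
  assume "x \<in> reset_clocks \<tau>"
  then obtain t where t: "t \<in> set \<tau>" "x \<in> snd t" by (auto simp: reset_clocks_def)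
  then obtain p where "p < length \<tau>" "\<tau> ! p = t" by (metis in_set_conv_nth)
  then show "\<exists>p. p < N \<and> x \<in> snd (\<tau> ! p)" using t(2) unfolding N_def by blast
qed

lemma G_reset_edges:
  assumes "x \<in> reset_clocks \<tau>"
  shows "((3 * reset_pos x + 2 + l * (3 * N), x), wzero, (3 * reset_pos x + 2 + l * (3 * N), x0)) \<in> G"
    "((3 * reset_pos x + 2 + l * (3 * N), x0), wzero, (3 * reset_pos x + 2 + l * (3 * N), x)) \<in> G"
proof -
  let ?i = "reset_pos x + l * N"
  have "x \<in> snd (trn ?i)" using reset_pos[OF assms] by (simp add: trn_def)
  then obtain g R where t: "trn ?i = (g, R)" "x \<in> R" by (cases "trn ?i") auto
  have c: "3 * reset_pos x + 2 + l * (3 * N) = 3 * ?i + 2" by (simp add: algebra_simps)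
  show "((3 * reset_pos x + 2 + l * (3 * N), x), wzero, (3 * reset_pos x + 2 + l * (3 * N), x0)) \<in> G"
    "((3 * reset_pos x + 2 + l * (3 * N), x0), wzero, (3 * reset_pos x + 2 + l * (3 * N), x)) \<in> G"
    unfolding c by (rule G_trans_edge; use t in \<open>simp add: trans_edge_iff\<close>)+
qed

text \<open>Moving right is free for every clock. A reset of \<open>x\<close> is met within two
  periods, giving a free switch to \<open>x0\<close>, and a reset of \<open>y\<close> within two
  more, giving a free switch to \<open>y\<close>.\<close>

lemma jump:
  assumes "x \<in> reset_clocks \<tau>" "y \<in> reset_clocks \<tau>"
  shows "walk G (c, x) wzero (c + 4 * (3 * N), y)"
proof -
  have next_reset: "\<exists>l. c \<le> 3 * reset_pos x + 2 + l * (3 * N) \<and> 3 * reset_pos x + 2 + l * (3 * N) \<le> c + 2 * (3 * N)"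
    if "x \<in> reset_clocks \<tau>" for x c
  proof (intro exI conjI)
    let ?l = "Suc (c div (3 * N))"
    have p: "3 * reset_pos x + 2 < 3 * N" using reset_pos[OF that] by linarith
    have c: "c div (3 * N) * (3 * N) + c mod (3 * N) = c" by (rule div_mult_mod_eq)
    have "c mod (3 * N) < 3 * N" using N_pos by simp
    moreover have l: "?l * (3 * N) = c div (3 * N) * (3 * N) + 3 * N" by simp
    ultimately show "c \<le> 3 * reset_pos x + 2 + ?l * (3 * N)" using c by linarith
    show "3 * reset_pos x + 2 + ?l * (3 * N) \<le> c + 2 * (3 * N)" using p c l by linarith
  qed
  obtain l where l: "c \<le> 3 * reset_pos x + 2 + l * (3 * N)" "3 * reset_pos x + 2 + l * (3 * N) \<le> c + 2 * (3 * N)"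
    using next_reset[OF assms(1)] by blast
  define c1 where "c1 = 3 * reset_pos x + 2 + l * (3 * N)"
  obtain l' where l': "c1 \<le> 3 * reset_pos y + 2 + l' * (3 * N)" "3 * reset_pos y + 2 + l' * (3 * N) \<le> c1 + 2 * (3 * N)"
    using next_reset[OF assms(2)] by blast
  define c2 where "c2 = 3 * reset_pos y + 2 + l' * (3 * N)"
  have le: "c \<le> c1" "c1 \<le> c2" "c2 \<le> c + 4 * (3 * N)" using l l' unfolding c1_def c2_def by linarith+
  have right: "walk G (a, z) wzero (b, z)" if "a \<le> b" for a b z
    using walk_right[of a z "b - a"] that by simp
  have "walk G (c, x) wzero (c1, x0)"
    using walk_snoc[OF right[OF le(1)] G_reset_edges(1)[OF assms(1), of l, folded c1_def]] by simp
  moreover have "walk G (c1, x0) wzero (c2, y)"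
    using walk_snoc[OF right[OF le(2)] G_reset_edges(2)[OF assms(2), of l', folded c2_def]] by simp
  ultimately have "walk G (c, x) wzero (c2, y)" using walk_trans by fastforce
  from walk_trans[OF this right[OF le(3)]] show ?thesis by simp
qed

lemma walk_shift:
  "walk G u w v \<Longrightarrow> walk G (fst u + d * (3 * N), snd u) w (fst v + d * (3 * N), snd v)"
proof (induction rule: walk_induct)
  case (snoc w v w' z)
  have "((fst v + d * (3 * N), snd v), w', (fst z + d * (3 * N), snd z)) \<in> G"
    using snoc.hyps(2) by (simp only: shift_edge prod.collapse)
  then show ?case by (rule walk_snoc[OF snoc.IH])
qed simp

lemma iterate_loop:
  assumes "walk G (c, x) w (c + g * (3 * N), x)"
  shows "\<exists>w'. walk G (c, x) w' (c + k * g * (3 * N), x) \<and> snd w' = int k * snd w"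
proof (induction k)
  case (Suc k)
  then obtain w' where w': "walk G (c, x) w' (c + k * g * (3 * N), x)" "snd w' = int k * snd w" by blast
  have "walk G (c + k * g * (3 * N), x) w (c + Suc k * g * (3 * N), x)"
    using walk_shift[OF assms, of "k * g"] by (simp add: algebra_simps)
  from walk_trans[OF w'(1) this] show ?case
    using w'(2) by (intro exI[of _ "wadd w' w"]) (simp add: algebra_simps)
qed (auto intro: exI[of _ wzero])

lemma iterate_loop_down:
  assumes "walk G (c + g * (3 * N), x) w (c, x)"
  shows "\<exists>w'. walk G (c + k * g * (3 * N), x) w' (c, x) \<and> snd w' = int k * snd w"
proof (induction k)
  case (Suc k)
  then obtain w' where w': "walk G (c + k * g * (3 * N), x) w' (c, x)" "snd w' = int k * snd w" by blast
  have "walk G (c + Suc k * g * (3 * N), x) w (c + k * g * (3 * N), x)"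
    using walk_shift[OF assms, of "k * g"] by (simp add: algebra_simps)
  from walk_trans[OF this w'(1)] show ?case
    using w'(2) by (intro exI[of _ "wadd w w'"]) (simp add: algebra_simps)
qed (auto intro: exI[of _ wzero])

text \<open>
  Otherwise going round the loop at \<open>x\<close> often, moving right through the reference clock to \<open>y\<close> for
  free, and coming back along the loop at \<open>y\<close> joins two fixed vertices with arbitrarily small weight.
\<close>

lemma opposite_loops:
  assumes sat: "sat f G" and x: "x \<in> reset_clocks \<tau>" and y: "y \<in> reset_clocks \<tau>"
    and up: "walk G (c + i * (3 * N), x) w (c + (i + g) * (3 * N), x)"
    and down: "walk G (c + (j + g) * (3 * N), y) w' (c + j * (3 * N), y)"
  shows "0 \<le> snd w + snd w'"
proof (rule ccontr)
  assume "\<not> 0 \<le> snd w + snd w'"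
  \<comment> \<open>Integrality: a negative sum is at most -1, so every round gains at least
    1.\<close>
  then have neg: "snd w + snd w' \<le> -1" by simp
  \<comment> \<open>Shifting by \<open>j\<close> and by \<open>i + 4\<close> periods puts the loops
    at fixed places exactly four periods apart, the length of \<open>jump\<close>.\<close>
  define a where "a = c + (i + j) * (3 * N)"
  define b where "b = c + (i + j + 4) * (3 * N)"
  have up': "walk G (a, x) w (a + g * (3 * N), x)"
    using walk_shift[OF up, of j] by (simp add: a_def algebra_simps)
  have down': "walk G (b + g * (3 * N), y) w' (b, y)"
    using walk_shift[OF down, of "i + 4"] by (simp add: b_def algebra_simps)
  have bound: "f (b, y) - f (a, x) \<le> - real k" for k
  proof -
    obtain w1 where w1: "walk G (a, x) w1 (a + k * g * (3 * N), x)" "snd w1 = int k * snd w"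
      using iterate_loop[OF up'] by blast
    obtain w2 where w2: "walk G (b + k * g * (3 * N), y) w2 (b, y)" "snd w2 = int k * snd w'"
      using iterate_loop_down[OF down'] by blast
    have "walk G (a + k * g * (3 * N), x) wzero (b + k * g * (3 * N), y)"
      using jump[OF x y, of "a + k * g * (3 * N)"] by (simp add: a_def b_def algebra_simps)
    from walk_trans[OF w1(1) walk_trans[OF this w2(1)]]
    have "walk G (a, x) (wadd w1 (wadd wzero w2)) (b, y)" .
    moreover have "(a, x) \<noteq> (b, y)" using N_pos by (simp add: a_def b_def)
    ultimately have "wsat (f (b, y) - f (a, x)) (wadd w1 (wadd wzero w2))"
      using sat_path[OF sat walk_path] by blast
    then have "f (b, y) - f (a, x) \<le> of_int (snd w1 + snd w2)"
      by (auto simp: wsat_def split: if_splits)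
    also have "snd w1 + snd w2 = int k * (snd w + snd w')" by (simp add: w1 w2 algebra_simps)
    also have "\<dots> \<le> int k * (- 1)" using neg by (intro mult_left_mono) auto
    finally show ?thesis by simp
  qed
  obtain k where "f (a, x) - f (b, y) < real k" using reals_Archimedean2 by blast
  then show False using bound[of k] by simp
qed

text \<open>At the columns where \<open>z\<close> is reset the reference clock can be exchanged for
  \<open>z\<close>. The solution \<open>f\<close> gives \<open>pump\<close> through
  \<open>opposite_loops\<close>.\<close>

lemma strip_copies:
  assumes sat: "sat f G" and z: "z \<in> reset_clocks \<tau>"
  shows "strip (copies M) (M * (3 * N) - 1) (3 * N) (3 * reset_pos z + 2) (reset_clocks \<tau>) clocks"
proof
  let ?\<kappa> = "3 * reset_pos z + 2"
  have sub: "copies M \<subseteq> G" unfolding copies_def by (rule restr_subset)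
  show "0 < 3 * N" using N_pos by simp
  show "finite (reset_clocks \<tau>)" by simp
  show "reset_clocks \<tau> \<subseteq> clocks" by (auto simp: clocks_def)
  show "i \<le> M * (3 * N) - 1 \<and> j \<le> M * (3 * N) - 1 \<and> i \<le> Suc j \<and> j \<le> Suc i"
    if "((i, x), w, (j, y)) \<in> copies M" for i x w j y
    using that adjacent[of i x w j y] by (simp add: copies_def)
  show "((i + 3 * N, x), w, (j + 3 * N, y)) \<in> copies M \<longleftrightarrow> ((i, x), w, (j, y)) \<in> copies M"
    if "i + 3 * N \<le> M * (3 * N) - 1" "j + 3 * N \<le> M * (3 * N) - 1" for i x w j y
  proof -
    have "i \<le> M * (3 * N) - 1" "j \<le> M * (3 * N) - 1" using that by linarith+
    then show ?thesis using that by (simp only: copies_def restr_iff periodic) simp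
  qed
  show "x = y \<or> x \<in> clocks \<and> y \<in> clocks" if "((i, x), w, (j, y)) \<in> copies M" for i x w j y
    using closed_clocks that sub by blast
  show "\<exists>z'\<in>reset_clocks \<tau>. z' = x \<or>
      ((?\<kappa> + l * (3 * N), x), wzero, (?\<kappa> + l * (3 * N), z')) \<in> copies M \<and>
      ((?\<kappa> + l * (3 * N), z'), wzero, (?\<kappa> + l * (3 * N), x)) \<in> copies M"
    if "x \<in> clocks" "?\<kappa> + l * (3 * N) \<le> M * (3 * N) - 1" for x l
  proof (cases "x = x0")
    case True
    then show ?thesis using G_reset_edges[OF z, of l] that(2)
      by (intro bexI[OF _ z]) (simp add: copies_def)
  next
    case False
    then show ?thesis using that(1) by (auto simp: clocks_def)
  qed
  show "0 \<le> snd w + snd w'"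
    if "x \<in> reset_clocks \<tau>" "y \<in> reset_clocks \<tau>"
      "path (copies M) (?\<kappa> + i * (3 * N), x) w (?\<kappa> + (i + g) * (3 * N), x)"
      "path (copies M) (?\<kappa> + (j + g) * (3 * N), y) w' (?\<kappa> + j * (3 * N), y)" for x y g i w j w'
    using opposite_loops[OF sat that(1,2) walk_mono[OF path_walk[OF that(3)] sub]
        walk_mono[OF path_walk[OF that(4)] sub]] .
qed

text \<open>The reference clock is never reset; this turns the bound \<open>(card S + 1)^2\<close>
  of the strip into n^2.\<close>

lemma card_reset_clocks: "card (reset_clocks \<tau>) + 1 \<le> card (UNIV :: 'c set)"
proof -
  have "card (insert x0 (reset_clocks \<tau>)) \<le> card (UNIV :: 'c set)" by (rule card_mono) auto
  then show ?thesis using x0_not_reset(2) by simp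
qed

lemma start_clock:
  assumes "path (copies M) (a, x) w (b, y)" "x \<noteq> y"
  shows "x \<in> clocks"
proof -
  have "walk G (a, x) w (b, y)"
    using walk_mono[OF path_walk[OF assms(1)]] unfolding copies_def by (metis restr_subset)
  then show ?thesis using walk_clocks[of "(a, x)" w "(b, y)"] assms(2) by simp
qed

section \<open>Stabilisation of the powers\<close>

text \<open>Weights in \<open>2 * m\<close> copies cannot exceed those in \<open>m\<close> copies,
  as the graph is larger. For the converse, walks between vertices of an end column are lowered
  until they fit into the \<open>m\<close> copies next to it.\<close>

lemma bumpeq_summary:
  assumes sat: "sat f G" and big: "(card (UNIV :: 'c set))\<^sup>2 < 2 * m" and m: "even m" "0 < m"
  shows "bumpeq (summary (2 * m)) (summary m)"
proof -
  let ?C = "3 * N"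
  obtain z where z: "z \<in> reset_clocks \<tau>" using resets by blast
  \<comment> \<open>Chosen so that \<open>2 * m = 4 * (K + 1)\<close>, the quantity bounded by the
    strip argument. Cut \<open>2 * K\<close> lies in period number \<open>2 * K + 1\<close> counted
    from 1, still within the first \<open>m\<close>.\<close>
  define K where "K = m div 2 - 1"
  have K: "m = 2 * (K + 1)" using m unfolding K_def by (auto elim!: evenE)
  have "(card (reset_clocks \<tau>) + 1)\<^sup>2 \<le> (card (UNIV :: 'c set))\<^sup>2"
    by (rule power_mono[OF card_reset_clocks]) simp
  then have big': "(card (reset_clocks \<tau>) + 1)\<^sup>2 < 4 * (K + 1)" using big K by linarith
  define H where "H = 2 * m * ?C - 1"
  have mC: "1 < m * ?C" by (rule one_less[OF m(2)])
  have H: "Suc H = 2 * m * ?C" using mC by (simp add: H_def)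
  have Hm: "H = m * ?C - 1 + m * ?C" using mC by (simp add: H_def)
  interpret strip "copies (2 * m)" H ?C "3 * reset_pos z + 2" "reset_clocks \<tau>" clocks
    unfolding H_def by (rule strip_copies[OF sat z])
  have \<kappa>: "3 * reset_pos z + 2 < ?C" using reset_pos[OF z] by simp
  have "cut (2 * K) < Suc (2 * K) * ?C" using \<kappa> unfolding cut_def by simp
  also have "Suc (2 * K) * ?C \<le> m * ?C" unfolding K by (intro mult_le_mono1) simp
  finally have cut: "cut (2 * K) \<le> m * ?C - 1" by linarith
  have mono: "copies m \<subseteq> copies (2 * m)" by (rule copies_mono) simp
  have restr_copies: "restr (copies (2 * m)) lo hi \<subseteq> restr G lo hi" for lo hi
    unfolding copies_def using restr_subset by (auto simp: restr_def)
  have left_le: "\<exists>w'. wle w' w \<and> path (copies m) (0, x) w' (0, y)"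
    if p: "path (copies (2 * m)) (0, x) w (0, y)" and ne: "x \<noteq> y" for x y w
  proof -
    have "m * ?C - 1 \<le> H" by (simp add: Hm)
    from walk_from_bottom[OF big' cut this start_clock[OF p ne] path_walk[OF p]]
    obtain w' where w': "wle w' w" "cwalk (copies (2 * m)) 0 (m * ?C - 1) (0, x) w' (0, y)" by blast
    have "walk (copies m) (0, x) w' (0, y)"
      unfolding copies_def[of m] by (rule walk_mono[OF w'(2) restr_copies])
    then show ?thesis using w'(1) ne walk_path by fast
  qed
  have right_le: "\<exists>w'. wle w' w \<and> path (copies m) (m * ?C - 1, x) w' (m * ?C - 1, y)"
    if p: "path (copies (2 * m)) (H, x) w (H, y)" and ne: "x \<noteq> y" for x y w
  proof -
    have "2 * K < m" "m \<le> 2 * m" by (simp_all add: K)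
    from walk_from_top[OF H \<kappa> big' this start_clock[OF p ne] path_walk[OF p]]
    obtain w' where w': "wle w' w" "cwalk (copies (2 * m)) (H - (m * ?C - 1)) H (H, x) w' (H, y)" by blast
    have "H - (m * ?C - 1) = m * ?C" by (simp add: Hm)
    then have "cwalk G (m * ?C) H (H, x) w' (H, y)" using walk_mono[OF w'(2) restr_copies] by simp
    from cwalk_unshift[OF order.refl this]
    have "walk (copies m) (m * ?C - 1, x) w' (m * ?C - 1, y)" by (simp add: copies_def Hm)
    then show ?thesis using w'(1) ne walk_path by fast
  qed
  have right_ge: "\<exists>w'. wle w' w \<and> path (copies (2 * m)) (H, x) w' (H, y)"
    if p: "path (copies m) (m * ?C - 1, x) w (m * ?C - 1, y)" and ne: "x \<noteq> y" for x y w
  proof -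
    have "cwalk G (0 + m * ?C) (m * ?C - 1 + m * ?C) (H, x) w (H, y)"
      using cwalk_shift[OF path_walk[OF p, unfolded copies_def], of m] by (simp add: Hm)
    then have "walk (copies (2 * m)) (H, x) w (H, y)"
      unfolding copies_def H_def[symmetric] by (rule cwalk_mono) (simp_all add: Hm)
    from walk_path[OF this] show ?thesis using ne wle_refl by blast
  qed
  have left_ge: "\<exists>w'. wle w' w \<and> path (copies (2 * m)) (0, x) w' (0, y)"
    if p: "path (copies m) (0, x) w (0, y)" for x y w
    using path_mono[OF p mono] wle_refl by blast
  have edge: "((a, x), w, (b, y)) \<in> snd (summary (2 * m)) \<longleftrightarrow> ((a, x), w, (b, y)) \<in> snd (summary m)"
    if "a = b" for a b x y w
  proof (cases "a \<le> 1 \<and> x \<noteq> y")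
    case True
    consider "a = 0" | "a = 1" using True by linarith
    then show ?thesis
    proof cases
      case 1
      show ?thesis
        using min_weight_cong[of "copies (2 * m)" "(0, x)" "(0, y)" "copies m" "(0, x)" "(0, y)", OF left_le left_ge] True that 1
          one_less[OF m(2)] one_less[of "2 * m"] m(2)
        by (simp add: summary_def close_edge_iff end_col_def del: close.simps)
    next
      case 2
      have ab: "a = 1" "b = 1" using 2 that by simp_all
      have ec: "end_col (2 * m * ?C) 1 = H" "end_col (m * ?C) 1 = m * ?C - 1"
        by (simp_all add: end_col_def H_def)
      have "1 < m * ?C" "1 < 2 * m * ?C" using mC H by simp_all
      then show ?thesis
        using min_weight_cong[of "copies (2 * m)" "(H, x)" "(H, y)" "copies m" "(m * ?C - 1, x)" "(m * ?C - 1, y)",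
            OF right_le right_ge] True
        unfolding ab summary_def by (simp only: close_edge_iff ec) simp
    qed
  next
    case False
    then show ?thesis using that one_less[OF m(2)] one_less[of "2 * m"] m(2)
      by (auto simp: summary_def close_edge_iff simp del: close.simps)
  qed
  have "left (summary (2 * m)) = left (summary m)" "right (summary (2 * m)) = right (summary m)"
    unfolding left_def right_def by (rule edge_set_eqI; use edge in fastforce)+
  then show ?thesis by (simp add: bumpeq_def)
qed

section \<open>From runs to solutions of the unrolled graph and back\<close>

lemma trn_add: "trn (j * N + i) = trn i"
  by (simp add: trn_def)

lemma run_iff_trn_trace:
  "run x0 v \<tau> v' \<longleftrightarrow> (\<exists>ws ds. ws 0 = v \<and> ws N = v' \<and> (\<forall>i<N. step x0 (ws i) (trn i) (ds i) (ws (Suc i))))"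
  unfolding run_iff_trace N_def[symmetric] by (intro ex_cong1 conj_cong refl) (auto simp: trn_def)

lemma omega_iterable_from_iff:
  "omega_iterable_from x0 \<tau> v \<longleftrightarrow>
     (\<exists>ws ds. ws 0 = v \<and> (\<forall>i. step x0 (ws i) (trn i) (ds i) (ws (Suc i))))"
proof
  assume "omega_iterable_from x0 \<tau> v"
  then obtain vs where vs: "vs 0 = v" "\<And>j. run x0 (vs j) \<tau> (vs (Suc j))"
    unfolding omega_iterable_from_def by blast
  from vs(2)[unfolded run_iff_trn_trace]
  have "\<And>j. \<exists>W D. W 0 = vs j \<and> W N = vs (Suc j) \<and> (\<forall>i<N. step x0 (W i) (trn i) (D i) (W (Suc i)))" .
  from glue_traces[of N trn vs "\<lambda>v t d v'. step x0 v t d v'", OF N_pos trn_periodic this]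
  show "\<exists>ws ds. ws 0 = v \<and> (\<forall>i. step x0 (ws i) (trn i) (ds i) (ws (Suc i)))" unfolding vs(1) .
next
  assume "\<exists>ws ds. ws 0 = v \<and> (\<forall>i. step x0 (ws i) (trn i) (ds i) (ws (Suc i)))"
  then obtain ws ds where ws: "ws 0 = v" "\<And>i. step x0 (ws i) (trn i) (ds i) (ws (Suc i))" by blast
  have "run x0 (ws (j * N)) \<tau> (ws (Suc j * N))" for j
    unfolding run_iff_trn_trace
  proof (intro exI conjI allI impI)
    show "step x0 (ws (j * N + i)) (trn i) (ds (j * N + i)) (ws (j * N + Suc i))" for i
      using ws(2)[of "j * N + i"] by (simp add: trn_add)
  qed (simp_all add: add.commute)
  then show "omega_iterable_from x0 \<tau> v"
    unfolding omega_iterable_from_def using ws(1) by (intro exI[of _ "\<lambda>j. ws (j * N)"]) simp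
qed

lemma sat_of_omega_iterable:
  assumes "omega_iterable_from x0 \<tau> v" "valuation x0 v"
  shows "\<exists>f. sat f G \<and> (\<forall>x. f (0, x) = v x)"
proof -
  obtain ws ds where ws: "ws 0 = v" and st: "\<And>i. step x0 (ws i) (trn i) (ds i) (ws (Suc i))"
    using assms(1) unfolding omega_iterable_from_iff by blast
  have val: "valuation x0 (ws i)" for i
  proof (induction i)
    case (Suc i)
    show ?case by (rule step_valuation[OF st Suc x0_not_reset(1)])
  qed (simp add: ws assms(2))
  \<comment> \<open>\<open>T i\<close> is the absolute time before transition \<open>i\<close>.
    Columns \<open>3 * i\<close>, \<open>3 * i + 1\<close>, \<open>3 * i + 2\<close> hold the values
    before the delay, after it, and after the reset.\<close>
  define T where "T i = (\<Sum>j<i. ds j)" for i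
  define f where "f p = (case p of (c, x) \<Rightarrow>
      if c mod 3 = 0 then ws (c div 3) x - T (c div 3)
      else if c mod 3 = 1 then delay x0 (ws (c div 3)) (ds (c div 3)) x - T (Suc (c div 3))
      else ws (Suc (c div 3)) x - T (Suc (c div 3)))" for p
  have f: "f (3 * i, x) = ws i x - T i" "f (3 * i + 1, x) = delay x0 (ws i) (ds i) x - T (Suc i)"
    "f (3 * i + 2, x) = ws (Suc i) x - T (Suc i)" "f (3 * i + 3, x) = ws (Suc i) x - T (Suc i)" for i x
  proof -
    have "(3 * i + 1) mod 3 = 1" "(3 * i + 1) div 3 = i" "(3 * i + 2) mod 3 = 2" "(3 * i + 2) div 3 = i"
      "(3 * i + 3) mod 3 = 0" "(3 * i + 3) div 3 = Suc i" by presburger+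
    then show "f (3 * i, x) = ws i x - T i" "f (3 * i + 1, x) = delay x0 (ws i) (ds i) x - T (Suc i)"
      "f (3 * i + 2, x) = ws (Suc i) x - T (Suc i)" "f (3 * i + 3, x) = ws (Suc i) x - T (Suc i)"
      unfolding f_def by simp_all
  qed
  have "wsat (f (b, y) - f (a, x)) w" if "((a, x), w, (b, y)) \<in> G" for a x w b y
    using that unfolding G_edge_iff
  proof (elim disjE exE conjE)
    fix i assume i: "3 * i \<le> a" "3 * i \<le> b" "((a - 3 * i, x), w, (b - 3 * i, y)) \<in> snd (trans_graph x0 (trn i))"
    obtain g R where t: "trn i = (g, R)" by (cases "trn i")
    have "wsat (f (3 * i + (b - 3 * i), y) - f (3 * i + (a - 3 * i), x)) w"
    proof (rule sat_of_step[OF st[of i, unfolded t] val, where f = "\<lambda>c x. f (3 * i + c, x)" and T = "T i"])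
      show "x0 \<notin> R" using x0_not_reset(1)[of i] by (simp add: t)
      show "((a - 3 * i, x), w, (b - 3 * i, y)) \<in> snd (trans_graph x0 (g, R))" using i(3) by (simp add: t)
    qed (simp_all add: f f(2,3)[simplified] T_def)
    then show ?thesis using i(1,2) by simp
  next
    fix i assume "w = wzero" "y = x" "a = 3 * i + 2" "b = 3 * i + 3"
    then show ?thesis by (simp only: f wsat_wzero diff_self order.refl)
  next
    fix i assume "w = wzero" "y = x" "a = 3 * i + 3" "b = 3 * i + 2"
    then show ?thesis by (simp only: f wsat_wzero diff_self order.refl)
  qed
  then have "sat f G" unfolding sat_def by (simp add: split_paired_All)
  moreover have "f (0, x) = v x" for x using f(1)[of 0 x] by (simp add: ws T_def)
  ultimately show ?thesis by blast
qed

lemma copies_subset: "copies m \<subseteq> G"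
  unfolding copies_def by (rule restr_subset)

lemma sat_neg_free: "sat f G \<Longrightarrow> neg_free (copies m)"
  unfolding neg_free_def using sat_no_neg[OF sat_subset[OF _ copies_subset]] by blast

lemma left_summary_iff:
  assumes "0 < m"
  shows "((0, x), w, (0, y)) \<in> left (summary m) \<longleftrightarrow> x \<noteq> y \<and>
    (\<exists>w'. path (copies m) (0, x) w' (0, y)) \<and> w = min_weight (copies m) (0, x) (0, y)"
  using one_less[OF assms] by (simp add: left_def summary_def close_edge_iff end_col_def del: close.simps)

text \<open>Minimal weights imply all other path constraints, and closed paths hold trivially
  without negative cycles.\<close>

lemma zone_summary_iff:
  assumes m: "0 < m" and nf: "neg_free (copies m)"
  shows "v \<in> zone x0 (left (summary m)) \<longleftrightarrow>
    valuation x0 v \<and> (\<forall>x w y. path (copies m) (0, x) w (0, y) \<longrightarrow> wsat (v y - v x) w)"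
proof -
  have "v \<in> zone x0 (left (summary m)) \<longleftrightarrow> valuation x0 v \<and>
      (\<forall>x w y. ((0, x), w, (0, y)) \<in> left (summary m) \<longrightarrow> wsat (v y - v x) w)"
    by (simp add: zone_def wsat_def split_paired_All)
  also have "\<dots> \<longleftrightarrow> valuation x0 v \<and> (\<forall>x w y. path (copies m) (0, x) w (0, y) \<longrightarrow> wsat (v y - v x) w)"
  proof (intro conj_cong refl iffI allI impI)
    fix x w y
    assume Z: "\<forall>x w y. ((0, x), w, (0, y)) \<in> left (summary m) \<longrightarrow> wsat (v y - v x) w"
      and p: "path (copies m) (0, x) w (0, y)"
    show "wsat (v y - v x) w"
    proof (cases "x = y")
      case True
      then show ?thesis using nf p by (auto simp: neg_free_def wsat_0)
    next
      case False
      have "wsat (v y - v x) (min_weight (copies m) (0, x) (0, y))"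
        using Z p False by (simp add: left_summary_iff[OF m]) blast
      then show ?thesis
        using copies_min_weight[OF nf p] p by (auto simp: is_min_weight_def intro: wsat_mono)
    qed
  next
    fix x w y
    assume "\<forall>x w y. path (copies m) (0, x) w (0, y) \<longrightarrow> wsat (v y - v x) w"
      and "((0, x), w, (0, y)) \<in> left (summary m)"
    then show "wsat (v y - v x) w"
      using copies_min_weight[OF nf] by (auto simp: left_summary_iff[OF m] is_min_weight_def)
  qed
  finally show ?thesis .
qed

lemma zone_of_omega_iterable:
  assumes "omega_iterable_from x0 \<tau> v" "valuation x0 v" "0 < m"
  shows "v \<in> zone x0 (left (summary m))"
proof -
  obtain f where f: "sat f G" "\<And>x. f (0, x) = v x" using sat_of_omega_iterable[OF assms(1,2)] by blast
  then show ?thesis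
    using sat_path[OF sat_subset[OF f(1) copies_subset[of m]]] assms(2)
    by (subst zone_summary_iff[OF assms(3) sat_neg_free[OF f(1)]]) (simp flip: f(2))
qed

text \<open>A solution over \<open>2 * m\<close> copies is built but only the first \<open>m\<close>
  are run; the second half is a translate of \<open>m\<close> copies and certifies that the
  valuation reached is in the zone of \<open>m\<close> copies.\<close>

lemma zone_trace:
  assumes m: "0 < m" and nf: "neg_free (copies (2 * m))" and v: "v \<in> zone x0 (left (summary (2 * m)))"
  shows "\<exists>v'\<in>zone x0 (left (summary m)). \<exists>W D. W 0 = v \<and> W (m * N) = v' \<and>
    (\<forall>i<m * N. step x0 (W i) (trn i) (D i) (W (Suc i)))"
proof -
  have v': "valuation x0 v" "\<And>x w y. path (copies (2 * m)) (0, x) w (0, y) \<Longrightarrow> wsat (v y - v x) w"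
    using v m by (simp_all add: zone_summary_iff[OF _ nf])
  let ?A = "{0} \<times> (UNIV :: 'c set)" and ?B = "{0..2 * m * (3 * N) - 1} \<times> (UNIV :: 'c set)"
  have "\<exists>g. (\<forall>a\<in>?A. g a = v (snd a)) \<and>
      (\<forall>a\<in>?A \<union> ?B. \<forall>b\<in>?A \<union> ?B. \<forall>w. path (copies (2 * m)) a w b \<longrightarrow> wsat (g b - g a) w)"
    by (rule extend_assignment[OF nf copies_min_weight[OF nf]]) (use v'(2) in auto)
  then obtain g where g: "\<forall>a\<in>?A. g a = v (snd a)"
      "\<forall>a\<in>?A \<union> ?B. \<forall>b\<in>?A \<union> ?B. \<forall>w. path (copies (2 * m)) a w b \<longrightarrow> wsat (g b - g a) w"
    by blast
  have g0: "g (0, x) = v x" for x using g(1) by simp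
  have sat: "sat g (copies (2 * m))"
    unfolding sat_def
  proof (intro allI impI)
    fix u w z assume e: "(u, w, z) \<in> copies (2 * m)"
    then have "u \<in> ?B" "z \<in> ?B" by (auto simp: copies_def mem_Times_iff)
    then show "wsat (g z - g u) w" using g(2) path.edge[OF e] by blast
  qed
  define W where "W i = (\<lambda>x. g (3 * i, x) - g (3 * i, x0))" for i
  define D where "D i = g (3 * i, x0) - g (Suc (3 * i), x0)" for i
  have st: "step x0 (W i) (trn i) (D i) (W (Suc i))" if i: "i < m * N" for i
  proof -
    obtain gd R where t: "trn i = (gd, R)" by (cases "trn i")
    have small: "3 * i + 3 \<le> 2 * m * (3 * N) - 1" using i by simp
    have edge: "wsat (g (b, y) - g (a, x)) w"
      if "((a, x), w, (b, y)) \<in> G" "a \<le> 3 * i + 3" "b \<le> 3 * i + 3" for a x w b y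
      using that small sat unfolding sat_def copies_def by fastforce
    have "g (3 * i + 3, x) = g (3 * i + 2, x)" for x
    proof -
      have "((3 * i + 2, x), wzero, (3 * i + 3, x)) \<in> G" "((3 * i + 3, x), wzero, (3 * i + 2, x)) \<in> G"
        unfolding G_edge_iff by (intro disjI2 exI[of _ i]; simp)+
      from this[THEN edge] show ?thesis by (simp add: wsat_wzero)
    qed
    then have W: "W (Suc i) = (\<lambda>x. g (3 * i + 2, x) - g (3 * i + 2, x0))"
      by (simp add: W_def add.commute)
    have "step x0 (\<lambda>x. g (3 * i, x) - g (3 * i, x0)) (gd, R) (g (3 * i, x0) - g (Suc (3 * i), x0))
        (\<lambda>x. g (3 * i + 2, x) - g (3 * i + 2, x0))"
    proof (rule step_of_sat)
      fix a x w b y assume e: "((a, x), w, (b, y)) \<in> snd (trans_graph x0 (gd, R))"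
      then have "((3 * i + a, x), w, (3 * i + b, y)) \<in> G" by (intro G_trans_edge) (simp add: t)
      then show "wsat (g (3 * i + b, y) - g (3 * i + a, x)) w"
        using trans_edge_bound[OF e] by (intro edge) simp_all
    next
      show "x0 \<notin> R" using x0_not_reset(1)[of i] by (simp add: t)
    qed
    then show ?thesis by (simp only: W t) (simp only: W_def D_def)
  qed
  have W0: "W 0 = v" using v'(1) by (simp add: W_def g0 valuation_def)
  have val: "i \<le> m * N \<Longrightarrow> valuation x0 (W i)" for i
  proof (induction i)
    case (Suc i)
    show ?case
      by (rule step_valuation[OF st _ x0_not_reset(1)]) (use Suc in simp_all)
  qed (simp add: W0 v'(1))
  have "wsat (W (m * N) y - W (m * N) x) w" if p: "path (copies m) (0, x) w (0, y)" for x w y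
  proof -
    let ?C = "3 * N"
    have "cwalk G (0 + m * ?C) (m * ?C - 1 + m * ?C) (m * ?C, x) w (m * ?C, y)"
      using cwalk_shift[OF path_walk[OF p, unfolded copies_def], of m] by simp
    then have "walk (copies (2 * m)) (m * ?C, x) w (m * ?C, y)"
      unfolding copies_def by (rule cwalk_mono) simp_all
    then have "wsat (g (m * ?C, y) - g (m * ?C, x)) w"
      unfolding walk_def
    proof (elim disjE)
      assume "path (copies (2 * m)) (m * ?C, x) w (m * ?C, y)"
      then show ?thesis by (rule sat_path[OF sat])
    qed (simp add: wsat_wzero)
    then show ?thesis by (simp add: W_def mult.left_commute)
  qed
  then have "W (m * N) \<in> zone x0 (left (summary m))"
    using val neg_free_subset[OF nf copies_mono, of m] by (simp add: zone_summary_iff[OF m])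
  then show ?thesis using W0 st by blast
qed

text \<open>Stability identifies the zones of \<open>2 * m\<close> and \<open>m\<close> copies, so
  \<open>zone_trace\<close> leads from this zone back into it and can be repeated forever.\<close>

lemma omega_iterable_of_zone:
  assumes m: "0 < m" and nf: "neg_free (copies (2 * m))"
    and stable: "left (summary (2 * m)) = left (summary m)" and v: "v \<in> zone x0 (left (summary m))"
  shows "omega_iterable_from x0 \<tau> v"
proof -
  let ?Z = "zone x0 (left (summary m))"
  have "\<forall>v\<in>?Z. \<exists>v'. v' \<in> ?Z \<and> (\<exists>W D. W 0 = v \<and> W (m * N) = v' \<and>
      (\<forall>i<m * N. step x0 (W i) (trn i) (D i) (W (Suc i))))"
    using zone_trace[OF m nf] unfolding stable by blast
  then obtain next_v where nv: "\<And>v. v \<in> ?Z \<Longrightarrow> next_v v \<in> ?Z"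
      "\<And>v. v \<in> ?Z \<Longrightarrow> \<exists>W D. W 0 = v \<and> W (m * N) = next_v v \<and>
        (\<forall>i<m * N. step x0 (W i) (trn i) (D i) (W (Suc i)))"
    using bchoice[where S = ?Z] by metis
  define vs where "vs j = (next_v ^^ j) v" for j
  have vs: "vs j \<in> ?Z" for j
    by (induction j) (simp_all add: vs_def v nv(1))
  have "0 < m * N" using m N_pos by simp
  moreover have "trn (i + m * N) = trn i" for i by (simp add: trn_def)
  moreover have "\<exists>W D. W 0 = vs j \<and> W (m * N) = vs (Suc j) \<and>
      (\<forall>i<m * N. step x0 (W i) (trn i) (D i) (W (Suc i)))" for j
    using nv(2)[OF vs[of j]] by (simp add: vs_def)
  ultimately have "\<exists>ws ds. ws 0 = vs 0 \<and> (\<forall>i. step x0 (ws i) (trn i) (ds i) (ws (Suc i)))"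
    by (rule glue_traces[where P = "\<lambda>v t d v'. step x0 v t d v'"])
  then show ?thesis unfolding omega_iterable_from_iff by (simp add: vs_def)
qed

lemma seq_graph_copies: "seq_graph x0 \<tau> = (3 * N, copies 1)"
proof -
  have "\<tau> \<noteq> []" using N_pos by (simp add: N_def)
  moreover have "trn i = \<tau> ! i" if "i < length \<tau>" for i using that by (simp add: trn_def N_def)
  moreover have "copies 1 = restr (inf_graph x0 trn) 0 (3 * N - 1)" unfolding copies_def by (simp add: G_def)
  ultimately show ?thesis using seq_graph_inf[of \<tau> trn x0] unfolding N_def by simp
qed

lemma Gpow_summary: "neg_free (copies (2 ^ k)) \<Longrightarrow> Gpow x0 \<tau> k = summary (2 ^ k)"
proof (induction k)
  case 0
  show ?case by (simp add: seq_graph_copies summary_def del: close.simps)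
next
  case (Suc k)
  have nf: "neg_free (copies (2 * 2 ^ k))" using Suc.prems by simp
  have "neg_free (copies (2 ^ k))" by (rule neg_free_subset[OF nf copies_mono]) simp
  then show ?case using Suc.IH gmult_summary[OF _ nf] by simp
qed

lemma compose_neg_cycle:
  assumes "neg_free (copies (2 ^ k))"
  shows "has_neg_cycle (compose (Gpow x0 \<tau> k) (Gpow x0 \<tau> k)) \<longleftrightarrow> \<not> neg_free (copies (2 ^ Suc k))"
  unfolding Gpow_summary[OF assms] compose_summary has_neg_cycle_iff
  using neg_free_double[OF _ assms] neg_free_doubled[of "2 ^ k"] by auto

lemma reached_neg_free:
  assumes "reached x0 \<tau> n k"
  shows "neg_free (copies (2 ^ k))"
proof -
  have "j \<le> k \<Longrightarrow> neg_free (copies (2 ^ j))" for j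
  proof (induction j)
    case 0
    then show ?case
      using assms has_neg_cycle_iff[of "3 * N" "copies 1"] by (simp add: reached_def seq_graph_copies)
  next
    case (Suc j)
    then show ?case using assms compose_neg_cycle[of j] by (auto simp: reached_def)
  qed
  then show ?thesis by simp
qed

lemma omega_iterable_sat:
  assumes "omega_iterable x0 \<tau>"
  obtains f where "sat f G"
  using assms sat_of_omega_iterable unfolding omega_iterable_def by metis

text \<open>If \<open>\<tau>\<close> were iterable, the previous exponent \<open>j = k - 1\<close>
  would satisfy \<open>2 * 2 ^ j > n^2\<close>, so the powers would have been stable there and
  iteration \<open>k\<close> would not have been reached.\<close>

lemma stops_by_bound:
  assumes r: "reached x0 \<tau> (card (UNIV :: 'c set)) k" and big: "(card (UNIV :: 'c set))\<^sup>2 < 2 ^ k"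
  shows "\<not> omega_iterable x0 \<tau>"
proof
  assume "omega_iterable x0 \<tau>"
  then obtain f where sat: "sat f G" by (rule omega_iterable_sat)
  \<comment> \<open>A reset clock and \<open>x0\<close> give n \<ge> 2, hence
    \<open>2 ^ k > 4\<close> and \<open>2 < k\<close>; this makes \<open>2 ^ j\<close> even, as
    \<open>bumpeq_summary\<close> requires.\<close>
  have "0 < card (reset_clocks \<tau>)" using resets by (simp add: card_gt_0_iff)
  then have "2 \<le> card (UNIV :: 'c set)" using card_reset_clocks by linarith
  then have "2\<^sup>2 \<le> (card (UNIV :: 'c set))\<^sup>2" by (rule power_mono) simp
  then have k: "(2::nat) ^ 2 < 2 ^ k" using big by linarith
  then have "2 < k" by (rule power_less_imp_less_exp[rotated]) simp
  define j where "j = Suc (k - 2)"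
  have j: "k = Suc j" "0 < j" using \<open>2 < k\<close> by (simp_all add: j_def)
  have "(card (UNIV :: 'c set))\<^sup>2 < 2 * 2 ^ j" using big unfolding j(1) power_Suc .
  from bumpeq_summary[OF sat this] have "bumpeq (summary (2 ^ Suc j)) (summary (2 ^ j))"
    using j(2) unfolding power_Suc by simp
  then have "bumpeq (Gpow x0 \<tau> (Suc j)) (Gpow x0 \<tau> j)"
    by (simp only: Gpow_summary[OF sat_neg_free[OF sat]])
  moreover have "\<not> bumpeq (Gpow x0 \<tau> (Suc j)) (Gpow x0 \<tau> j)"
    using r j(1) unfolding reached_def by blast
  ultimately show False by blast
qed

lemma stops_by_stability:
  assumes r: "reached x0 \<tau> n k"
    and nc: "\<not> has_neg_cycle (compose (Gpow x0 \<tau> k) (Gpow x0 \<tau> k))"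
    and b: "bumpeq (Gpow x0 \<tau> (Suc k)) (Gpow x0 \<tau> k)"
  shows "zone x0 (left (Gpow x0 \<tau> k)) = {v. valuation x0 v \<and> omega_iterable_from x0 \<tau> v}"
proof -
  have nf: "neg_free (copies (2 ^ k))" by (rule reached_neg_free[OF r])
  have nf2: "neg_free (copies (2 ^ Suc k))" using nc compose_neg_cycle[OF nf] by blast
  have "left (summary (2 * 2 ^ k)) = left (summary (2 ^ k))"
    using b unfolding bumpeq_def Gpow_summary[OF nf] Gpow_summary[OF nf2] by simp
  from omega_iterable_of_zone[OF _ _ this] nf2
  have "omega_iterable_from x0 \<tau> v" if "v \<in> zone x0 (left (summary (2 ^ k)))" for v
    using that by simp
  then show ?thesis
    unfolding Gpow_summary[OF nf]
  proof (intro equalityI subsetI CollectI conjI)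
    show "v \<in> zone x0 (left (summary (2 ^ k)))"
      if "v \<in> {v. valuation x0 v \<and> omega_iterable_from x0 \<tau> v}" for v
      using that zone_of_omega_iterable[of v "2 ^ k"] by simp
  qed (simp_all add: zone_def)
qed

end

lemma timed_loop_reduce:
  assumes "wf_seq x0 \<sigma>" "has_pos_lower_reset \<sigma>"
  shows "timed_loop x0 (reduce \<sigma>)"
proof
  have r: "reset_clocks (reduce \<sigma>) = reset_clocks \<sigma>"
    by (auto simp: reset_clocks_def reduce_def split: prod.splits)
  show "wf_seq x0 (reduce \<sigma>)"
    using assms(1) unfolding wf_seq_def reduce_def by fastforce
  show "x \<in> reset_clocks (reduce \<sigma>)" if "t \<in> set (reduce \<sigma>)" "(x, r, c) \<in> set (fst t)" for t x r c
    using that unfolding r by (auto simp: reduce_def)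
  show "reset_clocks (reduce \<sigma>) \<noteq> {}"
    using assms(2) unfolding r has_pos_lower_reset_def by blast
qed

theorem mainTheorem19:
  fixes x0 :: "'c::finite" and \<sigma> :: "'c transition list"
  assumes "wf_seq x0 \<sigma>"
    and "\<not> C1 \<sigma>" and "\<not> C2 \<sigma>" and "\<not> C3 \<sigma>"
    and "has_pos_lower_reset \<sigma>"
  shows "(has_neg_cycle (seq_graph x0 (reduce \<sigma>)) \<longrightarrow> \<not> omega_iterable x0 (reduce \<sigma>))
    \<and> (\<forall>k. reached x0 (reduce \<sigma>) (card (UNIV :: 'c set)) k
           \<and> has_neg_cycle (compose (Gpow x0 (reduce \<sigma>) k) (Gpow x0 (reduce \<sigma>) k))
           \<longrightarrow> \<not> omega_iterable x0 (reduce \<sigma>))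
    \<and> (\<forall>k. reached x0 (reduce \<sigma>) (card (UNIV :: 'c set)) k
           \<and> \<not> has_neg_cycle (compose (Gpow x0 (reduce \<sigma>) k) (Gpow x0 (reduce \<sigma>) k))
           \<and> (2::nat) ^ k > (card (UNIV :: 'c set)) ^ 2
           \<longrightarrow> \<not> omega_iterable x0 (reduce \<sigma>))
    \<and> (\<forall>k. reached x0 (reduce \<sigma>) (card (UNIV :: 'c set)) k
           \<and> \<not> has_neg_cycle (compose (Gpow x0 (reduce \<sigma>) k) (Gpow x0 (reduce \<sigma>) k))
           \<and> \<not> (2::nat) ^ k > (card (UNIV :: 'c set)) ^ 2
           \<and> bumpeq (Gpow x0 (reduce \<sigma>) (Suc k)) (Gpow x0 (reduce \<sigma>) k)
           \<longrightarrow> zone x0 (left (Gpow x0 (reduce \<sigma>) k))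
               = {v. valuation x0 v \<and> omega_iterable_from x0 (reduce \<sigma>) v})"
proof -
  interpret timed_loop x0 "reduce \<sigma>" by (rule timed_loop_reduce) (rule assms)+
  \<comment> \<open>A run gives a solution of the whole unrolled graph, so a negative cycle in any
    number of copies refutes iterability.\<close>
  have neg: "\<not> omega_iterable x0 (reduce \<sigma>)" if "\<not> neg_free (copies m)" for m
    using that omega_iterable_sat sat_neg_free by blast
  show ?thesis
  proof (intro conjI allI impI; (elim conjE)?)
    assume "has_neg_cycle (seq_graph x0 (reduce \<sigma>))"
    then show "\<not> omega_iterable x0 (reduce \<sigma>)" using neg[of 1] by (simp add: seq_graph_copies has_neg_cycle_iff)
  next
    fix k
    assume "reached x0 (reduce \<sigma>) (card (UNIV :: 'c set)) k"
      and "has_neg_cycle (compose (Gpow x0 (reduce \<sigma>) k) (Gpow x0 (reduce \<sigma>) k))"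
    then show "\<not> omega_iterable x0 (reduce \<sigma>)" using neg compose_neg_cycle reached_neg_free by blast
  qed (use stops_by_bound stops_by_stability in blast)+
qed

end
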